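(* Let $(\mathcal C,\mathrm{Ty},\mathrm{Tm})$ be a category with families (with $\mathcal C$ small) supporting the usual type formers listed in the context. If $\mathcal C$ has exo-nat products, then in the presheaf two-level category with families $(\widehat{\mathcal C},\widehat{\mathrm{Ty}},\widehat{\mathrm{Tm}},\mathrm{Ty}^f,\mathrm{Tm}^f)$ built from $(\mathcal C,\mathrm{Ty},\mathrm{Tm})$, the natural number exo-type $\mathbb N^e\in\widehat{\mathrm{Ty}}(1_{\widehat{\mathcal C}})$ is a cofibrant exo-type.
   Context: **CwF.** A category with families (CwF) is a category $\mathcal C$ (objects: contexts) with a terminal object $1_{\mathcal C}$, a presheaf $\mathrm{Ty}:\mathcal C^{op}\to\mathrm{Set}$, a presheaf $\mathrm{Tm}:(\int\mathrm{Ty})^{op}\to\mathrm{Set}$, and for each $\Gamma$ and $A\in\mathrm{Ty}(\Gamma)$ a context $\Gamma.A$, a morphism $p_A:\Gamma.A\to\Gamma$ and a term $q_A\in\mathrm{Tm}(\Gamma.A,A[p_A])$ such that for all $\sigma:\Delta\to\Gamma$ and $a\in\mathrm{Tm}(\Delta,A[\sigma])$ there is a unique $\theta:\Delta\to\Gamma.A$ with $p_A\circ\theta=\sigma$ and $q_A[\theta]=a$. Here $X[\sigma]$ denotes the action of a presheaf on a morphism $\sigma$ (substitution). **Type formers.** The CwF is assumed to support, in the usual sense and strictly stably under substitution: $\Pi$-types (with $\beta,\eta$), $\Sigma$-types (with $\beta,\eta$), unit, empty type, coproducts, natural numbers, and intensional identity types $\mathrm{Id}$ (with $\mathrm{refl}$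 and $J$, and the $\beta$ rule for $J$). For a type $A\in \mathrm{Ty}(\Gamma)$, $\mathrm{isContr}(A):=\Sigma(A,\Pi(A[p_A],\mathrm{Id}_A))\in\mathrm{Ty}(\Gamma)$. **Exo-nat products.** Let $\mathbf N$ be the (external) set of natural numbers. $\mathcal C$ has exo-nat products if for each $\Gamma$ there is a map $\Omega_\Gamma:\prod_{\mathbf N}\mathrm{Ty}(\Gamma)\to\mathrm{Ty}(\Gamma)$ such that for any $Y=(Y_a)_{a\in\mathbf N}$: (1) there is a bijection $\phi:\mathrm{Tm}(\Gamma,\Omega_\Gamma(Y))\cong\prod_{a\in\mathbf N}\mathrm{Tm}(\Gamma,Y_a)$ with inverse $\psi$; (2) if $d,c\in\prod_{a\in\mathbf N}\mathrm{Tm}(\Gamma,Y_a)$ are such that for each $a$ there is a term of $\mathrm{Id}(d_a,c_a)$ (identity type of $Y_a$), then there is a term of $\mathrm{Id}(\psi(d),\psi(c))$ (identity type of $\Omega_\Gamma(Y)$); and all these data (the maps $\Omega_\Gamma$, the bijections, and the assignment of a term of $\mathrm{Id}(\psi(d),\psi(c))$ to terms of the $\mathrm{Id}(d_a,c_a)$) are natural in $\Gamma$, i.e. commute with substitution. **Two-level CwF.** A two-level CwF is a CwF $(\mathcal D,\mathrm{Ty}^e,\mathrm{Tm}^e)$ with a second presheaf $\mathrm{Ty}^f:\mathcal D^{op}\to\mathrm{Set}$ and a natural transformation $c:\mathrm{Ty}^f\to\mathrm{Ty}^e$. Then $\mathrm{Tm}^f(\Gamma,A):=\mathrm{Tm}^e(\Gamma,c_\Gamma(A))$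 and $\Gamma.A:=\Gamma.c_\Gamma(A)$ give a second CwF structure. Elements of $\mathrm{Ty}^e$ are exo-types, elements of $\mathrm{Ty}^f$ are types. **Presheaf two-level CwF.** Let $\widehat{\mathcal C}$ be the category of presheaves on $\mathcal C$. For $P\in\widehat{\mathcal C}$, $\widehat{\mathrm{Ty}}(P)$ is the set of presheaves $A:(\int P)^{op}\to\mathrm{Set}$ on the category of elements of $P$; for $\phi:Q\to P$, $A[\phi](\Gamma,x)=A(\Gamma,\phi_\Gamma(x))$; $\widehat{\mathrm{Tm}}(P,A)$ is the set of families $a(\Gamma,x)\in A(\Gamma,x)$ ($\Gamma\in\mathcal C$, $x\in P(\Gamma)$) with $a(\Gamma,x)[\sigma]=a(\Delta,x[\sigma])$ for all $\sigma:\Delta\to\Gamma$; and $P.A(\Gamma)=\coprod_{x\in P(\Gamma)}A(\Gamma,x)$. For $A\in\widehat{\mathrm{Ty}}(P)$ and $B\in\widehat{\mathrm{Ty}}(P.A)$, $\Pi^e(A,B)(\Gamma,x)$ is the set of families $f(\Delta,\sigma,a)\in B(\Delta,(x[\sigma],a))$, indexed by $\Delta\in\mathcal C$, $\sigma:\Delta\to\Gamma$, $a\in A(\Delta,x[\sigma])$, with $f(\Delta,\sigma,a)[\tau]=f(\Theta,\sigma\circ\tau,a[\tau])$ for all $\tau:\Theta\to\Delta$. The exo-type $\mathbb N^e\in\widehat{\mathrm{Ty}}(1_{\widehat{\mathcal C}})$ is the constant presheaf with value $\mathbf N$. The second level is $\mathrm{Ty}^f(P):=\widehat{\mathcal C}(P,\mathrm{Ty})$,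 with $c_P(A)(\Gamma,x):=\mathrm{Tm}(\Gamma,A_\Gamma(x))$ for $A\in\mathrm{Ty}^f(P)$, $x\in P(\Gamma)$, and $\mathrm{Tm}^f(P,A):=\widehat{\mathrm{Tm}}(P,c_P(A))$. The type formers of $(\mathcal C,\mathrm{Ty},\mathrm{Tm})$ are inherited pointwise by $(\mathrm{Ty}^f,\mathrm{Tm}^f)$; e.g. for $A\in\mathrm{Ty}^f(P)$, $B\in\mathrm{Ty}^f(P.A)$, $\Pi(A,B)_\Gamma(x)=\Pi\bigl(A_\Gamma(x),\,B_{\Gamma.A_\Gamma(x)}(x[p],q)\bigr)$, and similarly for $\Sigma$ and $\mathrm{Id}$; hence $\mathrm{isContr}$ makes sense for $\mathrm{Ty}^f$. **Cofibrant exo-type (semantic).** In a two-level CwF $(\mathcal D,\mathrm{Ty}^e,\mathrm{Tm}^e,\mathrm{Ty}^f,\mathrm{Tm}^f)$ with conversion $c$ and enough type formers, an exo-type $A\in\mathrm{Ty}^e(\Gamma)$ is cofibrant if for any $\Delta$ and $\sigma:\Delta\to\Gamma$: (1) there is a map, natural in $\Delta$, $\Theta^{\mathrm{Ty}}_\Delta:\mathrm{Ty}^f(\Delta.A[\sigma])\to\mathrm{Ty}^f(\Delta)$ such that for any $Y\in\mathrm{Ty}^f(\Delta.A[\sigma])$ there is an isomorphism, natural in $\Delta$, $c_\Delta(\Theta^{\mathrm{Ty}}_\Delta(Y))\cong\Pi^e(A[\sigma],c_{\Delta.A[\sigma]}(Y))$ of exo-types over $\Delta$; (2) there is a map, natural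 in $\Delta$, $\Theta^{\mathrm{Tm}}_\Delta:\mathrm{Tm}^f(\Delta.A[\sigma],\mathrm{isContr}(Y))\to\mathrm{Tm}^f(\Delta,\mathrm{isContr}(\Theta^{\mathrm{Ty}}_\Delta(Y)))$ for each such $Y$. Natural in $\Delta$ means compatible with substitution along every $\tau:\Upsilon\to\Delta$. *)

theory Defs
  imports Main
begin

section \<open>Categories with families\<close>

record ('o, 'm) cat =
  Obj :: "'o set"
  Arr :: "'m set"
  Dom :: "'m \<Rightarrow> 'o"
  Cod :: "'m \<Rightarrow> 'o"
  idn :: "'o \<Rightarrow> 'm"
  cmp :: "'m \<Rightarrow> 'm \<Rightarrow> 'm"  (infixl \<open>\<odot>\<index>\<close> 80)

definition hom :: "('o, 'm, 'z) cat_scheme \<Rightarrow> 'o \<Rightarrow> 'o \<Rightarrow> 'm set" where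
  "hom C \<Delta> \<Gamma> = {\<sigma> \<in> Arr C. Dom C \<sigma> = \<Delta> \<and> Cod C \<sigma> = \<Gamma>}"

locale category =
  fixes C :: "('o, 'm, 'z) cat_scheme" (structure)
  assumes dom_obj: "\<sigma> \<in> Arr C \<Longrightarrow> Dom C \<sigma> \<in> Obj C"
    and cod_obj: "\<sigma> \<in> Arr C \<Longrightarrow> Cod C \<sigma> \<in> Obj C"
    and idn_hom: "\<Gamma> \<in> Obj C \<Longrightarrow> idn C \<Gamma> \<in> hom C \<Gamma> \<Gamma>"
    and cmp_hom: "\<lbrakk>\<sigma> \<in> hom C \<Delta> \<Gamma>; \<tau> \<in> hom C \<Theta> \<Delta>\<rbrakk> \<Longrightarrow> \<sigma> \<odot> \<tau> \<in> hom C \<Theta> \<Gamma>"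
    and cmp_idn: "\<sigma> \<in> hom C \<Delta> \<Gamma> \<Longrightarrow> \<sigma> \<odot> idn C \<Delta> = \<sigma>"
    and idn_cmp: "\<sigma> \<in> hom C \<Delta> \<Gamma> \<Longrightarrow> idn C \<Gamma> \<odot> \<sigma> = \<sigma>"
    and cmp_assoc: "\<lbrakk>\<sigma> \<in> hom C \<Delta> \<Gamma>; \<tau> \<in> hom C \<Theta> \<Delta>; \<rho> \<in> hom C \<Xi> \<Theta>\<rbrakk>
      \<Longrightarrow> \<sigma> \<odot> \<tau> \<odot> \<rho> = \<sigma> \<odot> (\<tau> \<odot> \<rho>)"

text \<open>
  \<open>A \<cdot> \<sigma>\<close> is the substituted type \<open>A[\<sigma>]\<close> and \<open>tmsub C A a \<sigma>\<close> is the substituted term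
  \<open>a[\<sigma>]\<close>.  The latter takes the type \<open>A\<close> of \<open>a\<close> as an argument because a presheaf on the
  category of elements of \<open>Ty\<close> acts along arrows \<open>\<sigma> : (\<Delta>, A[\<sigma>]) \<rightarrow> (\<Gamma>, A)\<close>, and the sets of terms
  of different types are not required to be disjoint.  The context extension \<open>\<Gamma>.A\<close> is \<open>cext C \<Gamma> A\<close>.
\<close>

record ('o, 'm, 't, 'a) cwf = "('o, 'm) cat" +
  One :: 'o
  Ty :: "'o \<Rightarrow> 't set"
  tysub :: "'t \<Rightarrow> 'm \<Rightarrow> 't"  (infixl \<open>\<cdot>\<index>\<close> 75)
  Tm :: "'o \<Rightarrow> 't \<Rightarrow> 'a set"
  tmsub :: "'t \<Rightarrow> 'a \<Rightarrow> 'm \<Rightarrow> 'a"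
  cext :: "'o \<Rightarrow> 't \<Rightarrow> 'o"
  pp :: "'o \<Rightarrow> 't \<Rightarrow> 'm"
  qq :: "'o \<Rightarrow> 't \<Rightarrow> 'a"

locale cwf = category C
  for C :: "('o, 'm, 't, 'a, 'z) cwf_scheme" (structure) +
  assumes One_obj: "One C \<in> Obj C"
    and One_terminal: "\<Gamma> \<in> Obj C \<Longrightarrow> \<exists>!\<sigma>. \<sigma> \<in> hom C \<Gamma> (One C)"
    and tysub_Ty: "\<lbrakk>A \<in> Ty C \<Gamma>; \<sigma> \<in> hom C \<Delta> \<Gamma>\<rbrakk> \<Longrightarrow> A \<cdot> \<sigma> \<in> Ty C \<Delta>"
    and tysub_idn: "\<lbrakk>\<Gamma> \<in> Obj C; A \<in> Ty C \<Gamma>\<rbrakk> \<Longrightarrow> A \<cdot> idn C \<Gamma> = A"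
    and tysub_cmp: "\<lbrakk>A \<in> Ty C \<Gamma>; \<sigma> \<in> hom C \<Delta> \<Gamma>; \<tau> \<in> hom C \<Theta> \<Delta>\<rbrakk> \<Longrightarrow> A \<cdot> (\<sigma> \<odot> \<tau>) = A \<cdot> \<sigma> \<cdot> \<tau>"
    and tmsub_Tm: "\<lbrakk>A \<in> Ty C \<Gamma>; a \<in> Tm C \<Gamma> A; \<sigma> \<in> hom C \<Delta> \<Gamma>\<rbrakk>
      \<Longrightarrow> tmsub C A a \<sigma> \<in> Tm C \<Delta> (A \<cdot> \<sigma>)"
    and tmsub_idn: "\<lbrakk>\<Gamma> \<in> Obj C; A \<in> Ty C \<Gamma>; a \<in> Tm C \<Gamma> A\<rbrakk> \<Longrightarrow> tmsub C A a (idn C \<Gamma>) = a"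
    and tmsub_cmp: "\<lbrakk>A \<in> Ty C \<Gamma>; a \<in> Tm C \<Gamma> A; \<sigma> \<in> hom C \<Delta> \<Gamma>; \<tau> \<in> hom C \<Theta> \<Delta>\<rbrakk>
      \<Longrightarrow> tmsub C A a (\<sigma> \<odot> \<tau>) = tmsub C (A \<cdot> \<sigma>) (tmsub C A a \<sigma>) \<tau>"
    and cext_obj: "\<lbrakk>\<Gamma> \<in> Obj C; A \<in> Ty C \<Gamma>\<rbrakk> \<Longrightarrow> cext C \<Gamma> A \<in> Obj C"
    and pp_hom: "\<lbrakk>\<Gamma> \<in> Obj C; A \<in> Ty C \<Gamma>\<rbrakk> \<Longrightarrow> pp C \<Gamma> A \<in> hom C (cext C \<Gamma> A) \<Gamma>"
    and qq_Tm: "\<lbrakk>\<Gamma> \<in> Obj C; A \<in> Ty C \<Gamma>\<rbrakk> \<Longrightarrow> qq C \<Gamma> A \<in> Tm C (cext C \<Gamma> A) (A \<cdot> pp C \<Gamma> A)"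
    and cext_universal: "\<lbrakk>A \<in> Ty C \<Gamma>; \<sigma> \<in> hom C \<Delta> \<Gamma>; a \<in> Tm C \<Delta> (A \<cdot> \<sigma>)\<rbrakk>
      \<Longrightarrow> \<exists>!\<theta>. \<theta> \<in> hom C \<Delta> (cext C \<Gamma> A) \<and> pp C \<Gamma> A \<odot> \<theta> = \<sigma>
                \<and> tmsub C (A \<cdot> pp C \<Gamma> A) (qq C \<Gamma> A) \<theta> = a"

definition sext :: "('o, 'm, 't, 'a, 'z) cwf_scheme \<Rightarrow> 'm \<Rightarrow> 't \<Rightarrow> 'a \<Rightarrow> 'm"
    (\<open>\<langle>_; _; _\<rangle>\<index>\<close>) where
  "\<langle>\<sigma>; A; a\<rangle>\<^bsub>C\<^esub> = (THE \<theta>. \<theta> \<in> hom C (Dom C \<sigma>) (cext C (Cod C \<sigma>) A)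
      \<and> pp C (Cod C \<sigma>) A \<odot>\<^bsub>C\<^esub> \<theta> = \<sigma>
      \<and> tmsub C (A \<cdot>\<^bsub>C\<^esub> pp C (Cod C \<sigma>) A) (qq C (Cod C \<sigma>) A) \<theta> = a)"

text \<open>\<open>sect C \<Gamma> A a : \<Gamma> \<rightarrow> \<Gamma>.A\<close> is the section given by a term \<open>a\<close>, and
  \<open>\<sigma> \<up> A : \<Delta>.A[\<sigma>] \<rightarrow> \<Gamma>.A\<close> is the weakening of \<open>\<sigma> : \<Delta> \<rightarrow> \<Gamma>\<close>.\<close>

definition sect :: "('o, 'm, 't, 'a, 'z) cwf_scheme \<Rightarrow> 'o \<Rightarrow> 't \<Rightarrow> 'a \<Rightarrow> 'm" where
  "sect C \<Gamma> A a = \<langle>idn C \<Gamma>; A; a\<rangle>\<^bsub>C\<^esub>"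

definition lift :: "('o, 'm, 't, 'a, 'z) cwf_scheme \<Rightarrow> 'm \<Rightarrow> 't \<Rightarrow> 'm"  (infixl \<open>\<up>\<index>\<close> 82) where
  "\<sigma> \<up>\<^bsub>C\<^esub> A = \<langle>\<sigma> \<odot>\<^bsub>C\<^esub> pp C (Dom C \<sigma>) (A \<cdot>\<^bsub>C\<^esub> \<sigma>); A; qq C (Dom C \<sigma>) (A \<cdot>\<^bsub>C\<^esub> \<sigma>)\<rangle>\<^bsub>C\<^esub>"

section \<open>Type formers\<close>

text \<open>\<open>Idt C \<Gamma> A\<close> is the identity type in its generic context \<open>\<Gamma>.A.A[p]\<close>;
  \<open>IdT C \<Gamma> A a b\<close> is its instance at two terms.\<close>

record ('o, 'm, 't, 'a) cwf_psi = "('o, 'm, 't, 'a) cwf" +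
  Pi :: "'o \<Rightarrow> 't \<Rightarrow> 't \<Rightarrow> 't"
  Sig :: "'o \<Rightarrow> 't \<Rightarrow> 't \<Rightarrow> 't"
  Idt :: "'o \<Rightarrow> 't \<Rightarrow> 't"

definition IdT :: "('o, 'm, 't, 'a, 'z) cwf_psi_scheme \<Rightarrow> 'o \<Rightarrow> 't \<Rightarrow> 'a \<Rightarrow> 'a \<Rightarrow> 't" where
  "IdT C \<Gamma> A a b = Idt C \<Gamma> A \<cdot>\<^bsub>C\<^esub> \<langle>sect C \<Gamma> A a; A \<cdot>\<^bsub>C\<^esub> pp C \<Gamma> A; b\<rangle>\<^bsub>C\<^esub>"

definition isContr :: "('o, 'm, 't, 'a, 'z) cwf_psi_scheme \<Rightarrow> 'o \<Rightarrow> 't \<Rightarrow> 't" where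
  "isContr C \<Gamma> A = Sig C \<Gamma> A (Pi C (cext C \<Gamma> A) (A \<cdot>\<^bsub>C\<^esub> pp C \<Gamma> A) (Idt C \<Gamma> A))"

text \<open>
  \<open>app C \<Gamma> A B f\<close> is the generic application \<open>f[p] q\<close>, a term of \<open>B\<close> in context \<open>\<Gamma>.A\<close>; the
  application of \<open>f\<close> to \<open>a\<close> is its substitution along \<open>sect C \<Gamma> A a\<close>.  The eliminators of the
  inductive types are likewise given in the generic context: \<open>natrec C \<Gamma> P z s\<close>, for instance, is
  a term of \<open>P\<close> in context \<open>\<Gamma>.N\<close>.
\<close>

record ('o, 'm, 't, 'a) cwf_tt = "('o, 'm, 't, 'a) cwf_psi" +
  lam :: "'o \<Rightarrow> 't \<Rightarrow> 't \<Rightarrow> 'a \<Rightarrow> 'a"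
  app :: "'o \<Rightarrow> 't \<Rightarrow> 't \<Rightarrow> 'a \<Rightarrow> 'a"
  mkpair :: "'o \<Rightarrow> 't \<Rightarrow> 't \<Rightarrow> 'a \<Rightarrow> 'a \<Rightarrow> 'a"
  pfst :: "'o \<Rightarrow> 't \<Rightarrow> 't \<Rightarrow> 'a \<Rightarrow> 'a"
  psnd :: "'o \<Rightarrow> 't \<Rightarrow> 't \<Rightarrow> 'a \<Rightarrow> 'a"
  UnitT :: "'o \<Rightarrow> 't"
  star :: "'o \<Rightarrow> 'a"
  unitrec :: "'o \<Rightarrow> 't \<Rightarrow> 'a \<Rightarrow> 'a"
  EmptyT :: "'o \<Rightarrow> 't"
  emptyrec :: "'o \<Rightarrow> 't \<Rightarrow> 'a"
  Cop :: "'o \<Rightarrow> 't \<Rightarrow> 't \<Rightarrow> 't"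
  inlt :: "'o \<Rightarrow> 't \<Rightarrow> 't \<Rightarrow> 'a \<Rightarrow> 'a"
  inrt :: "'o \<Rightarrow> 't \<Rightarrow> 't \<Rightarrow> 'a \<Rightarrow> 'a"
  coprec :: "'o \<Rightarrow> 't \<Rightarrow> 't \<Rightarrow> 't \<Rightarrow> 'a \<Rightarrow> 'a \<Rightarrow> 'a"
  NatT :: "'o \<Rightarrow> 't"
  zerot :: "'o \<Rightarrow> 'a"
  succt :: "'o \<Rightarrow> 'a \<Rightarrow> 'a"
  natrec :: "'o \<Rightarrow> 't \<Rightarrow> 'a \<Rightarrow> 'a \<Rightarrow> 'a"
  reflt :: "'o \<Rightarrow> 't \<Rightarrow> 'a"
  Jt :: "'o \<Rightarrow> 't \<Rightarrow> 't \<Rightarrow> 'a \<Rightarrow> 'a"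

locale cwf_Pi = cwf C for C :: "('o, 'm, 't, 'a, 'z) cwf_tt_scheme" (structure) +
  assumes Pi_Ty: "\<lbrakk>\<Gamma> \<in> Obj C; A \<in> Ty C \<Gamma>; B \<in> Ty C (cext C \<Gamma> A)\<rbrakk> \<Longrightarrow> Pi C \<Gamma> A B \<in> Ty C \<Gamma>"
    and lam_Tm: "\<lbrakk>\<Gamma> \<in> Obj C; A \<in> Ty C \<Gamma>; B \<in> Ty C (cext C \<Gamma> A); b \<in> Tm C (cext C \<Gamma> A) B\<rbrakk>
      \<Longrightarrow> lam C \<Gamma> A B b \<in> Tm C \<Gamma> (Pi C \<Gamma> A B)"
    and app_Tm: "\<lbrakk>\<Gamma> \<in> Obj C; A \<in> Ty C \<Gamma>; B \<in> Ty C (cext C \<Gamma> A); f \<in> Tm C \<Gamma> (Pi C \<Gamma> A B)\<rbrakk>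
      \<Longrightarrow> app C \<Gamma> A B f \<in> Tm C (cext C \<Gamma> A) B"
    and Pi_beta: "\<lbrakk>\<Gamma> \<in> Obj C; A \<in> Ty C \<Gamma>; B \<in> Ty C (cext C \<Gamma> A); b \<in> Tm C (cext C \<Gamma> A) B\<rbrakk>
      \<Longrightarrow> app C \<Gamma> A B (lam C \<Gamma> A B b) = b"
    and Pi_eta: "\<lbrakk>\<Gamma> \<in> Obj C; A \<in> Ty C \<Gamma>; B \<in> Ty C (cext C \<Gamma> A); f \<in> Tm C \<Gamma> (Pi C \<Gamma> A B)\<rbrakk>
      \<Longrightarrow> lam C \<Gamma> A B (app C \<Gamma> A B f) = f"
    and Pi_sub: "\<lbrakk>\<sigma> \<in> hom C \<Delta> \<Gamma>; A \<in> Ty C \<Gamma>; B \<in> Ty C (cext C \<Gamma> A)\<rbrakk>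
      \<Longrightarrow> Pi C \<Gamma> A B \<cdot> \<sigma> = Pi C \<Delta> (A \<cdot> \<sigma>) (B \<cdot> (\<sigma> \<up> A))"
    and lam_sub: "\<lbrakk>\<sigma> \<in> hom C \<Delta> \<Gamma>; A \<in> Ty C \<Gamma>; B \<in> Ty C (cext C \<Gamma> A); b \<in> Tm C (cext C \<Gamma> A) B\<rbrakk>
      \<Longrightarrow> tmsub C (Pi C \<Gamma> A B) (lam C \<Gamma> A B b) \<sigma>
        = lam C \<Delta> (A \<cdot> \<sigma>) (B \<cdot> (\<sigma> \<up> A)) (tmsub C B b (\<sigma> \<up> A))"
    and app_sub: "\<lbrakk>\<sigma> \<in> hom C \<Delta> \<Gamma>; A \<in> Ty C \<Gamma>; B \<in> Ty C (cext C \<Gamma> A); f \<in> Tm C \<Gamma> (Pi C \<Gamma> A B)\<rbrakk>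
      \<Longrightarrow> tmsub C B (app C \<Gamma> A B f) (\<sigma> \<up> A)
        = app C \<Delta> (A \<cdot> \<sigma>) (B \<cdot> (\<sigma> \<up> A)) (tmsub C (Pi C \<Gamma> A B) f \<sigma>)"

locale cwf_Sigma = cwf C for C :: "('o, 'm, 't, 'a, 'z) cwf_tt_scheme" (structure) +
  assumes Sig_Ty: "\<lbrakk>\<Gamma> \<in> Obj C; A \<in> Ty C \<Gamma>; B \<in> Ty C (cext C \<Gamma> A)\<rbrakk> \<Longrightarrow> Sig C \<Gamma> A B \<in> Ty C \<Gamma>"
    and mkpair_Tm: "\<lbrakk>\<Gamma> \<in> Obj C; A \<in> Ty C \<Gamma>; B \<in> Ty C (cext C \<Gamma> A); a \<in> Tm C \<Gamma> A;
        b \<in> Tm C \<Gamma> (B \<cdot> sect C \<Gamma> A a)\<rbrakk> \<Longrightarrow> mkpair C \<Gamma> A B a b \<in> Tm C \<Gamma> (Sig C \<Gamma> A B)"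
    and pfst_Tm: "\<lbrakk>\<Gamma> \<in> Obj C; A \<in> Ty C \<Gamma>; B \<in> Ty C (cext C \<Gamma> A); t \<in> Tm C \<Gamma> (Sig C \<Gamma> A B)\<rbrakk>
      \<Longrightarrow> pfst C \<Gamma> A B t \<in> Tm C \<Gamma> A"
    and psnd_Tm: "\<lbrakk>\<Gamma> \<in> Obj C; A \<in> Ty C \<Gamma>; B \<in> Ty C (cext C \<Gamma> A); t \<in> Tm C \<Gamma> (Sig C \<Gamma> A B)\<rbrakk>
      \<Longrightarrow> psnd C \<Gamma> A B t \<in> Tm C \<Gamma> (B \<cdot> sect C \<Gamma> A (pfst C \<Gamma> A B t))"
    and Sig_beta1: "\<lbrakk>\<Gamma> \<in> Obj C; A \<in> Ty C \<Gamma>; B \<in> Ty C (cext C \<Gamma> A); a \<in> Tm C \<Gamma> A;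
        b \<in> Tm C \<Gamma> (B \<cdot> sect C \<Gamma> A a)\<rbrakk> \<Longrightarrow> pfst C \<Gamma> A B (mkpair C \<Gamma> A B a b) = a"
    and Sig_beta2: "\<lbrakk>\<Gamma> \<in> Obj C; A \<in> Ty C \<Gamma>; B \<in> Ty C (cext C \<Gamma> A); a \<in> Tm C \<Gamma> A;
        b \<in> Tm C \<Gamma> (B \<cdot> sect C \<Gamma> A a)\<rbrakk> \<Longrightarrow> psnd C \<Gamma> A B (mkpair C \<Gamma> A B a b) = b"
    and Sig_eta: "\<lbrakk>\<Gamma> \<in> Obj C; A \<in> Ty C \<Gamma>; B \<in> Ty C (cext C \<Gamma> A); t \<in> Tm C \<Gamma> (Sig C \<Gamma> A B)\<rbrakk>
      \<Longrightarrow> mkpair C \<Gamma> A B (pfst C \<Gamma> A B t) (psnd C \<Gamma> A B t) = t"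
    and Sig_sub: "\<lbrakk>\<sigma> \<in> hom C \<Delta> \<Gamma>; A \<in> Ty C \<Gamma>; B \<in> Ty C (cext C \<Gamma> A)\<rbrakk>
      \<Longrightarrow> Sig C \<Gamma> A B \<cdot> \<sigma> = Sig C \<Delta> (A \<cdot> \<sigma>) (B \<cdot> (\<sigma> \<up> A))"
    and mkpair_sub: "\<lbrakk>\<sigma> \<in> hom C \<Delta> \<Gamma>; A \<in> Ty C \<Gamma>; B \<in> Ty C (cext C \<Gamma> A); a \<in> Tm C \<Gamma> A;
        b \<in> Tm C \<Gamma> (B \<cdot> sect C \<Gamma> A a)\<rbrakk>
      \<Longrightarrow> tmsub C (Sig C \<Gamma> A B) (mkpair C \<Gamma> A B a b) \<sigma>
        = mkpair C \<Delta> (A \<cdot> \<sigma>) (B \<cdot> (\<sigma> \<up> A)) (tmsub C A a \<sigma>) (tmsub C (B \<cdot> sect C \<Gamma> A a) b \<sigma>)"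
    and pfst_sub: "\<lbrakk>\<sigma> \<in> hom C \<Delta> \<Gamma>; A \<in> Ty C \<Gamma>; B \<in> Ty C (cext C \<Gamma> A); t \<in> Tm C \<Gamma> (Sig C \<Gamma> A B)\<rbrakk>
      \<Longrightarrow> tmsub C A (pfst C \<Gamma> A B t) \<sigma>
        = pfst C \<Delta> (A \<cdot> \<sigma>) (B \<cdot> (\<sigma> \<up> A)) (tmsub C (Sig C \<Gamma> A B) t \<sigma>)"
    and psnd_sub: "\<lbrakk>\<sigma> \<in> hom C \<Delta> \<Gamma>; A \<in> Ty C \<Gamma>; B \<in> Ty C (cext C \<Gamma> A); t \<in> Tm C \<Gamma> (Sig C \<Gamma> A B)\<rbrakk>
      \<Longrightarrow> tmsub C (B \<cdot> sect C \<Gamma> A (pfst C \<Gamma> A B t)) (psnd C \<Gamma> A B t) \<sigma>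
        = psnd C \<Delta> (A \<cdot> \<sigma>) (B \<cdot> (\<sigma> \<up> A)) (tmsub C (Sig C \<Gamma> A B) t \<sigma>)"

locale cwf_Unit = cwf C for C :: "('o, 'm, 't, 'a, 'z) cwf_tt_scheme" (structure) +
  assumes Unit_Ty: "\<Gamma> \<in> Obj C \<Longrightarrow> UnitT C \<Gamma> \<in> Ty C \<Gamma>"
    and star_Tm: "\<Gamma> \<in> Obj C \<Longrightarrow> star C \<Gamma> \<in> Tm C \<Gamma> (UnitT C \<Gamma>)"
    and unitrec_Tm: "\<lbrakk>\<Gamma> \<in> Obj C; P \<in> Ty C (cext C \<Gamma> (UnitT C \<Gamma>));
        d \<in> Tm C \<Gamma> (P \<cdot> sect C \<Gamma> (UnitT C \<Gamma>) (star C \<Gamma>))\<rbrakk>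
      \<Longrightarrow> unitrec C \<Gamma> P d \<in> Tm C (cext C \<Gamma> (UnitT C \<Gamma>)) P"
    and Unit_beta: "\<lbrakk>\<Gamma> \<in> Obj C; P \<in> Ty C (cext C \<Gamma> (UnitT C \<Gamma>));
        d \<in> Tm C \<Gamma> (P \<cdot> sect C \<Gamma> (UnitT C \<Gamma>) (star C \<Gamma>))\<rbrakk>
      \<Longrightarrow> tmsub C P (unitrec C \<Gamma> P d) (sect C \<Gamma> (UnitT C \<Gamma>) (star C \<Gamma>)) = d"
    and Unit_sub: "\<sigma> \<in> hom C \<Delta> \<Gamma> \<Longrightarrow> UnitT C \<Gamma> \<cdot> \<sigma> = UnitT C \<Delta>"
    and star_sub: "\<sigma> \<in> hom C \<Delta> \<Gamma> \<Longrightarrow> tmsub C (UnitT C \<Gamma>) (star C \<Gamma>) \<sigma> = star C \<Delta>"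
    and unitrec_sub: "\<lbrakk>\<sigma> \<in> hom C \<Delta> \<Gamma>; P \<in> Ty C (cext C \<Gamma> (UnitT C \<Gamma>));
        d \<in> Tm C \<Gamma> (P \<cdot> sect C \<Gamma> (UnitT C \<Gamma>) (star C \<Gamma>))\<rbrakk>
      \<Longrightarrow> tmsub C P (unitrec C \<Gamma> P d) (\<sigma> \<up> UnitT C \<Gamma>)
        = unitrec C \<Delta> (P \<cdot> (\<sigma> \<up> UnitT C \<Gamma>))
            (tmsub C (P \<cdot> sect C \<Gamma> (UnitT C \<Gamma>) (star C \<Gamma>)) d \<sigma>)"

locale cwf_Empty = cwf C for C :: "('o, 'm, 't, 'a, 'z) cwf_tt_scheme" (structure) +
  assumes Empty_Ty: "\<Gamma> \<in> Obj C \<Longrightarrow> EmptyT C \<Gamma> \<in> Ty C \<Gamma>"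
    and emptyrec_Tm: "\<lbrakk>\<Gamma> \<in> Obj C; P \<in> Ty C (cext C \<Gamma> (EmptyT C \<Gamma>))\<rbrakk>
      \<Longrightarrow> emptyrec C \<Gamma> P \<in> Tm C (cext C \<Gamma> (EmptyT C \<Gamma>)) P"
    and Empty_sub: "\<sigma> \<in> hom C \<Delta> \<Gamma> \<Longrightarrow> EmptyT C \<Gamma> \<cdot> \<sigma> = EmptyT C \<Delta>"
    and emptyrec_sub: "\<lbrakk>\<sigma> \<in> hom C \<Delta> \<Gamma>; P \<in> Ty C (cext C \<Gamma> (EmptyT C \<Gamma>))\<rbrakk>
      \<Longrightarrow> tmsub C P (emptyrec C \<Gamma> P) (\<sigma> \<up> EmptyT C \<Gamma>)
        = emptyrec C \<Delta> (P \<cdot> (\<sigma> \<up> EmptyT C \<Gamma>))"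

text \<open>The generic injections \<open>\<Gamma>.A \<rightarrow> \<Gamma>.(A + B)\<close> and \<open>\<Gamma>.B \<rightarrow> \<Gamma>.(A + B)\<close> over \<open>\<Gamma>\<close>.\<close>

definition inlsub :: "('o, 'm, 't, 'a, 'z) cwf_tt_scheme \<Rightarrow> 'o \<Rightarrow> 't \<Rightarrow> 't \<Rightarrow> 'm" where
  "inlsub C \<Gamma> A B = \<langle>pp C \<Gamma> A; Cop C \<Gamma> A B;
     inlt C (cext C \<Gamma> A) (A \<cdot>\<^bsub>C\<^esub> pp C \<Gamma> A) (B \<cdot>\<^bsub>C\<^esub> pp C \<Gamma> A) (qq C \<Gamma> A)\<rangle>\<^bsub>C\<^esub>"

definition inrsub :: "('o, 'm, 't, 'a, 'z) cwf_tt_scheme \<Rightarrow> 'o \<Rightarrow> 't \<Rightarrow> 't \<Rightarrow> 'm" where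
  "inrsub C \<Gamma> A B = \<langle>pp C \<Gamma> B; Cop C \<Gamma> A B;
     inrt C (cext C \<Gamma> B) (A \<cdot>\<^bsub>C\<^esub> pp C \<Gamma> B) (B \<cdot>\<^bsub>C\<^esub> pp C \<Gamma> B) (qq C \<Gamma> B)\<rangle>\<^bsub>C\<^esub>"

locale cwf_Cop = cwf C for C :: "('o, 'm, 't, 'a, 'z) cwf_tt_scheme" (structure) +
  assumes Cop_Ty: "\<lbrakk>\<Gamma> \<in> Obj C; A \<in> Ty C \<Gamma>; B \<in> Ty C \<Gamma>\<rbrakk> \<Longrightarrow> Cop C \<Gamma> A B \<in> Ty C \<Gamma>"
    and inl_Tm: "\<lbrakk>\<Gamma> \<in> Obj C; A \<in> Ty C \<Gamma>; B \<in> Ty C \<Gamma>; a \<in> Tm C \<Gamma> A\<rbrakk>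
      \<Longrightarrow> inlt C \<Gamma> A B a \<in> Tm C \<Gamma> (Cop C \<Gamma> A B)"
    and inr_Tm: "\<lbrakk>\<Gamma> \<in> Obj C; A \<in> Ty C \<Gamma>; B \<in> Ty C \<Gamma>; b \<in> Tm C \<Gamma> B\<rbrakk>
      \<Longrightarrow> inrt C \<Gamma> A B b \<in> Tm C \<Gamma> (Cop C \<Gamma> A B)"
    and coprec_Tm: "\<lbrakk>\<Gamma> \<in> Obj C; A \<in> Ty C \<Gamma>; B \<in> Ty C \<Gamma>; P \<in> Ty C (cext C \<Gamma> (Cop C \<Gamma> A B));
        d \<in> Tm C (cext C \<Gamma> A) (P \<cdot> inlsub C \<Gamma> A B); e \<in> Tm C (cext C \<Gamma> B) (P \<cdot> inrsub C \<Gamma> A B)\<rbrakk>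
      \<Longrightarrow> coprec C \<Gamma> A B P d e \<in> Tm C (cext C \<Gamma> (Cop C \<Gamma> A B)) P"
    and Cop_beta1: "\<lbrakk>\<Gamma> \<in> Obj C; A \<in> Ty C \<Gamma>; B \<in> Ty C \<Gamma>; P \<in> Ty C (cext C \<Gamma> (Cop C \<Gamma> A B));
        d \<in> Tm C (cext C \<Gamma> A) (P \<cdot> inlsub C \<Gamma> A B); e \<in> Tm C (cext C \<Gamma> B) (P \<cdot> inrsub C \<Gamma> A B)\<rbrakk>
      \<Longrightarrow> tmsub C P (coprec C \<Gamma> A B P d e) (inlsub C \<Gamma> A B) = d"
    and Cop_beta2: "\<lbrakk>\<Gamma> \<in> Obj C; A \<in> Ty C \<Gamma>; B \<in> Ty C \<Gamma>; P \<in> Ty C (cext C \<Gamma> (Cop C \<Gamma> A B));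
        d \<in> Tm C (cext C \<Gamma> A) (P \<cdot> inlsub C \<Gamma> A B); e \<in> Tm C (cext C \<Gamma> B) (P \<cdot> inrsub C \<Gamma> A B)\<rbrakk>
      \<Longrightarrow> tmsub C P (coprec C \<Gamma> A B P d e) (inrsub C \<Gamma> A B) = e"
    and Cop_sub: "\<lbrakk>\<sigma> \<in> hom C \<Delta> \<Gamma>; A \<in> Ty C \<Gamma>; B \<in> Ty C \<Gamma>\<rbrakk>
      \<Longrightarrow> Cop C \<Gamma> A B \<cdot> \<sigma> = Cop C \<Delta> (A \<cdot> \<sigma>) (B \<cdot> \<sigma>)"
    and inl_sub: "\<lbrakk>\<sigma> \<in> hom C \<Delta> \<Gamma>; A \<in> Ty C \<Gamma>; B \<in> Ty C \<Gamma>; a \<in> Tm C \<Gamma> A\<rbrakk>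
      \<Longrightarrow> tmsub C (Cop C \<Gamma> A B) (inlt C \<Gamma> A B a) \<sigma> = inlt C \<Delta> (A \<cdot> \<sigma>) (B \<cdot> \<sigma>) (tmsub C A a \<sigma>)"
    and inr_sub: "\<lbrakk>\<sigma> \<in> hom C \<Delta> \<Gamma>; A \<in> Ty C \<Gamma>; B \<in> Ty C \<Gamma>; b \<in> Tm C \<Gamma> B\<rbrakk>
      \<Longrightarrow> tmsub C (Cop C \<Gamma> A B) (inrt C \<Gamma> A B b) \<sigma> = inrt C \<Delta> (A \<cdot> \<sigma>) (B \<cdot> \<sigma>) (tmsub C B b \<sigma>)"
    and coprec_sub: "\<lbrakk>\<sigma> \<in> hom C \<Delta> \<Gamma>; A \<in> Ty C \<Gamma>; B \<in> Ty C \<Gamma>; P \<in> Ty C (cext C \<Gamma> (Cop C \<Gamma> A B));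
        d \<in> Tm C (cext C \<Gamma> A) (P \<cdot> inlsub C \<Gamma> A B); e \<in> Tm C (cext C \<Gamma> B) (P \<cdot> inrsub C \<Gamma> A B)\<rbrakk>
      \<Longrightarrow> tmsub C P (coprec C \<Gamma> A B P d e) (\<sigma> \<up> Cop C \<Gamma> A B)
        = coprec C \<Delta> (A \<cdot> \<sigma>) (B \<cdot> \<sigma>) (P \<cdot> (\<sigma> \<up> Cop C \<Gamma> A B))
            (tmsub C (P \<cdot> inlsub C \<Gamma> A B) d (\<sigma> \<up> A)) (tmsub C (P \<cdot> inrsub C \<Gamma> A B) e (\<sigma> \<up> B))"

text \<open>\<open>succsub C \<Gamma> : \<Gamma>.N \<rightarrow> \<Gamma>.N\<close> is the generic successor over \<open>\<Gamma>\<close>; the successor step of the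
  recursor lives over \<open>\<Gamma>.N.P\<close>.\<close>

definition succsub :: "('o, 'm, 't, 'a, 'z) cwf_tt_scheme \<Rightarrow> 'o \<Rightarrow> 'm" where
  "succsub C \<Gamma> = \<langle>pp C \<Gamma> (NatT C \<Gamma>); NatT C \<Gamma>;
     succt C (cext C \<Gamma> (NatT C \<Gamma>)) (qq C \<Gamma> (NatT C \<Gamma>))\<rangle>\<^bsub>C\<^esub>"

locale cwf_Nat = cwf C for C :: "('o, 'm, 't, 'a, 'z) cwf_tt_scheme" (structure) +
  assumes Nat_Ty: "\<Gamma> \<in> Obj C \<Longrightarrow> NatT C \<Gamma> \<in> Ty C \<Gamma>"
    and zero_Tm: "\<Gamma> \<in> Obj C \<Longrightarrow> zerot C \<Gamma> \<in> Tm C \<Gamma> (NatT C \<Gamma>)"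
    and succ_Tm: "\<lbrakk>\<Gamma> \<in> Obj C; n \<in> Tm C \<Gamma> (NatT C \<Gamma>)\<rbrakk> \<Longrightarrow> succt C \<Gamma> n \<in> Tm C \<Gamma> (NatT C \<Gamma>)"
    and natrec_Tm: "\<lbrakk>\<Gamma> \<in> Obj C; P \<in> Ty C (cext C \<Gamma> (NatT C \<Gamma>));
        z \<in> Tm C \<Gamma> (P \<cdot> sect C \<Gamma> (NatT C \<Gamma>) (zerot C \<Gamma>));
        s \<in> Tm C (cext C (cext C \<Gamma> (NatT C \<Gamma>)) P)
             (P \<cdot> (succsub C \<Gamma> \<odot> pp C (cext C \<Gamma> (NatT C \<Gamma>)) P))\<rbrakk>
      \<Longrightarrow> natrec C \<Gamma> P z s \<in> Tm C (cext C \<Gamma> (NatT C \<Gamma>)) P"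
    and Nat_beta_zero: "\<lbrakk>\<Gamma> \<in> Obj C; P \<in> Ty C (cext C \<Gamma> (NatT C \<Gamma>));
        z \<in> Tm C \<Gamma> (P \<cdot> sect C \<Gamma> (NatT C \<Gamma>) (zerot C \<Gamma>));
        s \<in> Tm C (cext C (cext C \<Gamma> (NatT C \<Gamma>)) P)
             (P \<cdot> (succsub C \<Gamma> \<odot> pp C (cext C \<Gamma> (NatT C \<Gamma>)) P))\<rbrakk>
      \<Longrightarrow> tmsub C P (natrec C \<Gamma> P z s) (sect C \<Gamma> (NatT C \<Gamma>) (zerot C \<Gamma>)) = z"
    and Nat_beta_succ: "\<lbrakk>\<Gamma> \<in> Obj C; P \<in> Ty C (cext C \<Gamma> (NatT C \<Gamma>));
        z \<in> Tm C \<Gamma> (P \<cdot> sect C \<Gamma> (NatT C \<Gamma>) (zerot C \<Gamma>));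
        s \<in> Tm C (cext C (cext C \<Gamma> (NatT C \<Gamma>)) P)
             (P \<cdot> (succsub C \<Gamma> \<odot> pp C (cext C \<Gamma> (NatT C \<Gamma>)) P))\<rbrakk>
      \<Longrightarrow> tmsub C P (natrec C \<Gamma> P z s) (succsub C \<Gamma>)
        = tmsub C (P \<cdot> (succsub C \<Gamma> \<odot> pp C (cext C \<Gamma> (NatT C \<Gamma>)) P)) s
            (sect C (cext C \<Gamma> (NatT C \<Gamma>)) P (natrec C \<Gamma> P z s))"
    and Nat_sub: "\<sigma> \<in> hom C \<Delta> \<Gamma> \<Longrightarrow> NatT C \<Gamma> \<cdot> \<sigma> = NatT C \<Delta>"
    and zero_sub: "\<sigma> \<in> hom C \<Delta> \<Gamma> \<Longrightarrow> tmsub C (NatT C \<Gamma>) (zerot C \<Gamma>) \<sigma> = zerot C \<Delta>"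
    and succ_sub: "\<lbrakk>\<sigma> \<in> hom C \<Delta> \<Gamma>; n \<in> Tm C \<Gamma> (NatT C \<Gamma>)\<rbrakk>
      \<Longrightarrow> tmsub C (NatT C \<Gamma>) (succt C \<Gamma> n) \<sigma> = succt C \<Delta> (tmsub C (NatT C \<Gamma>) n \<sigma>)"
    and natrec_sub: "\<lbrakk>\<sigma> \<in> hom C \<Delta> \<Gamma>; P \<in> Ty C (cext C \<Gamma> (NatT C \<Gamma>));
        z \<in> Tm C \<Gamma> (P \<cdot> sect C \<Gamma> (NatT C \<Gamma>) (zerot C \<Gamma>));
        s \<in> Tm C (cext C (cext C \<Gamma> (NatT C \<Gamma>)) P)
             (P \<cdot> (succsub C \<Gamma> \<odot> pp C (cext C \<Gamma> (NatT C \<Gamma>)) P))\<rbrakk>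
      \<Longrightarrow> tmsub C P (natrec C \<Gamma> P z s) (\<sigma> \<up> NatT C \<Gamma>)
        = natrec C \<Delta> (P \<cdot> (\<sigma> \<up> NatT C \<Gamma>))
            (tmsub C (P \<cdot> sect C \<Gamma> (NatT C \<Gamma>) (zerot C \<Gamma>)) z \<sigma>)
            (tmsub C (P \<cdot> (succsub C \<Gamma> \<odot> pp C (cext C \<Gamma> (NatT C \<Gamma>)) P)) s
               (\<sigma> \<up> NatT C \<Gamma> \<up> P))"

text \<open>The context \<open>\<Gamma>.A.A[p]\<close>, the extension \<open>\<Gamma>.A.A[p].Id\<close>, the diagonal \<open>\<Gamma>.A \<rightarrow> \<Gamma>.A.A[p]\<close> and
  its lifting along reflexivity.\<close>

definition cext2 :: "('o, 'm, 't, 'a, 'z) cwf_scheme \<Rightarrow> 'o \<Rightarrow> 't \<Rightarrow> 'o" where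
  "cext2 C \<Gamma> A = cext C (cext C \<Gamma> A) (A \<cdot>\<^bsub>C\<^esub> pp C \<Gamma> A)"

definition idctx :: "('o, 'm, 't, 'a, 'z) cwf_psi_scheme \<Rightarrow> 'o \<Rightarrow> 't \<Rightarrow> 'o" where
  "idctx C \<Gamma> A = cext C (cext2 C \<Gamma> A) (Idt C \<Gamma> A)"

definition diag :: "('o, 'm, 't, 'a, 'z) cwf_scheme \<Rightarrow> 'o \<Rightarrow> 't \<Rightarrow> 'm" where
  "diag C \<Gamma> A = sect C (cext C \<Gamma> A) (A \<cdot>\<^bsub>C\<^esub> pp C \<Gamma> A) (qq C \<Gamma> A)"

definition reflsub :: "('o, 'm, 't, 'a, 'z) cwf_tt_scheme \<Rightarrow> 'o \<Rightarrow> 't \<Rightarrow> 'm" where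
  "reflsub C \<Gamma> A = \<langle>diag C \<Gamma> A; Idt C \<Gamma> A; reflt C \<Gamma> A\<rangle>\<^bsub>C\<^esub>"

locale cwf_Id = cwf C for C :: "('o, 'm, 't, 'a, 'z) cwf_tt_scheme" (structure) +
  assumes Id_Ty: "\<lbrakk>\<Gamma> \<in> Obj C; A \<in> Ty C \<Gamma>\<rbrakk> \<Longrightarrow> Idt C \<Gamma> A \<in> Ty C (cext2 C \<Gamma> A)"
    and refl_Tm: "\<lbrakk>\<Gamma> \<in> Obj C; A \<in> Ty C \<Gamma>\<rbrakk>
      \<Longrightarrow> reflt C \<Gamma> A \<in> Tm C (cext C \<Gamma> A) (Idt C \<Gamma> A \<cdot> diag C \<Gamma> A)"
    and J_Tm: "\<lbrakk>\<Gamma> \<in> Obj C; A \<in> Ty C \<Gamma>; P \<in> Ty C (idctx C \<Gamma> A);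
        d \<in> Tm C (cext C \<Gamma> A) (P \<cdot> reflsub C \<Gamma> A)\<rbrakk> \<Longrightarrow> Jt C \<Gamma> A P d \<in> Tm C (idctx C \<Gamma> A) P"
    and J_beta: "\<lbrakk>\<Gamma> \<in> Obj C; A \<in> Ty C \<Gamma>; P \<in> Ty C (idctx C \<Gamma> A);
        d \<in> Tm C (cext C \<Gamma> A) (P \<cdot> reflsub C \<Gamma> A)\<rbrakk>
      \<Longrightarrow> tmsub C P (Jt C \<Gamma> A P d) (reflsub C \<Gamma> A) = d"
    and Id_sub: "\<lbrakk>\<sigma> \<in> hom C \<Delta> \<Gamma>; A \<in> Ty C \<Gamma>\<rbrakk>
      \<Longrightarrow> Idt C \<Gamma> A \<cdot> (\<sigma> \<up> A \<up> (A \<cdot> pp C \<Gamma> A)) = Idt C \<Delta> (A \<cdot> \<sigma>)"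
    and refl_sub: "\<lbrakk>\<sigma> \<in> hom C \<Delta> \<Gamma>; A \<in> Ty C \<Gamma>\<rbrakk>
      \<Longrightarrow> tmsub C (Idt C \<Gamma> A \<cdot> diag C \<Gamma> A) (reflt C \<Gamma> A) (\<sigma> \<up> A) = reflt C \<Delta> (A \<cdot> \<sigma>)"
    and J_sub: "\<lbrakk>\<sigma> \<in> hom C \<Delta> \<Gamma>; A \<in> Ty C \<Gamma>; P \<in> Ty C (idctx C \<Gamma> A);
        d \<in> Tm C (cext C \<Gamma> A) (P \<cdot> reflsub C \<Gamma> A)\<rbrakk>
      \<Longrightarrow> tmsub C P (Jt C \<Gamma> A P d) (\<sigma> \<up> A \<up> (A \<cdot> pp C \<Gamma> A) \<up> Idt C \<Gamma> A)
        = Jt C \<Delta> (A \<cdot> \<sigma>) (P \<cdot> (\<sigma> \<up> A \<up> (A \<cdot> pp C \<Gamma> A) \<up> Idt C \<Gamma> A))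
            (tmsub C (P \<cdot> reflsub C \<Gamma> A) d (\<sigma> \<up> A))"

locale cwf_type_formers =
  cwf_Pi C + cwf_Sigma C + cwf_Unit C + cwf_Empty C + cwf_Cop C + cwf_Nat C + cwf_Id C
  for C :: "('o, 'm, 't, 'a, 'z) cwf_tt_scheme" (structure)

section \<open>Exo-nat products\<close>

text \<open>\<open>iota \<Gamma> Y d c h\<close> is the term of \<open>Id(\<psi>(d), \<psi>(c))\<close> assigned to a family
  \<open>h\<close> of terms of \<open>Id(d\<^sub>n, c\<^sub>n)\<close>.\<close>

locale exo_nat_products = cwf C
  for C :: "('o, 'm, 't, 'a, 'z) cwf_psi_scheme" (structure) +
  fixes Omega :: "'o \<Rightarrow> (nat \<Rightarrow> 't) \<Rightarrow> 't"
    and phi :: "'o \<Rightarrow> (nat \<Rightarrow> 't) \<Rightarrow> 'a \<Rightarrow> nat \<Rightarrow> 'a"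
    and psi :: "'o \<Rightarrow> (nat \<Rightarrow> 't) \<Rightarrow> (nat \<Rightarrow> 'a) \<Rightarrow> 'a"
    and iota :: "'o \<Rightarrow> (nat \<Rightarrow> 't) \<Rightarrow> (nat \<Rightarrow> 'a) \<Rightarrow> (nat \<Rightarrow> 'a) \<Rightarrow> (nat \<Rightarrow> 'a) \<Rightarrow> 'a"
  assumes Omega_Ty: "\<lbrakk>\<Gamma> \<in> Obj C; \<And>n. Y n \<in> Ty C \<Gamma>\<rbrakk> \<Longrightarrow> Omega \<Gamma> Y \<in> Ty C \<Gamma>"
    and phi_Tm: "\<lbrakk>\<Gamma> \<in> Obj C; \<And>n. Y n \<in> Ty C \<Gamma>; t \<in> Tm C \<Gamma> (Omega \<Gamma> Y)\<rbrakk>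
      \<Longrightarrow> phi \<Gamma> Y t n \<in> Tm C \<Gamma> (Y n)"
    and psi_Tm: "\<lbrakk>\<Gamma> \<in> Obj C; \<And>n. Y n \<in> Ty C \<Gamma>; \<And>n. d n \<in> Tm C \<Gamma> (Y n)\<rbrakk>
      \<Longrightarrow> psi \<Gamma> Y d \<in> Tm C \<Gamma> (Omega \<Gamma> Y)"
    and psi_phi: "\<lbrakk>\<Gamma> \<in> Obj C; \<And>n. Y n \<in> Ty C \<Gamma>; t \<in> Tm C \<Gamma> (Omega \<Gamma> Y)\<rbrakk>
      \<Longrightarrow> psi \<Gamma> Y (phi \<Gamma> Y t) = t"
    and phi_psi: "\<lbrakk>\<Gamma> \<in> Obj C; \<And>n. Y n \<in> Ty C \<Gamma>; \<And>n. d n \<in> Tm C \<Gamma> (Y n)\<rbrakk>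
      \<Longrightarrow> phi \<Gamma> Y (psi \<Gamma> Y d) = d"
    and iota_Tm: "\<lbrakk>\<Gamma> \<in> Obj C; \<And>n. Y n \<in> Ty C \<Gamma>; \<And>n. d n \<in> Tm C \<Gamma> (Y n);
        \<And>n. c n \<in> Tm C \<Gamma> (Y n); \<And>n. h n \<in> Tm C \<Gamma> (IdT C \<Gamma> (Y n) (d n) (c n))\<rbrakk>
      \<Longrightarrow> iota \<Gamma> Y d c h \<in> Tm C \<Gamma> (IdT C \<Gamma> (Omega \<Gamma> Y) (psi \<Gamma> Y d) (psi \<Gamma> Y c))"
    and Omega_sub: "\<lbrakk>\<sigma> \<in> hom C \<Delta> \<Gamma>; \<And>n. Y n \<in> Ty C \<Gamma>\<rbrakk>
      \<Longrightarrow> Omega \<Gamma> Y \<cdot> \<sigma> = Omega \<Delta> (\<lambda>n. Y n \<cdot> \<sigma>)"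
    and phi_sub: "\<lbrakk>\<sigma> \<in> hom C \<Delta> \<Gamma>; \<And>n. Y n \<in> Ty C \<Gamma>; t \<in> Tm C \<Gamma> (Omega \<Gamma> Y)\<rbrakk>
      \<Longrightarrow> tmsub C (Y n) (phi \<Gamma> Y t n) \<sigma>
        = phi \<Delta> (\<lambda>n. Y n \<cdot> \<sigma>) (tmsub C (Omega \<Gamma> Y) t \<sigma>) n"
    and psi_sub: "\<lbrakk>\<sigma> \<in> hom C \<Delta> \<Gamma>; \<And>n. Y n \<in> Ty C \<Gamma>; \<And>n. d n \<in> Tm C \<Gamma> (Y n)\<rbrakk>
      \<Longrightarrow> tmsub C (Omega \<Gamma> Y) (psi \<Gamma> Y d) \<sigma>
        = psi \<Delta> (\<lambda>n. Y n \<cdot> \<sigma>) (\<lambda>n. tmsub C (Y n) (d n) \<sigma>)"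
    and iota_sub: "\<lbrakk>\<sigma> \<in> hom C \<Delta> \<Gamma>; \<And>n. Y n \<in> Ty C \<Gamma>; \<And>n. d n \<in> Tm C \<Gamma> (Y n);
        \<And>n. c n \<in> Tm C \<Gamma> (Y n); \<And>n. h n \<in> Tm C \<Gamma> (IdT C \<Gamma> (Y n) (d n) (c n))\<rbrakk>
      \<Longrightarrow> tmsub C (IdT C \<Gamma> (Omega \<Gamma> Y) (psi \<Gamma> Y d) (psi \<Gamma> Y c)) (iota \<Gamma> Y d c h) \<sigma>
        = iota \<Delta> (\<lambda>n. Y n \<cdot> \<sigma>) (\<lambda>n. tmsub C (Y n) (d n) \<sigma>) (\<lambda>n. tmsub C (Y n) (c n) \<sigma>)
            (\<lambda>n. tmsub C (IdT C \<Gamma> (Y n) (d n) (c n)) (h n) \<sigma>)"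

definition has_exo_nat_products :: "('o, 'm, 't, 'a, 'z) cwf_psi_scheme \<Rightarrow> bool" where
  "has_exo_nat_products C \<longleftrightarrow> (\<exists>Omega phi psi iota. exo_nat_products C Omega phi psi iota)"

section \<open>Two-level categories with families\<close>

text \<open>
  The underlying CwF is the exo-level, with \<open>PiE\<close> its formation of \<open>\<Pi>\<close>-types; the suffix \<open>F\<close> marks
  the second level.  \<open>fib_cwf D\<close> is the second CwF structure, with
  \<open>Tm\<^sup>f(\<Gamma>, A) = Tm\<^sup>e(\<Gamma>, c(A))\<close> and \<open>\<Gamma>.A = \<Gamma>.c(A)\<close>.
\<close>

record ('o, 'm, 't, 'a, 'f) tlcwf = "('o, 'm, 't, 'a) cwf" +
  PiE :: "'o \<Rightarrow> 't \<Rightarrow> 't \<Rightarrow> 't"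
  TyF :: "'o \<Rightarrow> 'f set"
  tysubF :: "'f \<Rightarrow> 'm \<Rightarrow> 'f"
  conv :: "'o \<Rightarrow> 'f \<Rightarrow> 't"
  PiF :: "'o \<Rightarrow> 'f \<Rightarrow> 'f \<Rightarrow> 'f"
  SigF :: "'o \<Rightarrow> 'f \<Rightarrow> 'f \<Rightarrow> 'f"
  IdF :: "'o \<Rightarrow> 'f \<Rightarrow> 'f"

locale two_level_cwf = cwf D
  for D :: "('o, 'm, 't, 'a, 'f, 'z) tlcwf_scheme" (structure) +
  assumes tysubF_TyF: "\<lbrakk>A \<in> TyF D \<Gamma>; \<sigma> \<in> hom D \<Delta> \<Gamma>\<rbrakk> \<Longrightarrow> tysubF D A \<sigma> \<in> TyF D \<Delta>"
    and tysubF_idn: "\<lbrakk>\<Gamma> \<in> Obj D; A \<in> TyF D \<Gamma>\<rbrakk> \<Longrightarrow> tysubF D A (idn D \<Gamma>) = A"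
    and tysubF_cmp: "\<lbrakk>A \<in> TyF D \<Gamma>; \<sigma> \<in> hom D \<Delta> \<Gamma>; \<tau> \<in> hom D \<Theta> \<Delta>\<rbrakk>
      \<Longrightarrow> tysubF D A (\<sigma> \<odot> \<tau>) = tysubF D (tysubF D A \<sigma>) \<tau>"
    and conv_Ty: "\<lbrakk>\<Gamma> \<in> Obj D; A \<in> TyF D \<Gamma>\<rbrakk> \<Longrightarrow> conv D \<Gamma> A \<in> Ty D \<Gamma>"
    and conv_sub: "\<lbrakk>A \<in> TyF D \<Gamma>; \<sigma> \<in> hom D \<Delta> \<Gamma>\<rbrakk>
      \<Longrightarrow> conv D \<Delta> (tysubF D A \<sigma>) = conv D \<Gamma> A \<cdot> \<sigma>"

definition fib_cwf :: "('o, 'm, 't, 'a, 'f, 'z) tlcwf_scheme \<Rightarrow> ('o, 'm, 'f, 'a) cwf_psi" where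
  "fib_cwf D = \<lparr>
     Obj = Obj D, Arr = Arr D, Dom = Dom D, Cod = Cod D, idn = idn D, cmp = cmp D, One = One D,
     Ty = TyF D,
     tysub = tysubF D,
     Tm = (\<lambda>\<Gamma> A. Tm D \<Gamma> (conv D \<Gamma> A)),
     tmsub = (\<lambda>A a \<sigma>. tmsub D (conv D (Cod D \<sigma>) A) a \<sigma>),
     cext = (\<lambda>\<Gamma> A. cext D \<Gamma> (conv D \<Gamma> A)),
     pp = (\<lambda>\<Gamma> A. pp D \<Gamma> (conv D \<Gamma> A)),
     qq = (\<lambda>\<Gamma> A. qq D \<Gamma> (conv D \<Gamma> A)),
     Pi = PiF D, Sig = SigF D, Idt = IdF D\<rparr>"

section \<open>Cofibrant exo-types\<close>

text \<open>An isomorphism \<open>X \<cong> Z\<close> of types over \<open>\<Gamma>\<close> is an isomorphism \<open>\<Gamma>.X \<cong> \<Gamma>.Z\<close> over \<open>\<Gamma>\<close>.\<close>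

definition ty_iso :: "('o, 'm, 't, 'a, 'z) cwf_scheme \<Rightarrow> 'o \<Rightarrow> 't \<Rightarrow> 't \<Rightarrow> 'm \<Rightarrow> bool" where
  "ty_iso D \<Gamma> X Z \<theta> \<longleftrightarrow>
     \<theta> \<in> hom D (cext D \<Gamma> X) (cext D \<Gamma> Z) \<and> pp D \<Gamma> Z \<odot>\<^bsub>D\<^esub> \<theta> = pp D \<Gamma> X \<and>
     (\<exists>\<theta>' \<in> hom D (cext D \<Gamma> Z) (cext D \<Gamma> X).
        pp D \<Gamma> X \<odot>\<^bsub>D\<^esub> \<theta>' = pp D \<Gamma> Z \<and>
        \<theta>' \<odot>\<^bsub>D\<^esub> \<theta> = idn D (cext D \<Gamma> X) \<and> \<theta> \<odot>\<^bsub>D\<^esub> \<theta>' = idn D (cext D \<Gamma> Z))"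

text \<open>
  A substitution \<open>\<sigma>\<close> determines \<open>\<Delta> = Dom D \<sigma>\<close>, so the maps \<open>\<Theta>\<^sup>T\<^sup>y\<close>, \<open>\<Theta>\<^sup>T\<^sup>m\<close> and the isomorphisms are
  indexed by \<open>\<sigma>\<close> alone.  Substitution along \<open>\<tau> : \<Upsilon> \<rightarrow> \<Delta>\<close> leads from the data at \<open>\<sigma>\<close> to the data at
  \<open>\<sigma> \<odot> \<tau>\<close>, and \<open>\<tau> \<up> A[\<sigma>] : \<Upsilon>.A[\<sigma> \<odot> \<tau>] \<rightarrow> \<Delta>.A[\<sigma>]\<close>.
\<close>

locale cofibrancy =
  fixes D :: "('o, 'm, 't, 'a, 'f, 'z) tlcwf_scheme" (structure)
    and \<Gamma> :: 'o
    and A :: 't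
    and ThTy :: "'m \<Rightarrow> 'f \<Rightarrow> 'f"
    and iso :: "'m \<Rightarrow> 'f \<Rightarrow> 'm"
    and ThTm :: "'m \<Rightarrow> 'f \<Rightarrow> 'a \<Rightarrow> 'a"
  assumes ThTy_TyF: "\<lbrakk>\<sigma> \<in> hom D \<Delta> \<Gamma>; Y \<in> TyF D (cext D \<Delta> (A \<cdot> \<sigma>))\<rbrakk> \<Longrightarrow> ThTy \<sigma> Y \<in> TyF D \<Delta>"
    and ThTy_nat: "\<lbrakk>\<sigma> \<in> hom D \<Delta> \<Gamma>; Y \<in> TyF D (cext D \<Delta> (A \<cdot> \<sigma>)); \<tau> \<in> hom D \<Upsilon> \<Delta>\<rbrakk>
      \<Longrightarrow> tysubF D (ThTy \<sigma> Y) \<tau> = ThTy (\<sigma> \<odot> \<tau>) (tysubF D Y (\<tau> \<up> (A \<cdot> \<sigma>)))"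
    and iso_iso: "\<lbrakk>\<sigma> \<in> hom D \<Delta> \<Gamma>; Y \<in> TyF D (cext D \<Delta> (A \<cdot> \<sigma>))\<rbrakk>
      \<Longrightarrow> ty_iso D \<Delta> (conv D \<Delta> (ThTy \<sigma> Y))
            (PiE D \<Delta> (A \<cdot> \<sigma>) (conv D (cext D \<Delta> (A \<cdot> \<sigma>)) Y)) (iso \<sigma> Y)"
    and iso_nat: "\<lbrakk>\<sigma> \<in> hom D \<Delta> \<Gamma>; Y \<in> TyF D (cext D \<Delta> (A \<cdot> \<sigma>)); \<tau> \<in> hom D \<Upsilon> \<Delta>\<rbrakk>
      \<Longrightarrow> iso \<sigma> Y \<odot> (\<tau> \<up> conv D \<Delta> (ThTy \<sigma> Y))
        = (\<tau> \<up> PiE D \<Delta> (A \<cdot> \<sigma>) (conv D (cext D \<Delta> (A \<cdot> \<sigma>)) Y))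
            \<odot> iso (\<sigma> \<odot> \<tau>) (tysubF D Y (\<tau> \<up> (A \<cdot> \<sigma>)))"
    and ThTm_Tm: "\<lbrakk>\<sigma> \<in> hom D \<Delta> \<Gamma>; Y \<in> TyF D (cext D \<Delta> (A \<cdot> \<sigma>));
        t \<in> Tm (fib_cwf D) (cext D \<Delta> (A \<cdot> \<sigma>)) (isContr (fib_cwf D) (cext D \<Delta> (A \<cdot> \<sigma>)) Y)\<rbrakk>
      \<Longrightarrow> ThTm \<sigma> Y t \<in> Tm (fib_cwf D) \<Delta> (isContr (fib_cwf D) \<Delta> (ThTy \<sigma> Y))"
    and ThTm_nat: "\<lbrakk>\<sigma> \<in> hom D \<Delta> \<Gamma>; Y \<in> TyF D (cext D \<Delta> (A \<cdot> \<sigma>)); \<tau> \<in> hom D \<Upsilon> \<Delta>;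
        t \<in> Tm (fib_cwf D) (cext D \<Delta> (A \<cdot> \<sigma>)) (isContr (fib_cwf D) (cext D \<Delta> (A \<cdot> \<sigma>)) Y)\<rbrakk>
      \<Longrightarrow> tmsub (fib_cwf D) (isContr (fib_cwf D) \<Delta> (ThTy \<sigma> Y)) (ThTm \<sigma> Y t) \<tau>
        = ThTm (\<sigma> \<odot> \<tau>) (tysubF D Y (\<tau> \<up> (A \<cdot> \<sigma>)))
            (tmsub (fib_cwf D) (isContr (fib_cwf D) (cext D \<Delta> (A \<cdot> \<sigma>)) Y) t (\<tau> \<up> (A \<cdot> \<sigma>)))"

definition cofibrant :: "('o, 'm, 't, 'a, 'f, 'z) tlcwf_scheme \<Rightarrow> 'o \<Rightarrow> 't \<Rightarrow> bool" where
  "cofibrant D \<Gamma> A \<longleftrightarrow>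
     \<Gamma> \<in> Obj D \<and> A \<in> Ty D \<Gamma> \<and> (\<exists>ThTy iso ThTm. cofibrancy D \<Gamma> A ThTy iso ThTm)"

section \<open>The universe of sets\<close>

text \<open>
  ``Set'' is the category of all sets of elements of the type \<open>'u\<close>, so presheaves on \<open>\<C>\<close> (with
  objects in \<open>'o\<close> and arrows in \<open>'m\<close>) have values of type \<open>'u set\<close>.  A universe structure on \<open>'u\<close>
  provides codes for pairs, for natural numbers and for families \<open>f(\<Delta>, \<sigma>, a)\<close> of the kind that make up
  the exo-type \<open>\<Pi>\<^sup>e(A, B)\<close>, where \<open>a\<close> ranges over a small subset of \<open>'u\<close>.  Smallness of
  \<open>\<C>\<close> means that such families, indexed by objects and arrows of \<open>\<C>\<close>, have codes.  The coding of
  families can only be injective for small ranges of \<open>a\<close>, by Cantor's theorem.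
  Presheaves themselves may have arbitrary subsets of \<open>'u\<close> as values.
\<close>

record ('o, 'm, 'u) universe =
  small :: "'u set \<Rightarrow> bool"
  upair :: "'u \<Rightarrow> 'u \<Rightarrow> 'u"
  unum :: "nat \<Rightarrow> 'u"
  ufam :: "('o \<Rightarrow> 'm \<Rightarrow> 'u \<Rightarrow> 'u) \<Rightarrow> 'u"

locale set_universe =
  fixes U :: "('o, 'm, 'u) universe"
  assumes upair_inj: "upair U x y = upair U x' y' \<longleftrightarrow> x = x' \<and> y = y'"
    and unum_inj: "inj (unum U)"
    and small_subset: "\<lbrakk>small U X; X' \<subseteq> X\<rbrakk> \<Longrightarrow> small U X'"
    and small_unum: "small U (range (unum U))"
    and small_UN: "(\<And>\<Delta> \<sigma>. small U (Xs \<Delta> \<sigma>)) \<Longrightarrow> small U (\<Union>\<Delta> :: 'o. \<Union>\<sigma> :: 'm. Xs \<Delta> \<sigma>)"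
    and ufam_inj: "small U X \<Longrightarrow> inj_on (ufam U) {f. \<forall>\<Delta> \<sigma> a. a \<notin> X \<longrightarrow> f \<Delta> \<sigma> a = undefined}"

definition ufst :: "('o, 'm, 'u) universe \<Rightarrow> 'u \<Rightarrow> 'u" where
  "ufst U z = (THE x. \<exists>y. z = upair U x y)"

definition usnd :: "('o, 'm, 'u) universe \<Rightarrow> 'u \<Rightarrow> 'u" where
  "usnd U z = (THE y. \<exists>x. z = upair U x y)"

context set_universe
begin

lemma ufst_upair [simp]: "ufst U (upair U x a) = x"
  by (auto simp: ufst_def upair_inj)

lemma usnd_upair [simp]: "usnd U (upair U x a) = a"
  by (auto simp: usnd_def upair_inj)

end

text \<open>For all types \<open>'o\<close>, \<open>'m\<close> and \<open>'b\<close> there is a universe structure on a type that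
  contains \<open>'b\<close>.  The existence of such a structure is thus no restriction on \<open>\<C>\<close>.\<close>

datatype ('o, 'm, 'b) utree =
    UBase 'b
  | UPair "('o, 'm, 'b) utree" "('o, 'm, 'b) utree"
  | UNum nat
  | UFam "'o \<Rightarrow> 'm \<Rightarrow> 'o \<times> 'm \<times> nat \<Rightarrow> ('o, 'm, 'b) utree"

definition utree_small :: "('o, 'm, 'b) utree set \<Rightarrow> bool" where
  "utree_small X \<longleftrightarrow> (\<exists>g :: 'o \<times> 'm \<times> nat \<Rightarrow> ('o, 'm, 'b) utree. X \<subseteq> range g)"

definition utree_fam :: "('o \<Rightarrow> 'm \<Rightarrow> ('o, 'm, 'b) utree \<Rightarrow> ('o, 'm, 'b) utree) \<Rightarrow> ('o, 'm, 'b) utree"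
  where "utree_fam f = (let g = SOME g. {a. \<exists>\<Delta> \<sigma>. f \<Delta> \<sigma> a \<noteq> undefined} \<subseteq> range g
     in UFam (\<lambda>\<Delta> \<sigma> k. UPair (g k) (f \<Delta> \<sigma> (g k))))"

lemma utree_universe:
  "set_universe \<lparr>small = utree_small, upair = UPair, unum = UNum, ufam = utree_fam
     :: ('o \<Rightarrow> 'm \<Rightarrow> ('o, 'm, 'b) utree \<Rightarrow> ('o, 'm, 'b) utree) \<Rightarrow> ('o, 'm, 'b) utree\<rparr>"
proof (unfold_locales, simp_all)
  show "inj UNum" by (simp add: inj_def)
  show "utree_small X \<Longrightarrow> X' \<subseteq> X \<Longrightarrow> utree_small X'" for X X' :: "('o, 'm, 'b) utree set"
    by (auto simp: utree_small_def)
  show "utree_small (range (UNum :: nat \<Rightarrow> ('o, 'm, 'b) utree))"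
    unfolding utree_small_def by (rule exI[of _ "\<lambda>(_, _, n). UNum n"]) (force simp: image_def)
next
  fix Xs :: "'o \<Rightarrow> 'm \<Rightarrow> ('o, 'm, 'b) utree set"
  assume "\<And>\<Delta> \<sigma>. utree_small (Xs \<Delta> \<sigma>)"
  then obtain g :: "'o \<Rightarrow> 'm \<Rightarrow> 'o \<times> 'm \<times> nat \<Rightarrow> ('o, 'm, 'b) utree"
    where g: "\<And>\<Delta> \<sigma>. Xs \<Delta> \<sigma> \<subseteq> range (g \<Delta> \<sigma>)"
    unfolding utree_small_def by metis
  let ?K = "UNIV :: ('o \<times> 'm \<times> nat) set"
  have "inj (\<lambda>n. (undefined, undefined, n) :: 'o \<times> 'm \<times> nat)"
    by (auto simp: inj_def)
  then have "infinite ?K"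
    using finite_imageD infinite_UNIV_nat by (metis finite_subset subset_UNIV)
  from ordIso_symmetric[OF card_of_Times_same_infinite[OF this]]
  obtain h where h: "bij_betw h ?K (?K \<times> ?K)"
    unfolding card_of_ordIso[symmetric] by blast
  let ?G = "\<lambda>k. let (k1, k2) = h k in g (fst k1) (fst (snd k1)) k2"
  have "(\<Union>\<Delta>. \<Union>\<sigma>. Xs \<Delta> \<sigma>) \<subseteq> range ?G"
  proof
    fix a assume "a \<in> (\<Union>\<Delta>. \<Union>\<sigma>. Xs \<Delta> \<sigma>)"
    then obtain \<Delta> \<sigma> k2 where a: "a = g \<Delta> \<sigma> k2" using g by blast
    obtain k where "h k = ((\<Delta>, \<sigma>, 0), k2)"
      using h unfolding bij_betw_def by (metis UNIV_Times_UNIV rangeE UNIV_I)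
    then have "a = ?G k" by (simp add: a)
    then show "a \<in> range ?G" by blast
  qed
  then show "utree_small (\<Union>\<Delta>. \<Union>\<sigma>. Xs \<Delta> \<sigma>)"
    unfolding utree_small_def by blast
next
  fix X :: "('o, 'm, 'b) utree set"
  assume X: "utree_small X"
  let ?S = "\<lambda>f :: 'o \<Rightarrow> 'm \<Rightarrow> ('o, 'm, 'b) utree \<Rightarrow> ('o, 'm, 'b) utree. {a. \<exists>\<Delta> \<sigma>. f \<Delta> \<sigma> a \<noteq> undefined}"
  show "inj_on utree_fam {f. \<forall>\<Delta> \<sigma> a. a \<notin> X \<longrightarrow> f \<Delta> \<sigma> a = undefined}"
  proof (rule inj_onI)
    fix f f' :: "'o \<Rightarrow> 'm \<Rightarrow> ('o, 'm, 'b) utree \<Rightarrow> ('o, 'm, 'b) utree"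
    assume f: "f \<in> {f. \<forall>\<Delta> \<sigma> a. a \<notin> X \<longrightarrow> f \<Delta> \<sigma> a = undefined}"
      and f': "f' \<in> {f. \<forall>\<Delta> \<sigma> a. a \<notin> X \<longrightarrow> f \<Delta> \<sigma> a = undefined}"
      and eq: "utree_fam f = utree_fam f'"
    obtain e :: "'o \<times> 'm \<times> nat \<Rightarrow> ('o, 'm, 'b) utree" where e: "X \<subseteq> range e"
      using X unfolding utree_small_def by blast
    define g :: "'o \<times> 'm \<times> nat \<Rightarrow> ('o, 'm, 'b) utree" where "g = (SOME g. ?S f \<subseteq> range g)"
    define g' :: "'o \<times> 'm \<times> nat \<Rightarrow> ('o, 'm, 'b) utree" where "g' = (SOME g. ?S f' \<subseteq> range g)"
    have g: "?S f \<subseteq> range g" unfolding g_def by (rule someI[of _ e]) (use f e in blast)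
    have g': "?S f' \<subseteq> range g'" unfolding g'_def by (rule someI[of _ e]) (use f' e in blast)
    have F: "(\<lambda>\<Delta> \<sigma> k. UPair (g k) (f \<Delta> \<sigma> (g k))) = (\<lambda>\<Delta> \<sigma> k. UPair (g' k) (f' \<Delta> \<sigma> (g' k)))"
      using eq by (simp add: utree_fam_def Let_def g_def g'_def)
    have G: "g k = g' k \<and> f \<Delta> \<sigma> (g k) = f' \<Delta> \<sigma> (g' k)" for \<Delta> \<sigma> k
      using fun_cong[OF fun_cong[OF fun_cong[OF F, of \<Delta>], of \<sigma>], of k] unfolding utree.inject .
    then have "g = g'" by (intro ext) blast
    then have H: "f \<Delta> \<sigma> (g k) = f' \<Delta> \<sigma> (g k)" for \<Delta> \<sigma> k using G by metis
    show "f = f'"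
    proof (intro ext)
      fix \<Delta> \<sigma> a
      show "f \<Delta> \<sigma> a = f' \<Delta> \<sigma> a"
      proof (cases "a \<in> range g")
        case True then show ?thesis using H by blast
      next
        case False
        then have "f \<Delta> \<sigma> a = undefined" "f' \<Delta> \<sigma> a = undefined"
          using g g' \<open>g = g'\<close> by blast+
        then show ?thesis by simp
      qed
    qed
  qed
qed

section \<open>Presheaves\<close>

text \<open>
  Presheaves, natural transformations and terms are given by total functions.  The functions
  \<open>mk_psh\<close>, \<open>mk_ntrans\<close> and \<open>mk_ptm\<close> assign default values outside the relevant domains, so that
  equality of the representing functions is equality of the represented presheaves.
\<close>

record ('o, 'm, 'u) psh =
  at :: "'o \<Rightarrow> 'u set"
  act :: "'m \<Rightarrow> 'u \<Rightarrow> 'u"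

definition mk_psh ::
    "('o, 'm, 'z) cat_scheme \<Rightarrow> ('o \<Rightarrow> 'u set) \<Rightarrow> ('m \<Rightarrow> 'u \<Rightarrow> 'u) \<Rightarrow> ('o, 'm, 'u) psh" where
  "mk_psh C F r = \<lparr>
     at = (\<lambda>\<Gamma>. if \<Gamma> \<in> Obj C then F \<Gamma> else {}),
     act = (\<lambda>\<sigma> x. if \<sigma> \<in> Arr C \<and> x \<in> F (Cod C \<sigma>) then r \<sigma> x else undefined)\<rparr>"

definition presheaf :: "('o, 'm, 'z) cat_scheme \<Rightarrow> ('o, 'm, 'u) psh \<Rightarrow> bool" where
  "presheaf C P \<longleftrightarrow>
     P = mk_psh C (at P) (act P) \<and>
     (\<forall>\<Delta> \<Gamma>. \<forall>\<sigma> \<in> hom C \<Delta> \<Gamma>. \<forall>x \<in> at P \<Gamma>. act P \<sigma> x \<in> at P \<Delta>) \<and>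
     (\<forall>\<Gamma> \<in> Obj C. \<forall>x \<in> at P \<Gamma>. act P (idn C \<Gamma>) x = x) \<and>
     (\<forall>\<Theta> \<Delta> \<Gamma>. \<forall>\<sigma> \<in> hom C \<Delta> \<Gamma>. \<forall>\<tau> \<in> hom C \<Theta> \<Delta>. \<forall>x \<in> at P \<Gamma>.
        act P (\<sigma> \<odot>\<^bsub>C\<^esub> \<tau>) x = act P \<tau> (act P \<sigma> x))"

record ('o, 'm, 'u) ntrans =
  src :: "('o, 'm, 'u) psh"
  tgt :: "('o, 'm, 'u) psh"
  cpt :: "'o \<Rightarrow> 'u \<Rightarrow> 'u"

definition mk_ntrans :: "('o, 'm, 'z) cat_scheme \<Rightarrow> ('o, 'm, 'u) psh \<Rightarrow> ('o, 'm, 'u) psh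
    \<Rightarrow> ('o \<Rightarrow> 'u \<Rightarrow> 'u) \<Rightarrow> ('o, 'm, 'u) ntrans" where
  "mk_ntrans C P Q k = \<lparr>src = P, tgt = Q,
     cpt = (\<lambda>\<Gamma> x. if \<Gamma> \<in> Obj C \<and> x \<in> at P \<Gamma> then k \<Gamma> x else undefined)\<rparr>"

definition nat_trans :: "('o, 'm, 'z) cat_scheme \<Rightarrow> ('o, 'm, 'u) ntrans \<Rightarrow> bool" where
  "nat_trans C \<phi> \<longleftrightarrow>
     presheaf C (src \<phi>) \<and> presheaf C (tgt \<phi>) \<and>
     \<phi> = mk_ntrans C (src \<phi>) (tgt \<phi>) (cpt \<phi>) \<and>
     (\<forall>\<Gamma> \<in> Obj C. \<forall>x \<in> at (src \<phi>) \<Gamma>. cpt \<phi> \<Gamma> x \<in> at (tgt \<phi>) \<Gamma>) \<and>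
     (\<forall>\<Delta> \<Gamma>. \<forall>\<sigma> \<in> hom C \<Delta> \<Gamma>. \<forall>x \<in> at (src \<phi>) \<Gamma>.
        cpt \<phi> \<Delta> (act (src \<phi>) \<sigma> x) = act (tgt \<phi>) \<sigma> (cpt \<phi> \<Gamma> x))"

definition ncomp :: "('o, 'm, 'z) cat_scheme \<Rightarrow> ('o, 'm, 'u) ntrans \<Rightarrow> ('o, 'm, 'u) ntrans
    \<Rightarrow> ('o, 'm, 'u) ntrans" where
  "ncomp C \<phi> \<psi> = mk_ntrans C (src \<psi>) (tgt \<phi>) (\<lambda>\<Gamma> x. cpt \<phi> \<Gamma> (cpt \<psi> \<Gamma> x))"

text \<open>The arrow \<open>(\<sigma>, x)\<close> of the category of elements, for \<open>\<sigma> : \<Delta> \<rightarrow> \<Gamma>\<close> and \<open>x \<in> P(\<Gamma>)\<close>, is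
  \<open>\<sigma> : (\<Delta>, x[\<sigma>]) \<rightarrow> (\<Gamma>, x)\<close>.\<close>

definition elements :: "('o, 'm, 'z) cat_scheme \<Rightarrow> ('o, 'm, 'u) psh \<Rightarrow> ('o \<times> 'u, 'm \<times> 'u) cat" where
  "elements C P = \<lparr>
     Obj = {(\<Gamma>, x). \<Gamma> \<in> Obj C \<and> x \<in> at P \<Gamma>},
     Arr = {(\<sigma>, x). \<sigma> \<in> Arr C \<and> x \<in> at P (Cod C \<sigma>)},
     Dom = (\<lambda>(\<sigma>, x). (Dom C \<sigma>, act P \<sigma> x)),
     Cod = (\<lambda>(\<sigma>, x). (Cod C \<sigma>, x)),
     idn = (\<lambda>(\<Gamma>, x). (idn C \<Gamma>, x)),
     cmp = (\<lambda>(\<sigma>, x) (\<tau>, y). (\<sigma> \<odot>\<^bsub>C\<^esub> \<tau>, x))\<rparr>"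

type_synonym ('o, 'm, 'u) pty = "('o \<times> 'u, 'm \<times> 'u, 'u) psh"

type_synonym ('o, 'u) ptm = "'o \<Rightarrow> 'u \<Rightarrow> 'u"

definition pty_sub :: "('o, 'm, 'z) cat_scheme \<Rightarrow> ('o, 'm, 'u) pty \<Rightarrow> ('o, 'm, 'u) ntrans
    \<Rightarrow> ('o, 'm, 'u) pty" where
  "pty_sub C A \<phi> = mk_psh (elements C (src \<phi>))
     (\<lambda>(\<Gamma>, x). at A (\<Gamma>, cpt \<phi> \<Gamma> x))
     (\<lambda>(\<sigma>, x) a. act A (\<sigma>, cpt \<phi> (Cod C \<sigma>) x) a)"

definition mk_ptm :: "('o, 'm, 'z) cat_scheme \<Rightarrow> ('o, 'm, 'u) psh \<Rightarrow> ('o \<Rightarrow> 'u \<Rightarrow> 'u)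
    \<Rightarrow> ('o, 'u) ptm" where
  "mk_ptm C P a = (\<lambda>\<Gamma> x. if \<Gamma> \<in> Obj C \<and> x \<in> at P \<Gamma> then a \<Gamma> x else undefined)"

definition ptms :: "('o, 'm, 'z) cat_scheme \<Rightarrow> ('o, 'm, 'u) psh \<Rightarrow> ('o, 'm, 'u) pty
    \<Rightarrow> ('o, 'u) ptm set" where
  "ptms C P A = {a. a = mk_ptm C P a \<and>
     (\<forall>\<Gamma> \<in> Obj C. \<forall>x \<in> at P \<Gamma>. a \<Gamma> x \<in> at A (\<Gamma>, x)) \<and>
     (\<forall>\<Delta> \<Gamma>. \<forall>\<sigma> \<in> hom C \<Delta> \<Gamma>. \<forall>x \<in> at P \<Gamma>. act A (\<sigma>, x) (a \<Gamma> x) = a \<Delta> (act P \<sigma> x))}"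

definition ptm_sub :: "('o, 'm, 'z) cat_scheme \<Rightarrow> ('o, 'u) ptm \<Rightarrow> ('o, 'm, 'u) ntrans
    \<Rightarrow> ('o, 'u) ptm" where
  "ptm_sub C a \<phi> = mk_ptm C (src \<phi>) (\<lambda>\<Gamma> x. a \<Gamma> (cpt \<phi> \<Gamma> x))"

definition pext :: "('o, 'm, 'u) universe \<Rightarrow> ('o, 'm, 'z) cat_scheme \<Rightarrow> ('o, 'm, 'u) psh
    \<Rightarrow> ('o, 'm, 'u) pty \<Rightarrow> ('o, 'm, 'u) psh" where
  "pext U C P A = mk_psh C
     (\<lambda>\<Gamma>. {upair U x a | x a. x \<in> at P \<Gamma> \<and> a \<in> at A (\<Gamma>, x)})
     (\<lambda>\<sigma> z. upair U (act P \<sigma> (ufst U z)) (act A (\<sigma>, ufst U z) (usnd U z)))"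

definition pterminal :: "('o, 'm, 'u) universe \<Rightarrow> ('o, 'm, 'z) cat_scheme \<Rightarrow> ('o, 'm, 'u) psh" where
  "pterminal U C = mk_psh C (\<lambda>_. {unum U 0}) (\<lambda>_ x. x)"

text \<open>The uncoded elements of \<open>\<Pi>\<^sup>e(A, B)(\<Gamma>, x)\<close>.\<close>

definition pi_families :: "('o, 'm, 'u) universe \<Rightarrow> ('o, 'm, 'z) cat_scheme \<Rightarrow> ('o, 'm, 'u) psh
    \<Rightarrow> ('o, 'm, 'u) pty \<Rightarrow> ('o, 'm, 'u) pty \<Rightarrow> 'o \<Rightarrow> 'u \<Rightarrow> ('o \<Rightarrow> 'm \<Rightarrow> 'u \<Rightarrow> 'u) set" where
  "pi_families U C P A B \<Gamma> x = {f.
     (\<forall>\<Delta> \<sigma> a. if \<sigma> \<in> hom C \<Delta> \<Gamma> \<and> a \<in> at A (\<Delta>, act P \<sigma> x)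
              then f \<Delta> \<sigma> a \<in> at B (\<Delta>, upair U (act P \<sigma> x) a)
              else f \<Delta> \<sigma> a = undefined) \<and>
     (\<forall>\<Theta> \<Delta>. \<forall>\<sigma> \<in> hom C \<Delta> \<Gamma>. \<forall>a \<in> at A (\<Delta>, act P \<sigma> x). \<forall>\<tau> \<in> hom C \<Theta> \<Delta>.
        act B (\<tau>, upair U (act P \<sigma> x) a) (f \<Delta> \<sigma> a)
        = f \<Theta> (\<sigma> \<odot>\<^bsub>C\<^esub> \<tau>) (act A (\<tau>, act P \<sigma> x) a))}"

text \<open>The coding of families is injective here, and \<open>\<Pi>\<^sup>e(A, B)\<close> therefore the exo-type that is
  intended, whenever the sets \<open>A(\<Gamma>, x)\<close> are small (see \<open>pi_families_inj\<close> below).\<close>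

definition pPi :: "('o, 'm, 'u) universe \<Rightarrow> ('o, 'm, 'z) cat_scheme \<Rightarrow> ('o, 'm, 'u) psh
    \<Rightarrow> ('o, 'm, 'u) pty \<Rightarrow> ('o, 'm, 'u) pty \<Rightarrow> ('o, 'm, 'u) pty" where
  "pPi U C P A B = mk_psh (elements C P)
     (\<lambda>(\<Gamma>, x). ufam U ` pi_families U C P A B \<Gamma> x)
     (\<lambda>(\<tau>, x) w. let f = inv_into (pi_families U C P A B (Cod C \<tau>) x) (ufam U) w in
        ufam U (\<lambda>\<Theta> \<rho> a. if \<rho> \<in> hom C \<Theta> (Dom C \<tau>) \<and> a \<in> at A (\<Theta>, act P \<rho> (act P \<tau> x))
                        then f \<Theta> (\<tau> \<odot>\<^bsub>C\<^esub> \<rho>) a else undefined))"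

definition exo_nat :: "('o, 'm, 'u) universe \<Rightarrow> ('o, 'm, 'z) cat_scheme \<Rightarrow> ('o, 'm, 'u) pty" where
  "exo_nat U C = mk_psh (elements C (pterminal U C)) (\<lambda>_. range (unum U)) (\<lambda>_ a. a)"

section \<open>The presheaf two-level category with families\<close>

definition ty_psh :: "('o, 'm, 'u, 'a, 'z) cwf_scheme \<Rightarrow> ('o, 'm, 'u) psh" where
  "ty_psh C = mk_psh C (Ty C) (\<lambda>\<sigma> A. A \<cdot>\<^bsub>C\<^esub> \<sigma>)"

definition fty_conv :: "('o, 'm, 'u, 'u, 'z) cwf_scheme \<Rightarrow> ('o, 'm, 'u) psh \<Rightarrow> ('o, 'm, 'u) ntrans
    \<Rightarrow> ('o, 'm, 'u) pty" where
  "fty_conv C P A = mk_psh (elements C P)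
     (\<lambda>(\<Gamma>, x). Tm C \<Gamma> (cpt A \<Gamma> x))
     (\<lambda>(\<sigma>, x) a. tmsub C (cpt A (Cod C \<sigma>) x) a \<sigma>)"

text \<open>\<open>\<Pi>\<close> and \<open>\<Sigma>\<close> are inherited pointwise by applying the type former \<open>T\<close> of \<open>\<C>\<close> to
  \<open>A\<^sub>\<Gamma>(x)\<close> and \<open>B(x[p], q)\<close>; an element of \<open>P.A.A[p]\<close> over \<open>\<Gamma>\<close> is of the form
  \<open>((x, a), b)\<close>.\<close>

definition fty_binder :: "('o, 'm, 'u) universe \<Rightarrow> ('o, 'm, 'u, 'u, 'z) cwf_scheme
    \<Rightarrow> ('o \<Rightarrow> 'u \<Rightarrow> 'u \<Rightarrow> 'u) \<Rightarrow> ('o, 'm, 'u) psh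
    \<Rightarrow> ('o, 'm, 'u) ntrans \<Rightarrow> ('o, 'm, 'u) ntrans \<Rightarrow> ('o, 'm, 'u) ntrans" where
  "fty_binder U C T P A B = mk_ntrans C P (ty_psh C) (\<lambda>\<Gamma> x.
     T \<Gamma> (cpt A \<Gamma> x)
       (cpt B (cext C \<Gamma> (cpt A \<Gamma> x))
          (upair U (act P (pp C \<Gamma> (cpt A \<Gamma> x)) x) (qq C \<Gamma> (cpt A \<Gamma> x)))))"

definition fty_Id :: "('o, 'm, 'u) universe \<Rightarrow> ('o, 'm, 'u, 'u, 'z) cwf_psi_scheme
    \<Rightarrow> ('o, 'm, 'u) psh \<Rightarrow> ('o, 'm, 'u) ntrans \<Rightarrow> ('o, 'm, 'u) ntrans" where
  "fty_Id U C P A =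
     (let PA = pext U C P (fty_conv C P A);
          \<pi> = mk_ntrans C PA P (\<lambda>_ z. ufst U z);
          PAA = pext U C PA (fty_conv C PA (ncomp C A \<pi>))
      in mk_ntrans C PAA (ty_psh C) (\<lambda>\<Gamma> z.
           IdT C \<Gamma> (cpt A \<Gamma> (ufst U (ufst U z))) (usnd U (ufst U z)) (usnd U z)))"

definition psh_tlcwf :: "('o, 'm, 'u) universe \<Rightarrow> ('o, 'm, 'u, 'u, 'z) cwf_psi_scheme
    \<Rightarrow> (('o, 'm, 'u) psh, ('o, 'm, 'u) ntrans, ('o, 'm, 'u) pty, ('o, 'u) ptm,
        ('o, 'm, 'u) ntrans) tlcwf" where
  "psh_tlcwf U C = \<lparr>
     Obj = {P. presheaf C P},
     Arr = {\<phi>. nat_trans C \<phi>},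
     Dom = src,
     Cod = tgt,
     idn = (\<lambda>P. mk_ntrans C P P (\<lambda>_ x. x)),
     cmp = ncomp C,
     One = pterminal U C,
     Ty = (\<lambda>P. {A. presheaf (elements C P) A}),
     tysub = pty_sub C,
     Tm = ptms C,
     tmsub = (\<lambda>_. ptm_sub C),
     cext = pext U C,
     pp = (\<lambda>P A. mk_ntrans C (pext U C P A) P (\<lambda>_ z. ufst U z)),
     qq = (\<lambda>P A. mk_ptm C (pext U C P A) (\<lambda>_ z. usnd U z)),
     PiE = pPi U C,
     TyF = (\<lambda>P. {A. nat_trans C A \<and> src A = P \<and> tgt A = ty_psh C}),
     tysubF = ncomp C,
     conv = fty_conv C,
     PiF = fty_binder U C (Pi C),
     SigF = fty_binder U C (Sig C),
     IdF = fty_Id U C\<rparr>"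

section \<open>The presheaf model is a two-level category with families\<close>

context category
begin

lemma homD: "\<sigma> \<in> hom C \<Delta> \<Gamma> \<Longrightarrow> \<Delta> \<in> Obj C \<and> \<Gamma> \<in> Obj C \<and> \<sigma> \<in> Arr C \<and> Dom C \<sigma> = \<Delta> \<and> Cod C \<sigma> = \<Gamma>"
  using dom_obj cod_obj by (auto simp: hom_def)

lemma Arr_hom: "\<sigma> \<in> Arr C \<Longrightarrow> \<sigma> \<in> hom C (Dom C \<sigma>) (Cod C \<sigma>)"
  by (simp add: hom_def)

lemma at_mk_psh: "at (mk_psh C F r) \<Gamma> = (if \<Gamma> \<in> Obj C then F \<Gamma> else {})"
  by (simp add: mk_psh_def)

lemma act_mk_psh: "\<lbrakk>\<sigma> \<in> hom C \<Delta> \<Gamma>; x \<in> F \<Gamma>\<rbrakk> \<Longrightarrow> act (mk_psh C F r) \<sigma> x = r \<sigma> x"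
  using homD by (auto simp: mk_psh_def)

lemma mk_psh_idem: "mk_psh C (at (mk_psh C F r)) (act (mk_psh C F r)) = mk_psh C F r"
  by (auto simp: mk_psh_def cod_obj fun_eq_iff)

lemma at_Obj: "\<lbrakk>presheaf C P; x \<in> at P \<Gamma>\<rbrakk> \<Longrightarrow> \<Gamma> \<in> Obj C"
proof -
  assume "presheaf C P" "x \<in> at P \<Gamma>"
  then have "P = mk_psh C (at P) (act P)" by (simp add: presheaf_def)
  then have "at P \<Gamma> = (if \<Gamma> \<in> Obj C then at P \<Gamma> else {})" by (metis at_mk_psh)
  then show ?thesis using \<open>x \<in> at P \<Gamma>\<close> by (auto split: if_splits)
qed

lemma presheaf_mk:
  assumes "\<And>\<Delta> \<Gamma> \<sigma> x. \<lbrakk>\<sigma> \<in> hom C \<Delta> \<Gamma>; x \<in> F \<Gamma>\<rbrakk> \<Longrightarrow> r \<sigma> x \<in> F \<Delta>"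
    and "\<And>\<Gamma> x. \<lbrakk>\<Gamma> \<in> Obj C; x \<in> F \<Gamma>\<rbrakk> \<Longrightarrow> r (idn C \<Gamma>) x = x"
    and "\<And>\<Theta> \<Delta> \<Gamma> \<sigma> \<tau> x. \<lbrakk>\<sigma> \<in> hom C \<Delta> \<Gamma>; \<tau> \<in> hom C \<Theta> \<Delta>; x \<in> F \<Gamma>\<rbrakk>
      \<Longrightarrow> r (\<sigma> \<odot> \<tau>) x = r \<tau> (r \<sigma> x)"
  shows "presheaf C (mk_psh C F r)"
proof -
  have 1: "act (mk_psh C F r) \<sigma> x \<in> at (mk_psh C F r) \<Delta>"
    if "\<sigma> \<in> hom C \<Delta> \<Gamma>" "x \<in> at (mk_psh C F r) \<Gamma>" for \<Delta> \<Gamma> \<sigma> x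
    using that homD[OF that(1)] assms(1)[OF that(1)] act_mk_psh[of \<sigma> \<Delta> \<Gamma> x F r]
    by (simp add: at_mk_psh)
  have 2: "act (mk_psh C F r) (idn C \<Gamma>) x = x"
    if "\<Gamma> \<in> Obj C" "x \<in> at (mk_psh C F r) \<Gamma>" for \<Gamma> x
    using that assms(2)[OF that(1)] act_mk_psh[OF idn_hom[OF that(1)], of x F r] by (simp add: at_mk_psh)
  have 3: "act (mk_psh C F r) (\<sigma> \<odot> \<tau>) x = act (mk_psh C F r) \<tau> (act (mk_psh C F r) \<sigma> x)"
    if "\<sigma> \<in> hom C \<Delta> \<Gamma>" "\<tau> \<in> hom C \<Theta> \<Delta>" "x \<in> at (mk_psh C F r) \<Gamma>" for \<Theta> \<Delta> \<Gamma> \<sigma> \<tau> x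
  proof -
    have "x \<in> F \<Gamma>" using that homD[OF that(1)] by (simp add: at_mk_psh)
    then show ?thesis
      using that assms(1)[OF that(1)] assms(3)[OF that(1,2)]
      by (simp add: act_mk_psh[OF cmp_hom[OF that(1,2)]] act_mk_psh[OF that(1)] act_mk_psh[OF that(2)])
  qed
  show ?thesis unfolding presheaf_def using 1 2 3 mk_psh_idem by metis
qed

lemma psh_eqI:
  assumes "presheaf C P" "presheaf C Q"
    and "\<And>\<Gamma>. \<Gamma> \<in> Obj C \<Longrightarrow> at P \<Gamma> = at Q \<Gamma>"
    and "\<And>\<Delta> \<Gamma> \<sigma> x. \<lbrakk>\<sigma> \<in> hom C \<Delta> \<Gamma>; x \<in> at P \<Gamma>\<rbrakk> \<Longrightarrow> act P \<sigma> x = act Q \<sigma> x"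
  shows "P = Q"
proof -
  have "P = mk_psh C (at P) (act P)" "Q = mk_psh C (at Q) (act Q)"
    using assms(1,2) by (simp_all add: presheaf_def)
  moreover have "mk_psh C (at P) (act P) = mk_psh C (at Q) (act Q)"
    using assms(3) assms(4)[OF Arr_hom] cod_obj by (auto simp: mk_psh_def fun_eq_iff)
  ultimately show ?thesis by simp
qed

lemma act_at: "\<lbrakk>presheaf C P; \<sigma> \<in> hom C \<Delta> \<Gamma>; x \<in> at P \<Gamma>\<rbrakk> \<Longrightarrow> act P \<sigma> x \<in> at P \<Delta>"
  by (auto simp: presheaf_def)

lemma act_idn: "\<lbrakk>presheaf C P; x \<in> at P \<Gamma>\<rbrakk> \<Longrightarrow> act P (idn C \<Gamma>) x = x"
  using at_Obj by (metis presheaf_def)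

lemma act_cmp: "\<lbrakk>presheaf C P; \<sigma> \<in> hom C \<Delta> \<Gamma>; \<tau> \<in> hom C \<Theta> \<Delta>; x \<in> at P \<Gamma>\<rbrakk>
    \<Longrightarrow> act P (\<sigma> \<odot> \<tau>) x = act P \<tau> (act P \<sigma> x)"
  by (auto simp: presheaf_def)

lemma elements_hom: "s \<in> hom (elements C P) D G \<longleftrightarrow>
  (\<exists>\<sigma> \<Delta> \<Gamma> x. s = (\<sigma>, x) \<and> \<sigma> \<in> hom C \<Delta> \<Gamma> \<and> x \<in> at P \<Gamma> \<and> D = (\<Delta>, act P \<sigma> x) \<and> G = (\<Gamma>, x))"
  by (auto simp: elements_def hom_def)

lemma elements_Obj: "(\<Gamma>, x) \<in> Obj (elements C P) \<longleftrightarrow> \<Gamma> \<in> Obj C \<and> x \<in> at P \<Gamma>"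
  by (simp add: elements_def)

lemma elements_idn: "idn (elements C P) (\<Gamma>, x) = (idn C \<Gamma>, x)"
  by (simp add: elements_def)

lemma elements_cmp: "cmp (elements C P) (\<sigma>, x) (\<tau>, y) = (\<sigma> \<odot> \<tau>, x)"
  by (simp add: elements_def)

lemma elements_category: assumes P: "presheaf C P" shows "category (elements C P)"
proof
  fix s assume "s \<in> Arr (elements C P)"
  then obtain \<sigma> x where s: "s = (\<sigma>, x)" "\<sigma> \<in> Arr C" "x \<in> at P (Cod C \<sigma>)"
    by (auto simp: elements_def)
  then show "Dom (elements C P) s \<in> Obj (elements C P)" "Cod (elements C P) s \<in> Obj (elements C P)"
    using act_at[OF P Arr_hom[OF s(2)] s(3)] by (simp_all add: elements_def dom_obj cod_obj)
next
  show "idn (elements C P) G \<in> hom (elements C P) G G" if "G \<in> Obj (elements C P)" for G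
  proof -
    obtain \<Gamma> x where G: "G = (\<Gamma>, x)" by (cases G)
    show ?thesis using that act_idn[OF P, of x \<Gamma>] idn_hom[of \<Gamma>]
      unfolding G elements_hom elements_idn elements_Obj by force
  qed
  fix s D G assume s0: "s \<in> hom (elements C P) D G"
  then obtain \<sigma> \<Delta> \<Gamma> x where s: "s = (\<sigma>, x)" "\<sigma> \<in> hom C \<Delta> \<Gamma>" "x \<in> at P \<Gamma>"
    "D = (\<Delta>, act P \<sigma> x)" "G = (\<Gamma>, x)" by (auto simp: elements_hom)
  show "cmp (elements C P) s (idn (elements C P) D) = s"
    using cmp_idn[OF s(2)] by (simp add: s(1,4) elements_cmp elements_idn)
  show "cmp (elements C P) (idn (elements C P) G) s = s"
    using idn_cmp[OF s(2)] by (simp add: s(1,5) elements_cmp elements_idn)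
  fix t T assume t0: "t \<in> hom (elements C P) T D"
  with s obtain \<tau> \<Theta> where t: "t = (\<tau>, act P \<sigma> x)" "\<tau> \<in> hom C \<Theta> \<Delta>"
    "T = (\<Theta>, act P \<tau> (act P \<sigma> x))" by (auto simp: elements_hom)
  show "cmp (elements C P) s t \<in> hom (elements C P) T G"
    using cmp_hom[OF s(2) t(2)] act_cmp[OF P s(2) t(2) s(3)] s(3)
    by (simp add: s(1,5) t(1,3) elements_cmp elements_hom)
  fix r X assume "r \<in> hom (elements C P) X T"
  with t obtain \<rho> \<Xi> where r: "r = (\<rho>, act P \<tau> (act P \<sigma> x))" "\<rho> \<in> hom C \<Xi> \<Theta>"
    by (auto simp: elements_hom)
  show "cmp (elements C P) (cmp (elements C P) s t) r = cmp (elements C P) s (cmp (elements C P) t r)"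
    using cmp_assoc[OF s(2) t(2) r(2)] by (simp add: s(1) t(1) r(1) elements_cmp)
qed

lemma pty_mk:
  assumes P: "presheaf C P"
    and "\<And>\<Delta> \<Gamma> \<sigma> x a. \<lbrakk>\<sigma> \<in> hom C \<Delta> \<Gamma>; x \<in> at P \<Gamma>; a \<in> F (\<Gamma>, x)\<rbrakk>
      \<Longrightarrow> r (\<sigma>, x) a \<in> F (\<Delta>, act P \<sigma> x)"
    and "\<And>\<Gamma> x a. \<lbrakk>\<Gamma> \<in> Obj C; x \<in> at P \<Gamma>; a \<in> F (\<Gamma>, x)\<rbrakk> \<Longrightarrow> r (idn C \<Gamma>, x) a = a"
    and "\<And>\<Theta> \<Delta> \<Gamma> \<sigma> \<tau> x a. \<lbrakk>\<sigma> \<in> hom C \<Delta> \<Gamma>; \<tau> \<in> hom C \<Theta> \<Delta>; x \<in> at P \<Gamma>; a \<in> F (\<Gamma>, x)\<rbrakk>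
      \<Longrightarrow> r (\<sigma> \<odot> \<tau>, x) a = r (\<tau>, act P \<sigma> x) (r (\<sigma>, x) a)"
  shows "presheaf (elements C P) (mk_psh (elements C P) F r)"
proof (rule category.presheaf_mk[OF elements_category[OF P]])
  show "r s a \<in> F D" if "s \<in> hom (elements C P) D G" "a \<in> F G" for D G s a
    using that assms(2) by (auto simp: elements_hom)
  show "r (idn (elements C P) G) a = a" if "G \<in> Obj (elements C P)" "a \<in> F G" for G a
    using that assms(3) by (cases G) (auto simp: elements_Obj elements_idn)
  show "r (cmp (elements C P) s t) a = r t (r s a)"
    if "s \<in> hom (elements C P) D G" "t \<in> hom (elements C P) T D" "a \<in> F G" for T D G s t a
  proof -
    from that(1) obtain \<sigma> \<Delta> \<Gamma> x where s: "s = (\<sigma>, x)" "\<sigma> \<in> hom C \<Delta> \<Gamma>" "x \<in> at P \<Gamma>"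
      "D = (\<Delta>, act P \<sigma> x)" "G = (\<Gamma>, x)" by (auto simp: elements_hom)
    from that(2) s obtain \<tau> \<Theta> where t: "t = (\<tau>, act P \<sigma> x)" "\<tau> \<in> hom C \<Theta> \<Delta>"
      by (auto simp: elements_hom)
    show ?thesis using assms(4)[OF s(2) t(2) s(3)] that(3) s t by (simp add: elements_cmp)
  qed
qed

lemma pty_at: "at (mk_psh (elements C P) F r) (\<Gamma>, x) = (if \<Gamma> \<in> Obj C \<and> x \<in> at P \<Gamma> then F (\<Gamma>, x) else {})"
  by (simp add: mk_psh_def elements_Obj)

lemma pty_act: "\<lbrakk>\<sigma> \<in> hom C \<Delta> \<Gamma>; x \<in> at P \<Gamma>; a \<in> F (\<Gamma>, x)\<rbrakk>
    \<Longrightarrow> act (mk_psh (elements C P) F r) (\<sigma>, x) a = r (\<sigma>, x) a"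
  by (auto simp: mk_psh_def elements_def hom_def)

lemma pty_act_at: "\<lbrakk>presheaf C P; presheaf (elements C P) A; \<sigma> \<in> hom C \<Delta> \<Gamma>; x \<in> at P \<Gamma>; a \<in> at A (\<Gamma>, x)\<rbrakk>
    \<Longrightarrow> act A (\<sigma>, x) a \<in> at A (\<Delta>, act P \<sigma> x)"
  using category.act_at[OF elements_category, of P A "(\<sigma>, x)" "(\<Delta>, act P \<sigma> x)" "(\<Gamma>, x)" a]
  by (auto simp: elements_hom)

lemma pty_act_idn: "\<lbrakk>presheaf C P; presheaf (elements C P) A; a \<in> at A (\<Gamma>, x)\<rbrakk>
    \<Longrightarrow> act A (idn C \<Gamma>, x) a = a"
  using category.act_idn[OF elements_category, of P A a "(\<Gamma>, x)"] by (simp add: elements_idn)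

lemma pty_act_cmp: "\<lbrakk>presheaf C P; presheaf (elements C P) A; \<sigma> \<in> hom C \<Delta> \<Gamma>; \<tau> \<in> hom C \<Theta> \<Delta>; x \<in> at P \<Gamma>; a \<in> at A (\<Gamma>, x)\<rbrakk>
    \<Longrightarrow> act A (\<sigma> \<odot> \<tau>, x) a = act A (\<tau>, act P \<sigma> x) (act A (\<sigma>, x) a)"
  using category.act_cmp[OF elements_category, of P A "(\<sigma>, x)" "(\<Delta>, act P \<sigma> x)" "(\<Gamma>, x)"
     "(\<tau>, act P \<sigma> x)" "(\<Theta>, act P \<tau> (act P \<sigma> x))" a] act_at[of P \<sigma> \<Delta> \<Gamma> x]
  by (simp add: elements_hom elements_cmp)

lemma pty_at_Obj: "\<lbrakk>presheaf C P; presheaf (elements C P) A; a \<in> at A (\<Gamma>, x)\<rbrakk> \<Longrightarrow> \<Gamma> \<in> Obj C \<and> x \<in> at P \<Gamma>"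
  using category.at_Obj[OF elements_category, of P A a "(\<Gamma>, x)"] by (simp add: elements_Obj)

lemma pty_eqI:
  assumes P: "presheaf C P" and A: "presheaf (elements C P) A" "presheaf (elements C P) B"
    and "\<And>\<Gamma> x. \<lbrakk>\<Gamma> \<in> Obj C; x \<in> at P \<Gamma>\<rbrakk> \<Longrightarrow> at A (\<Gamma>, x) = at B (\<Gamma>, x)"
    and "\<And>\<Delta> \<Gamma> \<sigma> x a. \<lbrakk>\<sigma> \<in> hom C \<Delta> \<Gamma>; x \<in> at P \<Gamma>; a \<in> at A (\<Gamma>, x)\<rbrakk>
      \<Longrightarrow> act A (\<sigma>, x) a = act B (\<sigma>, x) a"
  shows "A = B"
proof (rule category.psh_eqI[OF elements_category[OF P] A])
  show "at A G = at B G" if "G \<in> Obj (elements C P)" for G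
    using that assms(4) by (cases G) (auto simp: elements_Obj)
  show "act A s a = act B s a" if "s \<in> hom (elements C P) D G" "a \<in> at A G" for D G s a
    using that assms(5) by (auto simp: elements_hom)
qed

lemma cpt_mk: "\<lbrakk>\<Gamma> \<in> Obj C; x \<in> at P \<Gamma>\<rbrakk> \<Longrightarrow> cpt (mk_ntrans C P Q k) \<Gamma> x = k \<Gamma> x"
  by (simp add: mk_ntrans_def)

lemma src_mk [simp]: "src (mk_ntrans C P Q k) = P" by (simp add: mk_ntrans_def)
lemma tgt_mk [simp]: "tgt (mk_ntrans C P Q k) = Q" by (simp add: mk_ntrans_def)

lemma mk_idem [simp]: "mk_ntrans C P Q (cpt (mk_ntrans C P Q k)) = mk_ntrans C P Q k"
  by (auto simp: mk_ntrans_def fun_eq_iff)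

lemma nat_trans_mk:
  assumes P: "presheaf C P" and Q: "presheaf C Q"
    and "\<And>\<Gamma> x. \<lbrakk>\<Gamma> \<in> Obj C; x \<in> at P \<Gamma>\<rbrakk> \<Longrightarrow> k \<Gamma> x \<in> at Q \<Gamma>"
    and "\<And>\<Delta> \<Gamma> \<sigma> x. \<lbrakk>\<sigma> \<in> hom C \<Delta> \<Gamma>; x \<in> at P \<Gamma>\<rbrakk> \<Longrightarrow> k \<Delta> (act P \<sigma> x) = act Q \<sigma> (k \<Gamma> x)"
  shows "nat_trans C (mk_ntrans C P Q k)"
  unfolding nat_trans_def
  using assms act_at[OF P] homD by (auto simp: cpt_mk)

lemma nat_trans_eqI:
  assumes "nat_trans C f" "nat_trans C g" "src f = src g" "tgt f = tgt g"
    and "\<And>\<Gamma> x. \<lbrakk>\<Gamma> \<in> Obj C; x \<in> at (src f) \<Gamma>\<rbrakk> \<Longrightarrow> cpt f \<Gamma> x = cpt g \<Gamma> x"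
  shows "f = g"
proof -
  have "f = mk_ntrans C (src f) (tgt f) (cpt f)" "g = mk_ntrans C (src g) (tgt g) (cpt g)"
    using assms(1,2) by (simp_all add: nat_trans_def)
  moreover have "mk_ntrans C (src f) (tgt f) (cpt f) = mk_ntrans C (src g) (tgt g) (cpt g)"
    using assms(3-5) by (auto simp: mk_ntrans_def fun_eq_iff)
  ultimately show ?thesis by simp
qed

lemma nat_transD:
  assumes "nat_trans C f"
  shows "presheaf C (src f)" "presheaf C (tgt f)"
    and "x \<in> at (src f) \<Gamma> \<Longrightarrow> cpt f \<Gamma> x \<in> at (tgt f) \<Gamma>"
    and "\<lbrakk>\<sigma> \<in> hom C \<Delta> \<Gamma>; x \<in> at (src f) \<Gamma>\<rbrakk> \<Longrightarrow> cpt f \<Delta> (act (src f) \<sigma> x) = act (tgt f) \<sigma> (cpt f \<Gamma> x)"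
proof -
  show S: "presheaf C (src f)" and T: "presheaf C (tgt f)"
    using assms by (simp_all add: nat_trans_def)
  show "x \<in> at (src f) \<Gamma> \<Longrightarrow> cpt f \<Gamma> x \<in> at (tgt f) \<Gamma>"
    using assms at_Obj[OF S, of x \<Gamma>] by (auto simp: nat_trans_def)
  show "\<lbrakk>\<sigma> \<in> hom C \<Delta> \<Gamma>; x \<in> at (src f) \<Gamma>\<rbrakk> \<Longrightarrow> cpt f \<Delta> (act (src f) \<sigma> x) = act (tgt f) \<sigma> (cpt f \<Gamma> x)"
    using assms by (simp add: nat_trans_def)
qed

lemma ncomp_src [simp]: "src (ncomp C f g) = src g" by (simp add: ncomp_def)
lemma ncomp_tgt [simp]: "tgt (ncomp C f g) = tgt f" by (simp add: ncomp_def)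

lemma cpt_ncomp: "\<lbrakk>\<Gamma> \<in> Obj C; x \<in> at (src g) \<Gamma>\<rbrakk> \<Longrightarrow> cpt (ncomp C f g) \<Gamma> x = cpt f \<Gamma> (cpt g \<Gamma> x)"
  by (simp add: ncomp_def cpt_mk)

lemma ncomp_nat: "\<lbrakk>nat_trans C f; nat_trans C g; tgt g = src f\<rbrakk> \<Longrightarrow> nat_trans C (ncomp C f g)"
  unfolding ncomp_def
proof (rule nat_trans_mk, goal_cases)
  case 3 then show ?case using nat_transD(3)[of g] nat_transD(3)[of f] by simp
next
  case (4 \<Delta> \<Gamma> \<sigma> x)
  then show ?case
    using nat_transD(3)[OF 4(2) 4(5)] nat_transD(4)[OF 4(2,4,5)] nat_transD(4)[OF 4(1,4)] by simp
qed (simp_all add: nat_transD)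

lemma idn_nat: "presheaf C P \<Longrightarrow> nat_trans C (mk_ntrans C P P (\<lambda>_ x. x))"
  by (rule nat_trans_mk) auto

lemma ptm_eqI:
  assumes "a = mk_ptm C P a" "b = mk_ptm C P b" "\<And>\<Gamma> x. \<lbrakk>\<Gamma> \<in> Obj C; x \<in> at P \<Gamma>\<rbrakk> \<Longrightarrow> a \<Gamma> x = b \<Gamma> x"
  shows "a = b"
proof -
  have "mk_ptm C P a = mk_ptm C P b" using assms(3) by (auto simp: mk_ptm_def fun_eq_iff)
  then show ?thesis using assms(1,2) by simp
qed

lemma mk_ptm_idem [simp]: "mk_ptm C P (mk_ptm C P a) = mk_ptm C P a"
  by (auto simp: mk_ptm_def fun_eq_iff)

lemma mk_ptm_app: "\<lbrakk>\<Gamma> \<in> Obj C; x \<in> at P \<Gamma>\<rbrakk> \<Longrightarrow> mk_ptm C P a \<Gamma> x = a \<Gamma> x"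
  by (simp add: mk_ptm_def)

lemma ptms_mk:
  assumes P: "presheaf C P"
    and "\<And>\<Gamma> x. \<lbrakk>\<Gamma> \<in> Obj C; x \<in> at P \<Gamma>\<rbrakk> \<Longrightarrow> a \<Gamma> x \<in> at A (\<Gamma>, x)"
    and "\<And>\<Delta> \<Gamma> \<sigma> x. \<lbrakk>\<sigma> \<in> hom C \<Delta> \<Gamma>; x \<in> at P \<Gamma>\<rbrakk> \<Longrightarrow> act A (\<sigma>, x) (a \<Gamma> x) = a \<Delta> (act P \<sigma> x)"
  shows "mk_ptm C P a \<in> ptms C P A"
proof -
  have "act A (\<sigma>, x) (mk_ptm C P a \<Gamma> x) = mk_ptm C P a \<Delta> (act P \<sigma> x)"
    if "\<sigma> \<in> hom C \<Delta> \<Gamma>" "x \<in> at P \<Gamma>" for \<Delta> \<Gamma> \<sigma> x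
    using homD[OF that(1)] act_at[OF P that] assms(3)[OF that] that(2) by (simp add: mk_ptm_app)
  then show ?thesis using assms(2) by (simp add: ptms_def mk_ptm_app)
qed

lemma ptmsD:
  assumes "presheaf C P" "a \<in> ptms C P A"
  shows "a = mk_ptm C P a" "x \<in> at P \<Gamma> \<Longrightarrow> a \<Gamma> x \<in> at A (\<Gamma>, x)"
    and "\<lbrakk>\<sigma> \<in> hom C \<Delta> \<Gamma>; x \<in> at P \<Gamma>\<rbrakk> \<Longrightarrow> act A (\<sigma>, x) (a \<Gamma> x) = a \<Delta> (act P \<sigma> x)"
proof -
  show "a = mk_ptm C P a" using assms by (simp add: ptms_def)
  show "x \<in> at P \<Gamma> \<Longrightarrow> a \<Gamma> x \<in> at A (\<Gamma>, x)"
    using assms at_Obj[OF assms(1), of x \<Gamma>] by (auto simp: ptms_def)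
  show "\<lbrakk>\<sigma> \<in> hom C \<Delta> \<Gamma>; x \<in> at P \<Gamma>\<rbrakk> \<Longrightarrow> act A (\<sigma>, x) (a \<Gamma> x) = a \<Delta> (act P \<sigma> x)"
    using assms(2) by (simp add: ptms_def)
qed

lemma pty_sub_at: "at (pty_sub C A f) (\<Gamma>, x) = (if \<Gamma> \<in> Obj C \<and> x \<in> at (src f) \<Gamma> then at A (\<Gamma>, cpt f \<Gamma> x) else {})"
  by (simp add: pty_sub_def pty_at)

lemma pty_sub_act: "\<lbrakk>\<sigma> \<in> hom C \<Delta> \<Gamma>; x \<in> at (src f) \<Gamma>; a \<in> at A (\<Gamma>, cpt f \<Gamma> x)\<rbrakk>
   \<Longrightarrow> act (pty_sub C A f) (\<sigma>, x) a = act A (\<sigma>, cpt f \<Gamma> x) a"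
  unfolding pty_sub_def using homD[of \<sigma> \<Delta> \<Gamma>] by (subst pty_act) auto

lemma pty_sub_psh:
  assumes f: "nat_trans C f" and A: "presheaf (elements C (tgt f)) A"
  shows "presheaf (elements C (src f)) (pty_sub C A f)"
  unfolding pty_sub_def
proof (rule pty_mk, goal_cases)
  case 1 then show ?case using f nat_transD by blast
next
  case (2 \<Delta> \<Gamma> \<sigma> x a)
  then show ?case using homD[OF 2(1)] pty_act_at[OF nat_transD(2)[OF f] A 2(1) nat_transD(3)[OF f 2(2)]]
    by (simp add: nat_transD(4)[OF f 2(1,2)])
next
  case (3 \<Gamma> x a)
  then show ?case using homD[OF idn_hom[OF 3(1)]] pty_act_idn[OF nat_transD(2)[OF f] A] by simp
next
  case (4 \<Theta> \<Delta> \<Gamma> \<sigma> \<tau> x a)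
  then show ?case using homD[OF 4(1)] homD[OF 4(2)] homD[OF cmp_hom[OF 4(1,2)]]
      pty_act_cmp[OF nat_transD(2)[OF f] A 4(1,2) nat_transD(3)[OF f 4(3)]]
    by (simp add: nat_transD(4)[OF f 4(1,3)])
qed

lemma ptm_sub_ptms:
  assumes f: "nat_trans C f" and A: "presheaf (elements C (tgt f)) A" and a: "a \<in> ptms C (tgt f) A"
  shows "ptm_sub C a f \<in> ptms C (src f) (pty_sub C A f)"
  unfolding ptm_sub_def
proof (rule ptms_mk, goal_cases)
  case 1 then show ?case using f nat_transD by blast
next
  case (2 \<Gamma> x)
  then show ?case using ptmsD(2)[OF nat_transD(2)[OF f] a nat_transD(3)[OF f]] by (simp add: pty_sub_at)
next
  case (3 \<Delta> \<Gamma> \<sigma> x)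
  have k: "cpt f \<Gamma> x \<in> at (tgt f) \<Gamma>" using nat_transD(3)[OF f 3(2)] .
  show ?case
    using ptmsD(2,3)[OF nat_transD(2)[OF f] a] k 3
    by (simp add: pty_sub_act nat_transD(4)[OF f 3])
qed

end

locale psh_model = set_universe U + cwf C
  for U :: "('o, 'm, 'u) universe" and C :: "('o, 'm, 'u, 'u, 'z) cwf_psi_scheme" (structure)
begin

abbreviation "\<D> \<equiv> psh_tlcwf U C"

lemma D_simps [simp]:
  "Obj \<D> = {P. presheaf C P}" "Arr \<D> = {\<phi>. nat_trans C \<phi>}" "Dom \<D> = src" "Cod \<D> = tgt"
  "idn \<D> P = mk_ntrans C P P (\<lambda>_ x. x)" "cmp \<D> = ncomp C" "One \<D> = pterminal U C"
  "Ty \<D> P = {A. presheaf (elements C P) A}" "tysub \<D> = pty_sub C" "Tm \<D> = ptms C"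
  "tmsub \<D> A = ptm_sub C" "cext \<D> = pext U C"
  "pp \<D> P A = mk_ntrans C (pext U C P A) P (\<lambda>_ z. ufst U z)"
  "qq \<D> P A = mk_ptm C (pext U C P A) (\<lambda>_ z. usnd U z)"
  "PiE \<D> = pPi U C" "TyF \<D> P = {A. nat_trans C A \<and> src A = P \<and> tgt A = ty_psh C}"
  "tysubF \<D> = ncomp C" "conv \<D> = fty_conv C"
  by (auto simp: psh_tlcwf_def)

lemma D_hom: "f \<in> hom \<D> P Q \<longleftrightarrow> nat_trans C f \<and> src f = P \<and> tgt f = Q"
  by (auto simp: hom_def)

lemma pext_at: "at (pext U C P A) \<Gamma> = (if \<Gamma> \<in> Obj C then {upair U x a | x a. x \<in> at P \<Gamma> \<and> a \<in> at A (\<Gamma>, x)} else {})"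
  by (simp add: pext_def at_mk_psh)

lemma pext_act: "\<lbrakk>\<sigma> \<in> hom C \<Delta> \<Gamma>; x \<in> at P \<Gamma>; a \<in> at A (\<Gamma>, x)\<rbrakk>
   \<Longrightarrow> act (pext U C P A) \<sigma> (upair U x a) = upair U (act P \<sigma> x) (act A (\<sigma>, x) a)"
  unfolding pext_def by (subst act_mk_psh) auto

lemma pext_psh:
  assumes P: "presheaf C P" and A: "presheaf (elements C P) A"
  shows "presheaf C (pext U C P A)"
  unfolding pext_def
proof (rule presheaf_mk, goal_cases)
  case (1 \<Delta> \<Gamma> \<sigma> z)
  then show ?case using act_at[OF P] pty_act_at[OF P A] by fastforce
next
  case (2 \<Gamma> z)
  then show ?case using act_idn[OF P] pty_act_idn[OF P A] by fastforce
next
  case (3 \<Theta> \<Delta> \<Gamma> \<sigma> \<tau> z)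
  then show ?case using act_cmp[OF P 3(1,2)] pty_act_cmp[OF P A 3(1,2)] by fastforce
qed

lemma pterminal_psh: "presheaf C (pterminal U C)"
  unfolding pterminal_def by (rule presheaf_mk) auto

lemma pp_nat:
  assumes P: "presheaf C P" and A: "presheaf (elements C P) A"
  shows "nat_trans C (mk_ntrans C (pext U C P A) P (\<lambda>_ z. ufst U z))"
proof (rule nat_trans_mk[OF pext_psh[OF P A] P], goal_cases)
  case (1 \<Gamma> z) then show ?case by (auto simp: pext_at)
next
  case (2 \<Delta> \<Gamma> \<sigma> z) then show ?case using homD[OF 2(1)] by (auto simp: pext_at pext_act)
qed

lemma ty_psh_at: "at (ty_psh C) \<Gamma> = (if \<Gamma> \<in> Obj C then Ty C \<Gamma> else {})"
  by (simp add: ty_psh_def at_mk_psh)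

lemma ty_psh_act: "\<lbrakk>\<sigma> \<in> hom C \<Delta> \<Gamma>; X \<in> Ty C \<Gamma>\<rbrakk> \<Longrightarrow> act (ty_psh C) \<sigma> X = X \<cdot> \<sigma>"
  by (simp add: ty_psh_def act_mk_psh)

lemma ty_psh_psh: "presheaf C (ty_psh C)"
  unfolding ty_psh_def by (rule presheaf_mk) (auto simp: tysub_Ty tysub_idn tysub_cmp)

lemma ftyD:
  assumes "nat_trans C A" "tgt A = ty_psh C"
  shows "x \<in> at (src A) \<Gamma> \<Longrightarrow> cpt A \<Gamma> x \<in> Ty C \<Gamma>"
    and "\<lbrakk>\<sigma> \<in> hom C \<Delta> \<Gamma>; x \<in> at (src A) \<Gamma>\<rbrakk> \<Longrightarrow> cpt A \<Delta> (act (src A) \<sigma> x) = cpt A \<Gamma> x \<cdot> \<sigma>"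
proof -
  show 1: "x \<in> at (src A) \<Gamma> \<Longrightarrow> cpt A \<Gamma> x \<in> Ty C \<Gamma>" for x \<Gamma>
    using nat_transD(3)[OF assms(1), of x \<Gamma>] assms(2) by (simp add: ty_psh_at split: if_splits)
  show "\<lbrakk>\<sigma> \<in> hom C \<Delta> \<Gamma>; x \<in> at (src A) \<Gamma>\<rbrakk> \<Longrightarrow> cpt A \<Delta> (act (src A) \<sigma> x) = cpt A \<Gamma> x \<cdot> \<sigma>"
    using nat_transD(4)[OF assms(1), of \<sigma> \<Delta> \<Gamma> x] assms(2) by (simp add: ty_psh_act 1)
qed

lemma fty_conv_at: "at (fty_conv C P A) (\<Gamma>, x) = (if \<Gamma> \<in> Obj C \<and> x \<in> at P \<Gamma> then Tm C \<Gamma> (cpt A \<Gamma> x) else {})"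
  by (simp add: fty_conv_def pty_at)

lemma fty_conv_act: "\<lbrakk>\<sigma> \<in> hom C \<Delta> \<Gamma>; x \<in> at P \<Gamma>; a \<in> Tm C \<Gamma> (cpt A \<Gamma> x)\<rbrakk>
  \<Longrightarrow> act (fty_conv C P A) (\<sigma>, x) a = tmsub C (cpt A \<Gamma> x) a \<sigma>"
  unfolding fty_conv_def using homD[of \<sigma> \<Delta> \<Gamma>] by (subst pty_act) auto

lemma fty_conv_psh:
  assumes A: "nat_trans C A" "tgt A = ty_psh C"
  shows "presheaf (elements C (src A)) (fty_conv C (src A) A)"
  unfolding fty_conv_def
proof (rule pty_mk, goal_cases)
  case 1 then show ?case using nat_transD[OF A(1)] by blast
next
  case (2 \<Delta> \<Gamma> \<sigma> x a)
  then show ?case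
    using homD[OF 2(1)] ftyD(2)[OF A 2(1,2)] tmsub_Tm[OF ftyD(1)[OF A 2(2)] _ 2(1), of a] by simp
next
  case (3 \<Gamma> x a)
  then show ?case
    using homD[OF idn_hom[OF 3(1)]] tmsub_idn[OF 3(1) ftyD(1)[OF A 3(2)], of a] by simp
next
  case (4 \<Theta> \<Delta> \<Gamma> \<sigma> \<tau> x a)
  then show ?case using homD[OF 4(1)] homD[OF 4(2)] homD[OF cmp_hom[OF 4(1,2)]]
      tmsub_cmp[OF ftyD(1)[OF A 4(3)] _ 4(1,2), of a] ftyD(2)[OF A 4(1,3)] by simp
qed

lemma pi_families_inj:
  assumes "\<And>\<Delta> x. small U (at A (\<Delta>, x))"
  shows "inj_on (ufam U) (pi_families U C P A B \<Gamma> x)"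
proof -
  let ?X = "\<Union>\<Delta> :: 'o. \<Union>\<sigma> :: 'm. at A (\<Delta>, act P \<sigma> x)"
  have "small U ?X" by (rule small_UN) (rule assms)
  then have "inj_on (ufam U) {f. \<forall>\<Delta> \<sigma> a. a \<notin> ?X \<longrightarrow> f \<Delta> \<sigma> a = undefined}" by (rule ufam_inj)
  moreover have "pi_families U C P A B \<Gamma> x \<subseteq> {f. \<forall>\<Delta> \<sigma> a. a \<notin> ?X \<longrightarrow> f \<Delta> \<sigma> a = undefined}"
  proof (intro subsetI CollectI allI impI)
    fix f \<Delta> \<sigma> a assume f: "f \<in> pi_families U C P A B \<Gamma> x" and a: "a \<notin> ?X"
    then have "\<not> (\<sigma> \<in> hom C \<Delta> \<Gamma> \<and> a \<in> at A (\<Delta>, act P \<sigma> x))" by blast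
    then show "f \<Delta> \<sigma> a = undefined" using f unfolding pi_families_def mem_Collect_eq by meson
  qed
  ultimately show ?thesis by (rule inj_on_subset)
qed

lemma psh_category: "category \<D>"
proof (unfold_locales, goal_cases)
  case (1 \<sigma>) then show ?case by (simp add: nat_transD)
next
  case (2 \<sigma>) then show ?case by (simp add: nat_transD)
next
  case (3 \<Gamma>) then show ?case by (simp add: D_hom idn_nat)
next
  case (4 \<sigma> \<Delta> \<Gamma> \<tau> \<Theta>) then show ?case by (simp add: D_hom ncomp_nat)
next
  case (5 \<sigma> \<Delta> \<Gamma>)
  then have "nat_trans C \<sigma>" "presheaf C \<Delta>" "src \<sigma> = \<Delta>" by (auto simp: D_hom nat_transD)
  then show ?case
    by (simp, intro nat_trans_eqI ncomp_nat idn_nat) (auto simp: cpt_ncomp cpt_mk)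
next
  case (6 \<sigma> \<Delta> \<Gamma>)
  then have s: "nat_trans C \<sigma>" "presheaf C \<Gamma>" "tgt \<sigma> = \<Gamma>" by (auto simp: D_hom nat_transD)
  then show ?case using nat_transD(3)[OF s(1)]
    by (simp, intro nat_trans_eqI ncomp_nat idn_nat) (auto simp: cpt_ncomp cpt_mk)
next
  case (7 \<sigma> \<Delta> \<Gamma> \<tau> \<Theta> \<rho> \<Xi>)
  then have s: "nat_trans C \<sigma>" "nat_trans C \<tau>" "nat_trans C \<rho>" "src \<sigma> = tgt \<tau>" "src \<tau> = tgt \<rho>"
    by (auto simp: D_hom)
  then show ?case using nat_transD(3)[OF s(3)]
    by (simp, intro nat_trans_eqI ncomp_nat) (auto simp: cpt_ncomp)
qed

lemma psh_cwf: "cwf \<D>"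
proof (intro cwf.intro psh_category cwf_axioms.intro, goal_cases)
  case 1 show ?case by (simp add: pterminal_psh)
next
  case (2 P)
  then have P: "presheaf C P" by simp
  show ?case
  proof (rule ex1I[of _ "mk_ntrans C P (pterminal U C) (\<lambda>_ _. unum U 0)"])
    show "mk_ntrans C P (pterminal U C) (\<lambda>_ _. unum U 0) \<in> hom \<D> P (One \<D>)"
      by (simp add: D_hom, rule nat_trans_mk[OF P pterminal_psh])
        (auto simp: pterminal_def at_mk_psh act_mk_psh)
    then have n: "nat_trans C (mk_ntrans C P (pterminal U C) (\<lambda>_ _. unum U 0))" by (simp add: D_hom)
    fix f assume f: "f \<in> hom \<D> P (One \<D>)"
    then have f': "nat_trans C f" "src f = P" "tgt f = pterminal U C" by (auto simp: D_hom)
    show "f = mk_ntrans C P (pterminal U C) (\<lambda>_ _. unum U 0)"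
    proof (rule nat_trans_eqI[OF f'(1) n])
      show "cpt f G x = cpt (mk_ntrans C P (pterminal U C) (\<lambda>_ _. unum U 0)) G x"
        if "G \<in> Obj C" "x \<in> at (src f) G" for G x
        using nat_transD(3)[OF f'(1) that(2)] f'(2,3) that
        by (simp add: cpt_mk pterminal_def at_mk_psh)
    qed (simp_all add: f')
  qed
next
  case (3 A \<Gamma> \<sigma> \<Delta>) then show ?case using pty_sub_psh by (auto simp: D_hom)
next
  case (4 P A)
  then have P: "presheaf C P" and A: "presheaf (elements C P) A" by auto
  have "presheaf (elements C P) (pty_sub C A (mk_ntrans C P P (\<lambda>_ x. x)))"
    using pty_sub_psh[OF idn_nat[OF P]] A by simp
  then show ?case
    by (simp, intro pty_eqI[OF P _ A]) (auto simp: pty_sub_at pty_sub_act cpt_mk at_Obj[OF P])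
next
  case (5 A \<Gamma> \<sigma> \<Delta> \<tau> \<Theta>)
  then have A: "presheaf (elements C (tgt \<sigma>)) A" and s: "nat_trans C \<sigma>" and t: "nat_trans C \<tau>"
    and e: "tgt \<tau> = src \<sigma>" by (auto simp: D_hom)
  have 1: "presheaf (elements C (src \<tau>)) (pty_sub C A (ncomp C \<sigma> \<tau>))"
    using pty_sub_psh[OF ncomp_nat[OF s t e]] A by simp
  have 2: "presheaf (elements C (src \<tau>)) (pty_sub C (pty_sub C A \<sigma>) \<tau>)"
    using pty_sub_psh[OF t] pty_sub_psh[OF s A] e by simp
  show ?case using nat_transD(3)[OF t] e
    by (simp, intro pty_eqI[OF nat_transD(1)[OF t] 1 2])
      (auto simp: pty_sub_at pty_sub_act cpt_ncomp at_Obj[OF nat_transD(1)[OF t]])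
next
  case (6 A \<Gamma> a \<sigma> \<Delta>) then show ?case using ptm_sub_ptms by (auto simp: D_hom)
next
  case (7 P A a)
  then have P: "presheaf C P" and a: "a \<in> ptms C P A" by auto
  have "ptm_sub C a (mk_ntrans C P P (\<lambda>_ x. x)) = a"
    by (rule ptm_eqI[OF _ ptmsD(1)[OF P a]]) (simp_all add: ptm_sub_def mk_ptm_app cpt_mk)
  then show ?case by simp
next
  case (8 A \<Gamma> a \<sigma> \<Delta> \<tau> \<Theta>)
  then have t: "nat_trans C \<tau>" and e: "tgt \<tau> = src \<sigma>" by (auto simp: D_hom)
  have "ptm_sub C a (ncomp C \<sigma> \<tau>) = ptm_sub C (ptm_sub C a \<sigma>) \<tau>"
  proof (rule ptm_eqI[of _ "src \<tau>"])
    show "ptm_sub C a (ncomp C \<sigma> \<tau>) G x = ptm_sub C (ptm_sub C a \<sigma>) \<tau> G x"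
      if "G \<in> Obj C" "x \<in> at (src \<tau>) G" for G x
      using that nat_transD(3)[OF t that(2)] e by (simp add: ptm_sub_def mk_ptm_app cpt_ncomp)
  qed (simp_all add: ptm_sub_def)
  then show ?case by simp
next
  case (9 P A) then show ?case using pext_psh by simp
next
  case (10 P A) then show ?case using pp_nat by (simp add: D_hom)
next
  case (11 P A)
  then have P: "presheaf C P" and A: "presheaf (elements C P) A" by auto
  let ?E = "pext U C P A" and ?p = "mk_ntrans C (pext U C P A) P (\<lambda>_ z. ufst U z)"
  have "mk_ptm C ?E (\<lambda>_ z. usnd U z) \<in> ptms C ?E (pty_sub C A ?p)"
  proof (rule ptms_mk[OF pext_psh[OF P A]], goal_cases)
    case (1 \<Gamma> z) then show ?case by (auto simp: pext_at pty_sub_at cpt_mk)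
  next
    case (2 \<Delta> \<Gamma> \<sigma> z)
    then obtain x a where z: "z = upair U x a" "x \<in> at P \<Gamma>" "a \<in> at A (\<Gamma>, x)"
      by (auto simp: pext_at split: if_splits)
    have k: "cpt ?p \<Gamma> z = x" using homD[OF 2(1)] 2(2) z by (simp add: cpt_mk)
    have "act (pty_sub C A ?p) (\<sigma>, z) a = act A (\<sigma>, x) a"
      using pty_sub_act[OF 2(1), of z ?p a A] 2(2) z k by simp
    then show ?case using z by (simp add: pext_act[OF 2(1)])
  qed
  then show ?case by simp
next
  case (12 A \<Gamma> f \<Delta> a)
  then have f: "nat_trans C f" and A: "presheaf (elements C (tgt f)) A"
    and a: "a \<in> ptms C (src f) (pty_sub C A f)" and e: "\<Gamma> = tgt f" "\<Delta> = src f"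
    by (auto simp: D_hom)
  note S = nat_transD(1)[OF f] and T = nat_transD(2)[OF f]
  note E = pext_psh[OF T A]
  let ?th = "mk_ntrans C (src f) (pext U C (tgt f) A) (\<lambda>\<Gamma> x. upair U (cpt f \<Gamma> x) (a \<Gamma> x))"
  have aA: "a \<Gamma> x \<in> at A (\<Gamma>, cpt f \<Gamma> x)" if "x \<in> at (src f) \<Gamma>" for \<Gamma> x
    using ptmsD(2)[OF S a that] that at_Obj[OF S that] by (simp add: pty_sub_at)
  have th: "nat_trans C ?th"
  proof (rule nat_trans_mk[OF S E], goal_cases)
    case (1 \<Gamma> x) then show ?case using nat_transD(3)[OF f 1(2)] aA[OF 1(2)] by (auto simp: pext_at upair_inj)
  next
    case (2 \<Delta> \<Gamma> \<sigma> x)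
    have "act A (\<sigma>, cpt f \<Gamma> x) (a \<Gamma> x) = a \<Delta> (act (src f) \<sigma> x)"
      using ptmsD(3)[OF S a 2] pty_sub_act[OF 2 aA[OF 2(2)]] by simp
    then show ?case
      by (simp add: pext_act[OF 2(1) nat_transD(3)[OF f 2(2)] aA[OF 2(2)]] nat_transD(4)[OF f 2])
  qed
  show ?case
  proof (rule ex1I[of _ ?th], intro conjI, goal_cases)
    case 1 show ?case using th e by (simp add: D_hom)
  next
    case 2
    have "ncomp C (mk_ntrans C (pext U C (tgt f) A) (tgt f) (\<lambda>_ z. ufst U z)) ?th = f"
    proof (rule nat_trans_eqI[OF ncomp_nat[OF pp_nat[OF T A] th] f])
      show "cpt (ncomp C (mk_ntrans C (pext U C (tgt f) A) (tgt f) (\<lambda>_ z. ufst U z)) ?th) G x = cpt f G x"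
        if "G \<in> Obj C" "x \<in> at (src (ncomp C (mk_ntrans C (pext U C (tgt f) A) (tgt f) (\<lambda>_ z. ufst U z)) ?th)) G"
        for G x
        using that nat_transD(3)[OF th, of x G] by (simp add: cpt_ncomp cpt_mk)
    qed simp_all
    then show ?case by (simp add: e)
  next
    case 3
    have "ptm_sub C (mk_ptm C (pext U C (tgt f) A) (\<lambda>_ z. usnd U z)) ?th = a"
    proof (rule ptm_eqI[OF _ ptmsD(1)[OF S a]])
      show "ptm_sub C (mk_ptm C (pext U C (tgt f) A) (\<lambda>_ z. usnd U z)) ?th G x = a G x"
        if "G \<in> Obj C" "x \<in> at (src f) G" for G x
        using that nat_transD(3)[OF th, of x G] by (simp add: ptm_sub_def mk_ptm_app cpt_mk)
    qed (simp add: ptm_sub_def)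
    then show ?case by (simp add: e)
  next
    case (4 g)
    then have g: "nat_trans C g" "src g = src f" "tgt g = pext U C (tgt f) A"
      and g1: "ncomp C (mk_ntrans C (pext U C (tgt f) A) (tgt f) (\<lambda>_ z. ufst U z)) g = f"
      and g2: "ptm_sub C (mk_ptm C (pext U C (tgt f) A) (\<lambda>_ z. usnd U z)) g = a"
      by (auto simp: e D_hom)
    have "cpt g G x = upair U (cpt f G x) (a G x)" if G: "G \<in> Obj C" "x \<in> at (src f) G" for G x
    proof -
      have k: "cpt g G x \<in> at (pext U C (tgt f) A) G" using nat_transD(3)[OF g(1)] g G by simp
      have "cpt f G x = ufst U (cpt g G x)"
        using G g k by (subst g1[symmetric]) (simp add: cpt_ncomp cpt_mk)
      moreover have "a G x = usnd U (cpt g G x)"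
        using G g k by (subst g2[symmetric]) (simp add: ptm_sub_def mk_ptm_app)
      ultimately show ?thesis using k by (auto simp: pext_at split: if_splits)
    qed
    then show ?case using g by (intro nat_trans_eqI g th) (auto simp: cpt_mk)
  qed
qed

lemma psh_two_level: "two_level_cwf \<D>"
proof (intro two_level_cwf.intro psh_cwf two_level_cwf_axioms.intro, goal_cases)
  case (1 A \<Gamma> \<sigma> \<Delta>) then show ?case by (auto simp: D_hom ncomp_nat)
next
  case (2 \<Gamma> A)
  then show ?case using category.cmp_idn[OF psh_category, of A \<Gamma> "ty_psh C"] by (auto simp: D_hom)
next
  case (3 A \<Gamma> \<sigma> \<Delta> \<tau> \<Theta>)
  then show ?case using category.cmp_assoc[OF psh_category, of A \<Gamma> "ty_psh C" \<sigma> \<Delta> \<tau> \<Theta>] by (auto simp: D_hom)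
next
  case (4 \<Gamma> A) then show ?case using fty_conv_psh by auto
next
  case (5 A \<Gamma> \<sigma> \<Delta>)
  then have A: "nat_trans C A" "tgt A = ty_psh C" and s: "nat_trans C \<sigma>" and e: "src A = tgt \<sigma>" "\<Gamma> = tgt \<sigma>" "\<Delta> = src \<sigma>"
    by (auto simp: D_hom)
  have AS: "nat_trans C (ncomp C A \<sigma>)" using A s e by (simp add: ncomp_nat)
  show ?case unfolding e
  proof (simp, rule pty_eqI[OF nat_transD(1)[OF s]], goal_cases)
    case 1 show ?case using fty_conv_psh[OF AS] A by simp
  next
    case 2 show ?case using pty_sub_psh[OF s] fty_conv_psh[OF A] e by simp
  next
    case (3 \<Gamma> x) then show ?case using nat_transD(3)[OF s] by (simp add: fty_conv_at pty_sub_at cpt_ncomp)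
  next
    case (4 \<Delta> \<Gamma> \<sigma>' x a)
    then have m: "x \<in> at (src \<sigma>) \<Gamma>" "a \<in> Tm C \<Gamma> (cpt A \<Gamma> (cpt \<sigma> \<Gamma> x))" "\<Gamma> \<in> Obj C"
      by (auto simp: fty_conv_at cpt_ncomp split: if_splits)
    then show ?case using 4 nat_transD(3)[OF s]
      by (simp add: fty_conv_act pty_sub_act fty_conv_at cpt_ncomp)
  qed
qed

end

end

theory Submission
  imports Defs
begin

text \<open>
  For a type \<open>Y\<close> over \<open>P.\<nat>\<^sup>e\<close> and \<open>x \<in> P(\<Gamma>)\<close>, the components \<open>Y\<^sub>\<Gamma>(x, n)\<close> form a sequence of types of \<open>\<C>\<close>
  over \<open>\<Gamma>\<close>, and \<open>\<Theta>\<^sup>T\<^sup>y(Y)\<^sub>\<Gamma>(x)\<close> is its exo-nat product.  As \<open>\<nat>\<^sup>e\<close> is constant, an element of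
  \<open>\<Pi>\<^sup>e(\<nat>\<^sup>e, Y)(\<Gamma>, x)\<close> is determined by its values at \<open>id\<^sub>\<Gamma>\<close>, that is by a sequence of terms of the
  components; the bijection \<open>\<phi>\<close> therefore gives the isomorphism.  Contractibility of the components
  passes to the product in \<open>\<C>\<close>: the centre is \<open>\<psi>\<close> of the sequence of centres, and in context
  \<open>\<Gamma>.\<Omega>(Y)\<close> the contractions at the terms \<open>\<phi>(q)\<^sub>n\<close> give paths from the centres to \<open>\<phi>(q)\<^sub>n\<close>, which
  condition (2) on exo-nat products turns into a path from \<open>\<psi>(centres)\<close> to \<open>\<psi>(\<phi>(q)) = q\<close>.  Since \<open>isContr\<close> of
  the presheaf model is computed pointwise, this also gives \<open>\<Theta>\<^sup>T\<^sup>m\<close>.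
\<close>

section \<open>Substitutions into context extensions\<close>

context cwf
begin

lemma sext:
  assumes "A \<in> Ty C \<Gamma>" "\<sigma> \<in> hom C \<Delta> \<Gamma>" "a \<in> Tm C \<Delta> (A \<cdot> \<sigma>)"
  shows sext_hom: "\<langle>\<sigma>; A; a\<rangle> \<in> hom C \<Delta> (cext C \<Gamma> A)"
    and pp_sext: "pp C \<Gamma> A \<odot> \<langle>\<sigma>; A; a\<rangle> = \<sigma>"
    and qq_sext: "tmsub C (A \<cdot> pp C \<Gamma> A) (qq C \<Gamma> A) \<langle>\<sigma>; A; a\<rangle> = a"
  using theI'[OF cext_universal[OF assms]] homD[OF assms(2)] by (auto simp: sext_def)

text \<open>Uniqueness half of the universal property: \<open>pp\<close> and \<open>qq\<close> are
  jointly monic. The equations \<open>sext_cmp\<close> and \<open>sext_pp_qq\<close> are reduced to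
  it.\<close>

lemma cext_eqI:
  assumes A: "A \<in> Ty C \<Gamma>" and h: "\<theta> \<in> hom C \<Delta> (cext C \<Gamma> A)" "\<theta>' \<in> hom C \<Delta> (cext C \<Gamma> A)"
    and G: "\<Gamma> \<in> Obj C"
    and p: "pp C \<Gamma> A \<odot> \<theta> = pp C \<Gamma> A \<odot> \<theta>'"
    and q: "tmsub C (A \<cdot> pp C \<Gamma> A) (qq C \<Gamma> A) \<theta> = tmsub C (A \<cdot> pp C \<Gamma> A) (qq C \<Gamma> A) \<theta>'"
  shows "\<theta> = \<theta>'"
proof -
  note pH = pp_hom[OF G A]
  have "tmsub C (A \<cdot> pp C \<Gamma> A) (qq C \<Gamma> A) \<theta> \<in> Tm C \<Delta> (A \<cdot> (pp C \<Gamma> A \<odot> \<theta>))"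
    using tmsub_Tm[OF tysub_Ty[OF A pH] qq_Tm[OF G A] h(1)] tysub_cmp[OF A pH h(1)] by simp
  from cext_universal[OF A cmp_hom[OF pH h(1)] this] show ?thesis using h p q by metis
qed

lemma sext_cmp:
  assumes A: "A \<in> Ty C \<Gamma>" and s: "\<sigma> \<in> hom C \<Delta> \<Gamma>" and a: "a \<in> Tm C \<Delta> (A \<cdot> \<sigma>)"
    and t: "\<tau> \<in> hom C \<Theta> \<Delta>"
  shows "\<langle>\<sigma>; A; a\<rangle> \<odot> \<tau> = \<langle>\<sigma> \<odot> \<tau>; A; tmsub C (A \<cdot> \<sigma>) a \<tau>\<rangle>"
proof -
  have G: "\<Gamma> \<in> Obj C" using homD[OF s] by simp
  note pH = pp_hom[OF G A] and sH = sext_hom[OF A s a]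
  have a': "tmsub C (A \<cdot> \<sigma>) a \<tau> \<in> Tm C \<Theta> (A \<cdot> (\<sigma> \<odot> \<tau>))"
    using tmsub_Tm[OF tysub_Ty[OF A s] a t] tysub_cmp[OF A s t] by simp
  note st = cmp_hom[OF s t]
  have e: "A \<cdot> pp C \<Gamma> A \<cdot> \<langle>\<sigma>; A; a\<rangle> = A \<cdot> \<sigma>"
    using tysub_cmp[OF A pH sH] pp_sext[OF A s a] by simp
  show ?thesis
  proof (rule cext_eqI[OF A cmp_hom[OF sH t] sext_hom[OF A st a'] G])
    show "pp C \<Gamma> A \<odot> (\<langle>\<sigma>; A; a\<rangle> \<odot> \<tau>) = pp C \<Gamma> A \<odot> \<langle>\<sigma> \<odot> \<tau>; A; tmsub C (A \<cdot> \<sigma>) a \<tau>\<rangle>"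
      using cmp_assoc[OF pH sH t] pp_sext[OF A s a] pp_sext[OF A st a'] by simp
    show "tmsub C (A \<cdot> pp C \<Gamma> A) (qq C \<Gamma> A) (\<langle>\<sigma>; A; a\<rangle> \<odot> \<tau>)
        = tmsub C (A \<cdot> pp C \<Gamma> A) (qq C \<Gamma> A) \<langle>\<sigma> \<odot> \<tau>; A; tmsub C (A \<cdot> \<sigma>) a \<tau>\<rangle>"
      using tmsub_cmp[OF tysub_Ty[OF A pH] qq_Tm[OF G A] sH t] qq_sext[OF A s a] qq_sext[OF A st a'] e
      by simp
  qed
qed

lemma sext_pp_qq:
  assumes G: "\<Gamma> \<in> Obj C" and A: "A \<in> Ty C \<Gamma>"
  shows "\<langle>pp C \<Gamma> A; A; qq C \<Gamma> A\<rangle> = idn C (cext C \<Gamma> A)"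
proof -
  note pH = pp_hom[OF G A] and q = qq_Tm[OF G A] and E = cext_obj[OF G A]
  show ?thesis
    by (rule cext_eqI[OF A sext_hom[OF A pH q] idn_hom[OF E] G])
      (simp_all add: pp_sext[OF A pH q] qq_sext[OF A pH q] cmp_idn[OF pH]
        tmsub_idn[OF E tysub_Ty[OF A pH] q])
qed

lemma lift:
  assumes s: "\<sigma> \<in> hom C \<Delta> \<Gamma>" and A: "A \<in> Ty C \<Gamma>"
  shows lift_hom: "\<sigma> \<up> A \<in> hom C (cext C \<Delta> (A \<cdot> \<sigma>)) (cext C \<Gamma> A)"
    and pp_lift: "pp C \<Gamma> A \<odot> (\<sigma> \<up> A) = \<sigma> \<odot> pp C \<Delta> (A \<cdot> \<sigma>)"
    and qq_lift: "tmsub C (A \<cdot> pp C \<Gamma> A) (qq C \<Gamma> A) (\<sigma> \<up> A) = qq C \<Delta> (A \<cdot> \<sigma>)"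
    and tysub_pp_lift: "A \<cdot> pp C \<Gamma> A \<cdot> (\<sigma> \<up> A) = A \<cdot> \<sigma> \<cdot> pp C \<Delta> (A \<cdot> \<sigma>)"
    and lift_eq: "\<sigma> \<up> A = \<langle>\<sigma> \<odot> pp C \<Delta> (A \<cdot> \<sigma>); A; qq C \<Delta> (A \<cdot> \<sigma>)\<rangle>"
proof -
  have D: "\<Delta> \<in> Obj C" "\<Gamma> \<in> Obj C" using homD[OF s] by simp_all
  note As = tysub_Ty[OF A s]
  note pH = pp_hom[OF D(1) As]
  have q: "qq C \<Delta> (A \<cdot> \<sigma>) \<in> Tm C (cext C \<Delta> (A \<cdot> \<sigma>)) (A \<cdot> (\<sigma> \<odot> pp C \<Delta> (A \<cdot> \<sigma>)))"
    using qq_Tm[OF D(1) As] tysub_cmp[OF A s pH] by simp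
  show e: "\<sigma> \<up> A = \<langle>\<sigma> \<odot> pp C \<Delta> (A \<cdot> \<sigma>); A; qq C \<Delta> (A \<cdot> \<sigma>)\<rangle>"
    using homD[OF s] by (simp add: lift_def)
  note S = sext[OF A cmp_hom[OF s pH] q, folded e]
  show "\<sigma> \<up> A \<in> hom C (cext C \<Delta> (A \<cdot> \<sigma>)) (cext C \<Gamma> A)"
    "pp C \<Gamma> A \<odot> (\<sigma> \<up> A) = \<sigma> \<odot> pp C \<Delta> (A \<cdot> \<sigma>)"
    "tmsub C (A \<cdot> pp C \<Gamma> A) (qq C \<Gamma> A) (\<sigma> \<up> A) = qq C \<Delta> (A \<cdot> \<sigma>)" by (fact S)+
  show "A \<cdot> pp C \<Gamma> A \<cdot> (\<sigma> \<up> A) = A \<cdot> \<sigma> \<cdot> pp C \<Delta> (A \<cdot> \<sigma>)"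
    using tysub_cmp[OF A pp_hom[OF D(2) A] S(1)] S(2) tysub_cmp[OF A s pH] by simp
qed

text \<open>Both sides are pairings once \<open>lift_eq\<close> and \<open>sext_cmp\<close> are
  applied. By this rule a lifted substitution absorbs a pairing, as needed for identity types in
  generic contexts.\<close>

lemma lift_sext:
  assumes s: "\<sigma> \<in> hom C \<Delta> \<Gamma>" and A: "A \<in> Ty C \<Gamma>" and t: "\<tau> \<in> hom C \<Theta> \<Delta>"
    and a: "a \<in> Tm C \<Theta> (A \<cdot> \<sigma> \<cdot> \<tau>)"
  shows "(\<sigma> \<up> A) \<odot> \<langle>\<tau>; A \<cdot> \<sigma>; a\<rangle> = \<langle>\<sigma> \<odot> \<tau>; A; a\<rangle>"
proof -
  have D: "\<Delta> \<in> Obj C" using homD[OF s] by simp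
  note As = tysub_Ty[OF A s]
  note pH = pp_hom[OF D As] and S = sext[OF As t a]
  have q: "qq C \<Delta> (A \<cdot> \<sigma>) \<in> Tm C (cext C \<Delta> (A \<cdot> \<sigma>)) (A \<cdot> (\<sigma> \<odot> pp C \<Delta> (A \<cdot> \<sigma>)))"
    using qq_Tm[OF D As] tysub_cmp[OF A s pH] by simp
  show ?thesis
    unfolding lift_eq[OF s A] sext_cmp[OF A cmp_hom[OF s pH] q S(1)]
    using cmp_assoc[OF s pH S(1)] S(2,3) tysub_cmp[OF A s pH] by simp
qed

lemma sect:
  assumes G: "\<Gamma> \<in> Obj C" and A: "A \<in> Ty C \<Gamma>" and a: "a \<in> Tm C \<Gamma> A"
  shows sect_hom: "sect C \<Gamma> A a \<in> hom C \<Gamma> (cext C \<Gamma> A)"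
    and tysub_pp_sect: "B \<in> Ty C \<Gamma> \<Longrightarrow> B \<cdot> pp C \<Gamma> A \<cdot> sect C \<Gamma> A a = B"
    and sect_cmp: "\<sigma> \<in> hom C \<Delta> \<Gamma> \<Longrightarrow> sect C \<Gamma> A a \<odot> \<sigma> = \<langle>\<sigma>; A; tmsub C A a \<sigma>\<rangle>"
proof -
  have a': "a \<in> Tm C \<Gamma> (A \<cdot> idn C \<Gamma>)" using a tysub_idn[OF G A] by simp
  note S = sext[OF A idn_hom[OF G] a', folded sect_def]
  show h: "sect C \<Gamma> A a \<in> hom C \<Gamma> (cext C \<Gamma> A)" by (fact S)
  have p: "pp C \<Gamma> A \<odot> sect C \<Gamma> A a = idn C \<Gamma>" by (fact S)
  show "B \<cdot> pp C \<Gamma> A \<cdot> sect C \<Gamma> A a = B" if "B \<in> Ty C \<Gamma>"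
    using tysub_cmp[OF that pp_hom[OF G A] h] p tysub_idn[OF G that] by simp
  show "sect C \<Gamma> A a \<odot> \<sigma> = \<langle>\<sigma>; A; tmsub C A a \<sigma>\<rangle>" if "\<sigma> \<in> hom C \<Delta> \<Gamma>"
    using sext_cmp[OF A idn_hom[OF G] a' that] idn_cmp[OF that] tysub_idn[OF G A]
    by (simp add: sect_def)
qed

lemma lift_sect:
  assumes s: "\<sigma> \<in> hom C \<Delta> \<Gamma>" and A: "A \<in> Ty C \<Gamma>" and a: "a \<in> Tm C \<Delta> (A \<cdot> \<sigma>)"
  shows "(\<sigma> \<up> A) \<odot> sect C \<Delta> (A \<cdot> \<sigma>) a = \<langle>\<sigma>; A; a\<rangle>"
proof -
  have D: "\<Delta> \<in> Obj C" using homD[OF s] by simp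
  have "a \<in> Tm C \<Delta> (A \<cdot> \<sigma> \<cdot> idn C \<Delta>)" using a tysub_idn[OF D tysub_Ty[OF A s]] by simp
  then show ?thesis using lift_sext[OF s A idn_hom[OF D]] cmp_idn[OF s] by (simp add: sect_def)
qed

end

section \<open>Identity types at given pairs of terms\<close>

context cwf_Id
begin

text \<open>\<open>Id_sub\<close> speaks only of doubly lifted substitutions. A substitution into
  \<Gamma>.A.A[p] given by two terms factors as the double lift of \<sigma> after the pairing over
  \<Delta> that defines \<open>IdT\<close>, so \<open>Id_sub\<close> determines every
  instance.\<close>

lemma Idt_sext:
  assumes s: "\<sigma> \<in> hom C \<Delta> \<Gamma>" and A: "A \<in> Ty C \<Gamma>"
    and a: "a \<in> Tm C \<Delta> (A \<cdot> \<sigma>)" and b: "b \<in> Tm C \<Delta> (A \<cdot> \<sigma>)"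
  shows "\<langle>\<langle>\<sigma>; A; a\<rangle>; A \<cdot> pp C \<Gamma> A; b\<rangle> \<in> hom C \<Delta> (cext2 C \<Gamma> A)"
    and "Idt C \<Gamma> A \<cdot> \<langle>\<langle>\<sigma>; A; a\<rangle>; A \<cdot> pp C \<Gamma> A; b\<rangle> = IdT C \<Delta> (A \<cdot> \<sigma>) a b"
proof -
  have D: "\<Delta> \<in> Obj C" "\<Gamma> \<in> Obj C" using homD[OF s] by simp_all
  note As = tysub_Ty[OF A s] and pH = pp_hom[OF D(2) A] and S = sext[OF A s a]
  note Ap = tysub_Ty[OF A pH] and L = lift[OF s A]
  note pH' = pp_hom[OF D(1) As]
  have b': "b \<in> Tm C \<Delta> (A \<cdot> pp C \<Gamma> A \<cdot> \<langle>\<sigma>; A; a\<rangle>)"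
    using b tysub_cmp[OF A pH S(1)] S(2) by simp
  note h = sext_hom[OF Ap S(1) b']
  show "\<langle>\<langle>\<sigma>; A; a\<rangle>; A \<cdot> pp C \<Gamma> A; b\<rangle> \<in> hom C \<Delta> (cext2 C \<Gamma> A)" using h by (simp add: cext2_def)
  note sH = sect_hom[OF D(1) As a]
  have b2: "b \<in> Tm C \<Delta> (A \<cdot> pp C \<Gamma> A \<cdot> (\<sigma> \<up> A) \<cdot> sect C \<Delta> (A \<cdot> \<sigma>) a)"
    using b tysub_pp_sect[OF D(1) As a As] L(4) by simp
  have 1: "(\<sigma> \<up> A \<up> (A \<cdot> pp C \<Gamma> A)) \<odot> \<langle>sect C \<Delta> (A \<cdot> \<sigma>) a; A \<cdot> \<sigma> \<cdot> pp C \<Delta> (A \<cdot> \<sigma>); b\<rangle>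
    = \<langle>\<langle>\<sigma>; A; a\<rangle>; A \<cdot> pp C \<Gamma> A; b\<rangle>"
    using lift_sext[OF L(1) Ap sH b2] lift_sect[OF s A a] L(4) by simp
  have 2: "\<langle>sect C \<Delta> (A \<cdot> \<sigma>) a; A \<cdot> \<sigma> \<cdot> pp C \<Delta> (A \<cdot> \<sigma>); b\<rangle>
      \<in> hom C \<Delta> (cext C (cext C \<Delta> (A \<cdot> \<sigma>)) (A \<cdot> \<sigma> \<cdot> pp C \<Delta> (A \<cdot> \<sigma>)))"
    using sext_hom[OF tysub_Ty[OF As pH'] sH] b2 L(4) by simp
  have 3: "\<sigma> \<up> A \<up> (A \<cdot> pp C \<Gamma> A)
     \<in> hom C (cext C (cext C \<Delta> (A \<cdot> \<sigma>)) (A \<cdot> \<sigma> \<cdot> pp C \<Delta> (A \<cdot> \<sigma>))) (cext2 C \<Gamma> A)"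
    using lift_hom[OF L(1) Ap] L(4) by (simp add: cext2_def)
  show "Idt C \<Gamma> A \<cdot> \<langle>\<langle>\<sigma>; A; a\<rangle>; A \<cdot> pp C \<Gamma> A; b\<rangle> = IdT C \<Delta> (A \<cdot> \<sigma>) a b"
    using tysub_cmp[OF Id_Ty[OF D(2) A] 3 2] 1 Id_sub[OF s A] by (simp add: IdT_def)
qed

lemma IdT_Ty:
  assumes G: "\<Gamma> \<in> Obj C" and A: "A \<in> Ty C \<Gamma>" and a: "a \<in> Tm C \<Gamma> A" and b: "b \<in> Tm C \<Gamma> A"
  shows "IdT C \<Gamma> A a b \<in> Ty C \<Gamma>"
  using tysub_Ty[OF Id_Ty[OF G A] Idt_sext(1)[OF idn_hom[OF G] A]]
    Idt_sext(2)[OF idn_hom[OF G] A] a b by (simp add: tysub_idn[OF G A])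

text \<open>The substitution hidden in \<open>IdT\<close>, composed with \<sigma>, is again a
  pairing of two terms, to which \<open>Idt_sext\<close> applies.\<close>

lemma IdT_sub:
  assumes s: "\<sigma> \<in> hom C \<Delta> \<Gamma>" and A: "A \<in> Ty C \<Gamma>" and a: "a \<in> Tm C \<Gamma> A" and b: "b \<in> Tm C \<Gamma> A"
  shows "IdT C \<Gamma> A a b \<cdot> \<sigma> = IdT C \<Delta> (A \<cdot> \<sigma>) (tmsub C A a \<sigma>) (tmsub C A b \<sigma>)"
proof -
  have G: "\<Gamma> \<in> Obj C" using homD[OF s] by simp
  note pH = pp_hom[OF G A] and S = sect_hom[OF G A a]
  have a': "a \<in> Tm C \<Gamma> (A \<cdot> idn C \<Gamma>)" and b': "b \<in> Tm C \<Gamma> (A \<cdot> idn C \<Gamma>)"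
    using a b tysub_idn[OF G A] by simp_all
  note h = Idt_sext(1)[OF idn_hom[OF G] A a' b', folded sect_def]
  have b2: "b \<in> Tm C \<Gamma> (A \<cdot> pp C \<Gamma> A \<cdot> sect C \<Gamma> A a)" using b tysub_pp_sect[OF G A a A] by simp
  have "\<langle>sect C \<Gamma> A a; A \<cdot> pp C \<Gamma> A; b\<rangle> \<odot> \<sigma> = \<langle>\<langle>\<sigma>; A; tmsub C A a \<sigma>\<rangle>; A \<cdot> pp C \<Gamma> A; tmsub C A b \<sigma>\<rangle>"
    using sext_cmp[OF tysub_Ty[OF A pH] S b2 s] sect_cmp[OF G A a s] tysub_pp_sect[OF G A a A] by simp
  then show ?thesis
    using tysub_cmp[OF Id_Ty[OF G A] h s] Idt_sext(2)[OF s A tmsub_Tm[OF A a s] tmsub_Tm[OF A b s]]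
    by (simp add: IdT_def)
qed

end

section \<open>Contractible types\<close>

text \<open>The second component of \<open>isContr\<close>: over \<Gamma>.A, the assertion that the
  variable is a centre of contraction.\<close>

definition contr_body :: "('o, 'm, 't, 'a, 'z) cwf_psi_scheme \<Rightarrow> 'o \<Rightarrow> 't \<Rightarrow> 't" where
  "contr_body C \<Gamma> A = Pi C (cext C \<Gamma> A) (A \<cdot>\<^bsub>C\<^esub> pp C \<Gamma> A) (Idt C \<Gamma> A)"

text \<open>A type over \<Gamma>.A: paths from the weakened centre \<open>c\<close> to the variable.
  At the centre \<open>c\<close>, \<open>contr_body\<close> becomes the product of this family
  (\<open>contr_body_sect\<close>).\<close>

definition path_ty :: "('o, 'm, 't, 'a, 'z) cwf_psi_scheme \<Rightarrow> 'o \<Rightarrow> 't \<Rightarrow> 'a \<Rightarrow> 't" where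
  "path_ty C \<Gamma> A c =
     IdT C (cext C \<Gamma> A) (A \<cdot>\<^bsub>C\<^esub> pp C \<Gamma> A) (tmsub C A c (pp C \<Gamma> A)) (qq C \<Gamma> A)"

definition centre :: "('o, 'm, 't, 'a, 'z) cwf_tt_scheme \<Rightarrow> 'o \<Rightarrow> 't \<Rightarrow> 'a \<Rightarrow> 'a" where
  "centre C \<Gamma> A t = pfst C \<Gamma> A (contr_body C \<Gamma> A) t"

text \<open>The second component of a proof of contractibility is a dependent function. Applied to
  the variable it becomes a path over \<Gamma>.A, which can be pulled back along substitutions into
  \<Gamma>.A.\<close>

definition contraction :: "('o, 'm, 't, 'a, 'z) cwf_tt_scheme \<Rightarrow> 'o \<Rightarrow> 't \<Rightarrow> 'a \<Rightarrow> 'a" where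
  "contraction C \<Gamma> A t =
     app C \<Gamma> A (path_ty C \<Gamma> A (centre C \<Gamma> A t)) (psnd C \<Gamma> A (contr_body C \<Gamma> A) t)"

definition mk_contr :: "('o, 'm, 't, 'a, 'z) cwf_tt_scheme \<Rightarrow> 'o \<Rightarrow> 't \<Rightarrow> 'a \<Rightarrow> 'a \<Rightarrow> 'a" where
  "mk_contr C \<Gamma> A c h = mkpair C \<Gamma> A (contr_body C \<Gamma> A) c (lam C \<Gamma> A (path_ty C \<Gamma> A c) h)"

lemma isContr_contr_body: "isContr C \<Gamma> A = Sig C \<Gamma> A (contr_body C \<Gamma> A)"
  by (simp add: isContr_def contr_body_def)

section \<open>Paths from a fixed centre to a variable endpoint\<close>

context cwf_Id
begin

lemma path_ty_Ty:
  assumes G: "\<Gamma> \<in> Obj C" and A: "A \<in> Ty C \<Gamma>" and c: "c \<in> Tm C \<Gamma> A"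
  shows "path_ty C \<Gamma> A c \<in> Ty C (cext C \<Gamma> A)"
  unfolding path_ty_def
  using IdT_Ty[OF cext_obj[OF G A] tysub_Ty[OF A] tmsub_Tm[OF A c] qq_Tm[OF G A]] pp_hom[OF G A] by blast

text \<open>Substituting a term for the variable fixes the free endpoint. In this form a contraction
  yields a path between two given terms.\<close>

lemma path_ty_sext:
  assumes A: "A \<in> Ty C \<Gamma>" and c: "c \<in> Tm C \<Gamma> A"
    and s: "\<sigma> \<in> hom C \<Delta> \<Gamma>" and b: "b \<in> Tm C \<Delta> (A \<cdot> \<sigma>)"
  shows "path_ty C \<Gamma> A c \<cdot> \<langle>\<sigma>; A; b\<rangle> = IdT C \<Delta> (A \<cdot> \<sigma>) (tmsub C A c \<sigma>) b"
proof -
  have G: "\<Gamma> \<in> Obj C" using homD[OF s] by simp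
  note pH = pp_hom[OF G A] and S = sext[OF A s b]
  show ?thesis unfolding path_ty_def
    using IdT_sub[OF S(1) tysub_Ty[OF A pH] tmsub_Tm[OF A c pH] qq_Tm[OF G A]]
      tmsub_cmp[OF A c pH S(1)] tysub_cmp[OF A pH S(1)] S(2,3) by simp
qed

lemma path_ty_sub:
  assumes s: "\<sigma> \<in> hom C \<Delta> \<Gamma>" and A: "A \<in> Ty C \<Gamma>" and c: "c \<in> Tm C \<Gamma> A"
  shows "path_ty C \<Gamma> A c \<cdot> (\<sigma> \<up> A) = path_ty C \<Delta> (A \<cdot> \<sigma>) (tmsub C A c \<sigma>)"
proof -
  have D: "\<Delta> \<in> Obj C" "\<Gamma> \<in> Obj C" using homD[OF s] by simp_all
  note As = tysub_Ty[OF A s]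
  note pH = pp_hom[OF D(2) A] and pH' = pp_hom[OF D(1) As] and L = lift[OF s A]
  show ?thesis unfolding path_ty_def
    using IdT_sub[OF L(1) tysub_Ty[OF A pH] tmsub_Tm[OF A c pH] qq_Tm[OF D(2) A]]
      tmsub_cmp[OF A c pH L(1)] tmsub_cmp[OF A c s pH'] L(2-4) by simp
qed

text \<open>The identity type in its generic context is its own instance at the two variables,
  because pairing the generic projections gives the identity substitution. It links
  \<open>isContr\<close>, written with \<open>Idt\<close>, to the presheaf model, whose identity
  type is written with \<open>IdT\<close>.\<close>

lemma Idt_eq_path_ty:
  assumes G: "\<Gamma> \<in> Obj C" and A: "A \<in> Ty C \<Gamma>"
  shows "Idt C \<Gamma> A = path_ty C (cext C \<Gamma> A) (A \<cdot> pp C \<Gamma> A) (qq C \<Gamma> A)"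
proof -
  let ?p = "pp C \<Gamma> A" and ?q = "qq C \<Gamma> A"
  let ?p' = "pp C (cext C \<Gamma> A) (A \<cdot> ?p)" and ?q' = "qq C (cext C \<Gamma> A) (A \<cdot> ?p)"
  note pH = pp_hom[OF G A] and E = cext_obj[OF G A] and q = qq_Tm[OF G A]
  note Ap = tysub_Ty[OF A pH]
  note pH' = pp_hom[OF E Ap]
  \<comment> \<open>The pairing of \<open>?p\<close> and \<open>?q\<close> is the identity, so
    composing it with \<open>?p'\<close> gives \<open>?p'\<close> back.\<close>
  have e: "\<langle>?p \<odot> ?p'; A; tmsub C (A \<cdot> ?p) ?q ?p'\<rangle> = ?p'"
    using sext_cmp[OF A pH q pH'] sext_pp_qq[OF G A] idn_cmp[OF pH'] by simp
  have a: "tmsub C (A \<cdot> ?p) ?q ?p' \<in> Tm C (cext2 C \<Gamma> A) (A \<cdot> (?p \<odot> ?p'))"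
    and b: "?q' \<in> Tm C (cext2 C \<Gamma> A) (A \<cdot> (?p \<odot> ?p'))"
    using tmsub_Tm[OF Ap q pH'] qq_Tm[OF E Ap] tysub_cmp[OF A pH pH'] by (simp_all add: cext2_def)
  have "Idt C \<Gamma> A \<cdot> \<langle>?p'; A \<cdot> ?p; ?q'\<rangle> = path_ty C (cext C \<Gamma> A) (A \<cdot> ?p) ?q"
    using Idt_sext(2)[OF _ A a b] cmp_hom[OF pH pH'] tysub_cmp[OF A pH pH'] e
    by (simp add: cext2_def path_ty_def)
  then show ?thesis
    using sext_pp_qq[OF E Ap] tysub_idn[OF _ Id_Ty[OF G A]] cext_obj[OF E Ap] by (simp add: cext2_def)
qed

end

section \<open>Splitting contractibility into a centre and a path, stably under substitution\<close>

locale cwf_Pi_Sigma_Id = cwf_Pi C + cwf_Sigma C + cwf_Id C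
  for C :: "('o, 'm, 't, 'a, 'z) cwf_tt_scheme" (structure)
begin

lemma contr_body_Ty: "\<lbrakk>\<Gamma> \<in> Obj C; A \<in> Ty C \<Gamma>\<rbrakk> \<Longrightarrow> contr_body C \<Gamma> A \<in> Ty C (cext C \<Gamma> A)"
  unfolding contr_body_def
  by (rule Pi_Ty) (auto simp: cext_obj cext2_def[symmetric] Id_Ty intro: tysub_Ty pp_hom)

lemma contr_body_sub:
  assumes s: "\<sigma> \<in> hom C \<Delta> \<Gamma>" and A: "A \<in> Ty C \<Gamma>"
  shows "contr_body C \<Gamma> A \<cdot> (\<sigma> \<up> A) = contr_body C \<Delta> (A \<cdot> \<sigma>)"
proof -
  have G: "\<Gamma> \<in> Obj C" using homD[OF s] by simp
  show ?thesis unfolding contr_body_def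
    using Pi_sub[OF lift_hom[OF s A] tysub_Ty[OF A pp_hom[OF G A]]] Id_Ty[OF G A]
      Id_sub[OF s A] tysub_pp_lift[OF s A] by (simp add: cext2_def)
qed

text \<open>Lifting the section at \<open>c\<close> yields the pairing of the weakened centre with
  the variable, so \<open>Idt\<close> turns into \<open>path_ty\<close> under the product. This
  identifies the type of the second component of a proof of contractibility.\<close>

lemma contr_body_sect:
  assumes G: "\<Gamma> \<in> Obj C" and A: "A \<in> Ty C \<Gamma>" and c: "c \<in> Tm C \<Gamma> A"
  shows "contr_body C \<Gamma> A \<cdot> sect C \<Gamma> A c = Pi C \<Gamma> A (path_ty C \<Gamma> A c)"
proof -
  note pH = pp_hom[OF G A] and S = sect_hom[OF G A c]
  note Ap = tysub_Ty[OF A pH] and e = tysub_pp_sect[OF G A c A]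
  have "sect C \<Gamma> A c \<up> (A \<cdot> pp C \<Gamma> A)
      = \<langle>\<langle>pp C \<Gamma> A; A; tmsub C A c (pp C \<Gamma> A)\<rangle>; A \<cdot> pp C \<Gamma> A; qq C \<Gamma> A\<rangle>"
    using lift_eq[OF S Ap] sect_cmp[OF G A c pH] e by simp
  then have "Idt C \<Gamma> A \<cdot> (sect C \<Gamma> A c \<up> (A \<cdot> pp C \<Gamma> A)) = path_ty C \<Gamma> A c"
    using Idt_sext(2)[OF pH A tmsub_Tm[OF A c pH] qq_Tm[OF G A]] by (simp add: path_ty_def)
  then show ?thesis unfolding contr_body_def
    using Pi_sub[OF S Ap] Id_Ty[OF G A] e by (simp add: cext2_def)
qed

lemma centre_Tm: "\<lbrakk>\<Gamma> \<in> Obj C; A \<in> Ty C \<Gamma>; t \<in> Tm C \<Gamma> (isContr C \<Gamma> A)\<rbrakk> \<Longrightarrow> centre C \<Gamma> A t \<in> Tm C \<Gamma> A"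
  by (simp add: centre_def pfst_Tm contr_body_Ty isContr_contr_body)

lemma centre_sub:
  "\<lbrakk>\<sigma> \<in> hom C \<Delta> \<Gamma>; A \<in> Ty C \<Gamma>; t \<in> Tm C \<Gamma> (isContr C \<Gamma> A)\<rbrakk>
    \<Longrightarrow> tmsub C A (centre C \<Gamma> A t) \<sigma> = centre C \<Delta> (A \<cdot> \<sigma>) (tmsub C (isContr C \<Gamma> A) t \<sigma>)"
  using homD[of \<sigma> \<Delta> \<Gamma>]
  by (simp add: centre_def pfst_sub contr_body_Ty isContr_contr_body contr_body_sub)

lemma contraction_Tm:
  assumes G: "\<Gamma> \<in> Obj C" and A: "A \<in> Ty C \<Gamma>" and t: "t \<in> Tm C \<Gamma> (isContr C \<Gamma> A)"
  shows "contraction C \<Gamma> A t \<in> Tm C (cext C \<Gamma> A) (path_ty C \<Gamma> A (centre C \<Gamma> A t))"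
  unfolding contraction_def
  by (rule app_Tm[OF G A path_ty_Ty[OF G A centre_Tm[OF G A t]]])
    (use psnd_Tm[OF G A contr_body_Ty[OF G A] t[unfolded isContr_contr_body]]
      contr_body_sect[OF G A centre_Tm[OF G A t]] in \<open>simp add: centre_def\<close>)

text \<open>Stability of \<open>psnd\<close> and of \<open>app\<close> combine; the types match by
  \<open>contr_body_sect\<close>, \<open>contr_body_sub\<close> and
  \<open>path_ty_sub\<close>.\<close>

lemma contraction_sub:
  assumes s: "\<sigma> \<in> hom C \<Delta> \<Gamma>" and A: "A \<in> Ty C \<Gamma>" and t: "t \<in> Tm C \<Gamma> (isContr C \<Gamma> A)"
  shows "tmsub C (path_ty C \<Gamma> A (centre C \<Gamma> A t)) (contraction C \<Gamma> A t) (\<sigma> \<up> A)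
    = contraction C \<Delta> (A \<cdot> \<sigma>) (tmsub C (isContr C \<Gamma> A) t \<sigma>)"
proof -
  have G: "\<Gamma> \<in> Obj C" using homD[OF s] by simp
  note c = centre_Tm[OF G A t] and B = contr_body_Ty[OF G A]
  have t': "t \<in> Tm C \<Gamma> (Sig C \<Gamma> A (contr_body C \<Gamma> A))" using t by (simp add: isContr_contr_body)
  note e = contr_body_sect[OF G A c]
  have "psnd C \<Gamma> A (contr_body C \<Gamma> A) t \<in> Tm C \<Gamma> (Pi C \<Gamma> A (path_ty C \<Gamma> A (centre C \<Gamma> A t)))"
    using psnd_Tm[OF G A B t'] e by (simp add: centre_def)
  from app_sub[OF s A path_ty_Ty[OF G A c] this] show ?thesis
    using psnd_sub[OF s A B t'] e path_ty_sub[OF s A c] centre_sub[OF s A t] contr_body_sub[OF s A]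
    by (simp add: contraction_def centre_def isContr_contr_body)
qed

lemma mk_contr:
  assumes G: "\<Gamma> \<in> Obj C" and A: "A \<in> Ty C \<Gamma>" and c: "c \<in> Tm C \<Gamma> A"
    and h: "h \<in> Tm C (cext C \<Gamma> A) (path_ty C \<Gamma> A c)"
  shows mk_contr_Tm: "mk_contr C \<Gamma> A c h \<in> Tm C \<Gamma> (isContr C \<Gamma> A)"
    and mk_contr_sub: "\<sigma> \<in> hom C \<Delta> \<Gamma> \<Longrightarrow> tmsub C (isContr C \<Gamma> A) (mk_contr C \<Gamma> A c h) \<sigma>
      = mk_contr C \<Delta> (A \<cdot> \<sigma>) (tmsub C A c \<sigma>) (tmsub C (path_ty C \<Gamma> A c) h (\<sigma> \<up> A))"
proof -
  note B = contr_body_Ty[OF G A] and P = path_ty_Ty[OF G A c] and e = contr_body_sect[OF G A c]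
  have l: "lam C \<Gamma> A (path_ty C \<Gamma> A c) h \<in> Tm C \<Gamma> (contr_body C \<Gamma> A \<cdot> sect C \<Gamma> A c)"
    using lam_Tm[OF G A P h] e by simp
  show "mk_contr C \<Gamma> A c h \<in> Tm C \<Gamma> (isContr C \<Gamma> A)"
    unfolding mk_contr_def isContr_contr_body by (rule mkpair_Tm[OF G A B c l])
  show "tmsub C (isContr C \<Gamma> A) (mk_contr C \<Gamma> A c h) \<sigma>
      = mk_contr C \<Delta> (A \<cdot> \<sigma>) (tmsub C A c \<sigma>) (tmsub C (path_ty C \<Gamma> A c) h (\<sigma> \<up> A))"
    if s: "\<sigma> \<in> hom C \<Delta> \<Gamma>"
    unfolding mk_contr_def isContr_contr_body
    using mkpair_sub[OF s A B c l] lam_sub[OF s A P h] e contr_body_sub[OF s A] path_ty_sub[OF s A c]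
    by simp
qed

end

section \<open>Contractibility of exo-nat products\<close>

locale cwf_exo_nat = cwf_Pi_Sigma_Id C + exo_nat_products C Omega phi psi iota
  for C :: "('o, 'm, 't, 'a, 'z) cwf_tt_scheme" (structure) and Omega phi psi iota
begin

text \<open>The components of the variable of \<Gamma>.\<Omega>(Y). Stability of
  \<open>Omega\<close> lets the variable be read as an element of the product of the weakened
  types.\<close>

definition gproj :: "'o \<Rightarrow> (nat \<Rightarrow> 't) \<Rightarrow> nat \<Rightarrow> 'a" where
  "gproj \<Gamma> Y = (let \<Omega> = Omega \<Gamma> Y in
     phi (cext C \<Gamma> \<Omega>) (\<lambda>n. Y n \<cdot> pp C \<Gamma> \<Omega>) (qq C \<Gamma> \<Omega>))"

text \<open>The n-th projection \<Gamma>.\<Omega>(Y) \<rightarrow> \<Gamma>.Y(n) over \<Gamma>,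
  along which the contractions of the factors are pulled back.\<close>

definition projsub :: "'o \<Rightarrow> (nat \<Rightarrow> 't) \<Rightarrow> nat \<Rightarrow> 'm" where
  "projsub \<Gamma> Y n = \<langle>pp C \<Gamma> (Omega \<Gamma> Y); Y n; gproj \<Gamma> Y n\<rangle>"

definition Omega_path :: "'o \<Rightarrow> (nat \<Rightarrow> 't) \<Rightarrow> (nat \<Rightarrow> 'a) \<Rightarrow> 'a" where
  "Omega_path \<Gamma> Y t = (let \<Omega> = Omega \<Gamma> Y; c = (\<lambda>n. centre C \<Gamma> (Y n) (t n)) in
     iota (cext C \<Gamma> \<Omega>) (\<lambda>n. Y n \<cdot> pp C \<Gamma> \<Omega>) (\<lambda>n. tmsub C (Y n) (c n) (pp C \<Gamma> \<Omega>)) (gproj \<Gamma> Y)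
       (\<lambda>n. tmsub C (path_ty C \<Gamma> (Y n) (c n)) (contraction C \<Gamma> (Y n) (t n)) (projsub \<Gamma> Y n)))"

definition Omega_contr :: "'o \<Rightarrow> (nat \<Rightarrow> 't) \<Rightarrow> (nat \<Rightarrow> 'a) \<Rightarrow> 'a" where
  "Omega_contr \<Gamma> Y t =
     mk_contr C \<Gamma> (Omega \<Gamma> Y) (psi \<Gamma> Y (\<lambda>n. centre C \<Gamma> (Y n) (t n))) (Omega_path \<Gamma> Y t)"

section \<open>The variable of an exo-nat product and its components\<close>

context
  fixes \<Gamma> :: 'o and Y :: "nat \<Rightarrow> 't"
  assumes G: "\<Gamma> \<in> Obj C" and Y: "\<And>n. Y n \<in> Ty C \<Gamma>"
begin

lemma Omega: "Omega \<Gamma> Y \<in> Ty C \<Gamma>"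
  using Omega_Ty[OF G Y] .

lemma pp_Omega: "pp C \<Gamma> (Omega \<Gamma> Y) \<in> hom C (cext C \<Gamma> (Omega \<Gamma> Y)) \<Gamma>"
  using pp_hom[OF G Omega] .

lemma qq_Omega:
  "qq C \<Gamma> (Omega \<Gamma> Y)
    \<in> Tm C (cext C \<Gamma> (Omega \<Gamma> Y)) (Omega (cext C \<Gamma> (Omega \<Gamma> Y)) (\<lambda>n. Y n \<cdot> pp C \<Gamma> (Omega \<Gamma> Y)))"
  using qq_Tm[OF G Omega] Omega_sub[OF pp_Omega Y] by simp

lemma gproj_Tm: "gproj \<Gamma> Y n \<in> Tm C (cext C \<Gamma> (Omega \<Gamma> Y)) (Y n \<cdot> pp C \<Gamma> (Omega \<Gamma> Y))"
  using phi_Tm[OF cext_obj[OF G Omega] tysub_Ty[OF Y pp_Omega] qq_Omega] by (simp add: gproj_def Let_def)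

text \<open>The components determine the variable. The right endpoint of the path given by
  \<open>iota\<close> is therefore the variable itself, as a contraction requires.\<close>

lemma psi_gproj:
  "psi (cext C \<Gamma> (Omega \<Gamma> Y)) (\<lambda>n. Y n \<cdot> pp C \<Gamma> (Omega \<Gamma> Y)) (gproj \<Gamma> Y) = qq C \<Gamma> (Omega \<Gamma> Y)"
  using psi_phi[OF cext_obj[OF G Omega] tysub_Ty[OF Y pp_Omega] qq_Omega] by (simp add: gproj_def Let_def)

text \<open>This is naturality of \<open>phi\<close> along the lift of \<sigma>, which sends the
  variable to the variable.\<close>

lemma gproj_sub:
  assumes s: "\<sigma> \<in> hom C \<Delta> \<Gamma>"
  shows "tmsub C (Y n \<cdot> pp C \<Gamma> (Omega \<Gamma> Y)) (gproj \<Gamma> Y n) (\<sigma> \<up> Omega \<Gamma> Y) = gproj \<Delta> (\<lambda>n. Y n \<cdot> \<sigma>) n"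
proof -
  have D: "\<Delta> \<in> Obj C" using homD[OF s] by simp
  note L = lift[OF s Omega] and O = Omega_sub[OF s Y]
  have "Y n \<cdot> pp C \<Gamma> (Omega \<Gamma> Y) \<cdot> (\<sigma> \<up> Omega \<Gamma> Y) = Y n \<cdot> \<sigma> \<cdot> pp C \<Delta> (Omega \<Delta> (\<lambda>n. Y n \<cdot> \<sigma>))" for n
    using tysub_cmp[OF Y pp_Omega L(1), of n] tysub_cmp[OF Y s pp_hom[OF D tysub_Ty[OF Omega s]], of n]
      L(2) O by simp
  then show ?thesis
    using phi_sub[OF L(1) tysub_Ty[OF Y pp_Omega] qq_Omega, of n] L(3) O Omega_sub[OF pp_Omega Y]
    by (simp add: gproj_def Let_def)
qed

lemma projsub_hom: "projsub \<Gamma> Y n \<in> hom C (cext C \<Gamma> (Omega \<Gamma> Y)) (cext C \<Gamma> (Y n))"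
  unfolding projsub_def by (rule sext_hom[OF Y pp_Omega gproj_Tm])

text \<open>Both composites are pairings over the same substitution into \<Gamma>; their second
  components agree by \<open>gproj_sub\<close>.\<close>

lemma projsub_lift:
  assumes s: "\<sigma> \<in> hom C \<Delta> \<Gamma>"
  shows "projsub \<Gamma> Y n \<odot> (\<sigma> \<up> Omega \<Gamma> Y)
    = (\<sigma> \<up> Y n) \<odot> projsub \<Delta> (\<lambda>n. Y n \<cdot> \<sigma>) n"
proof -
  have D: "\<Delta> \<in> Obj C" using homD[OF s] by simp
  note L = lift[OF s Omega] and O = Omega_sub[OF s Y] and pH = pp_hom[OF D tysub_Ty[OF Omega s]]
  have "gproj \<Delta> (\<lambda>n. Y n \<cdot> \<sigma>) n \<in> Tm C (cext C \<Delta> (Omega \<Gamma> Y \<cdot> \<sigma>)) (Y n \<cdot> \<sigma> \<cdot> pp C \<Delta> (Omega \<Gamma> Y \<cdot> \<sigma>))"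
    using tmsub_Tm[OF tysub_Ty[OF Y pp_Omega] gproj_Tm L(1), of n] gproj_sub[OF s, of n]
      tysub_cmp[OF Y pp_Omega L(1), of n] tysub_cmp[OF Y s pH, of n] L(2) by simp
  then show ?thesis
    using sext_cmp[OF Y pp_Omega gproj_Tm L(1), of n] gproj_sub[OF s, of n] L(2)
      lift_sext[OF s Y pH, of _ n] O by (simp add: projsub_def)
qed

end

section \<open>Contracting a product of contractible types\<close>

context
  fixes \<Gamma> :: 'o and Y :: "nat \<Rightarrow> 't" and t :: "nat \<Rightarrow> 'a"
  assumes G: "\<Gamma> \<in> Obj C" and Y: "\<And>n. Y n \<in> Ty C \<Gamma>"
    and t: "\<And>n. t n \<in> Tm C \<Gamma> (isContr C \<Gamma> (Y n))"
begin

text \<open>Brings the path type into the exact form produced by \<open>iota_Tm\<close>: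
  \<open>psi_sub\<close> moves the weakening inside \<open>psi\<close>, and the variable is written
  as \<open>psi\<close> of its components.\<close>

lemma path_ty_Omega:
  assumes "\<And>n. c n \<in> Tm C \<Gamma> (Y n)"
  shows "path_ty C \<Gamma> (Omega \<Gamma> Y) (psi \<Gamma> Y c)
    = IdT C (cext C \<Gamma> (Omega \<Gamma> Y)) (Omega (cext C \<Gamma> (Omega \<Gamma> Y)) (\<lambda>n. Y n \<cdot> pp C \<Gamma> (Omega \<Gamma> Y)))
        (psi (cext C \<Gamma> (Omega \<Gamma> Y)) (\<lambda>n. Y n \<cdot> pp C \<Gamma> (Omega \<Gamma> Y))
           (\<lambda>n. tmsub C (Y n) (c n) (pp C \<Gamma> (Omega \<Gamma> Y))))
        (psi (cext C \<Gamma> (Omega \<Gamma> Y)) (\<lambda>n. Y n \<cdot> pp C \<Gamma> (Omega \<Gamma> Y)) (gproj \<Gamma> Y))"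
  unfolding path_ty_def psi_gproj[OF G Y]
    psi_sub[OF pp_Omega[of \<Gamma> Y, OF G Y] Y assms] Omega_sub[OF pp_Omega[of \<Gamma> Y, OF G Y] Y] ..

lemma contraction_projsub_Tm:
  "tmsub C (path_ty C \<Gamma> (Y n) (centre C \<Gamma> (Y n) (t n))) (contraction C \<Gamma> (Y n) (t n)) (projsub \<Gamma> Y n)
    \<in> Tm C (cext C \<Gamma> (Omega \<Gamma> Y)) (IdT C (cext C \<Gamma> (Omega \<Gamma> Y)) (Y n \<cdot> pp C \<Gamma> (Omega \<Gamma> Y))
        (tmsub C (Y n) (centre C \<Gamma> (Y n) (t n)) (pp C \<Gamma> (Omega \<Gamma> Y))) (gproj \<Gamma> Y n))"
  using tmsub_Tm[OF path_ty_Ty[OF G Y centre_Tm[OF G Y t]] contraction_Tm[OF G Y t] projsub_hom[of \<Gamma> Y, OF G Y]]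
    path_ty_sext[OF Y centre_Tm[OF G Y t] pp_Omega[of \<Gamma> Y, OF G Y] gproj_Tm[of \<Gamma> Y, OF G Y]]
  by (simp add: projsub_def)

lemma Omega_path_Tm:
  "Omega_path \<Gamma> Y t \<in> Tm C (cext C \<Gamma> (Omega \<Gamma> Y))
     (path_ty C \<Gamma> (Omega \<Gamma> Y) (psi \<Gamma> Y (\<lambda>n. centre C \<Gamma> (Y n) (t n))))"
  unfolding path_ty_Omega[OF centre_Tm[OF G Y t]] Omega_path_def Let_def
  by (rule iota_Tm[OF cext_obj[OF G Omega[of \<Gamma> Y, OF G Y]] tysub_Ty[OF Y pp_Omega[of \<Gamma> Y, OF G Y]]
        tmsub_Tm[OF Y centre_Tm[OF G Y t] pp_Omega[of \<Gamma> Y, OF G Y]] gproj_Tm[of \<Gamma> Y, OF G Y] contraction_projsub_Tm])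

text \<open>By \<open>iota_sub\<close> the substitution acts on each ingredient of
  \<open>iota\<close>. These are compared one at a time: types, left endpoints, paths, and right
  endpoints by \<open>gproj_sub\<close>.\<close>

lemma Omega_path_sub:
  assumes s: "\<sigma> \<in> hom C \<Delta> \<Gamma>"
  shows "tmsub C (path_ty C \<Gamma> (Omega \<Gamma> Y) (psi \<Gamma> Y (\<lambda>n. centre C \<Gamma> (Y n) (t n))))
      (Omega_path \<Gamma> Y t) (\<sigma> \<up> Omega \<Gamma> Y)
    = Omega_path \<Delta> (\<lambda>n. Y n \<cdot> \<sigma>) (\<lambda>n. tmsub C (isContr C \<Gamma> (Y n)) (t n) \<sigma>)"
proof -
  have D: "\<Delta> \<in> Obj C" using homD[OF s] by simp
  note O = Omega[of \<Gamma> Y, OF G Y] and OH = pp_Omega[of \<Gamma> Y, OF G Y] and OS = Omega_sub[OF s Y] and c = centre_Tm[OF G Y t]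
  note L = lift[OF s O] and pH = pp_hom[OF D tysub_Ty[OF O s]]
  note Ys = tysub_Ty[OF Y s]
    have 1: "Y n \<cdot> pp C \<Gamma> (Omega \<Gamma> Y) \<cdot> (\<sigma> \<up> Omega \<Gamma> Y) = Y n \<cdot> \<sigma> \<cdot> pp C \<Delta> (Omega \<Delta> (\<lambda>n. Y n \<cdot> \<sigma>))" for n
    using tysub_cmp[OF Y OH L(1), of n] tysub_cmp[OF Y s pH, of n] L(2) OS by simp
  have 2: "tmsub C (Y n \<cdot> pp C \<Gamma> (Omega \<Gamma> Y)) (tmsub C (Y n) (centre C \<Gamma> (Y n) (t n)) (pp C \<Gamma> (Omega \<Gamma> Y)))
       (\<sigma> \<up> Omega \<Gamma> Y)
      = tmsub C (Y n \<cdot> \<sigma>) (centre C \<Delta> (Y n \<cdot> \<sigma>) (tmsub C (isContr C \<Gamma> (Y n)) (t n) \<sigma>))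
         (pp C \<Delta> (Omega \<Delta> (\<lambda>n. Y n \<cdot> \<sigma>)))" for n
    using tmsub_cmp[OF Y c OH L(1), of n] tmsub_cmp[OF Y c s pH, of n] L(2) OS
      centre_sub[OF s Y t, of n] by simp
  \<comment> \<open>The factorwise paths commute with \<sigma> by the naturality square
    \<open>projsub_lift\<close> and the stability of each contraction.\<close>
  have 3: "tmsub C (IdT C (cext C \<Gamma> (Omega \<Gamma> Y)) (Y n \<cdot> pp C \<Gamma> (Omega \<Gamma> Y))
        (tmsub C (Y n) (centre C \<Gamma> (Y n) (t n)) (pp C \<Gamma> (Omega \<Gamma> Y))) (gproj \<Gamma> Y n))
       (tmsub C (path_ty C \<Gamma> (Y n) (centre C \<Gamma> (Y n) (t n))) (contraction C \<Gamma> (Y n) (t n)) (projsub \<Gamma> Y n))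
       (\<sigma> \<up> Omega \<Gamma> Y)
     = tmsub C (path_ty C \<Delta> (Y n \<cdot> \<sigma>) (centre C \<Delta> (Y n \<cdot> \<sigma>) (tmsub C (isContr C \<Gamma> (Y n)) (t n) \<sigma>)))
         (contraction C \<Delta> (Y n \<cdot> \<sigma>) (tmsub C (isContr C \<Gamma> (Y n)) (t n) \<sigma>))
         (projsub \<Delta> (\<lambda>n. Y n \<cdot> \<sigma>) n)" for n
  proof -
    note P = path_ty_Ty[OF G Y c, of n] and K = contraction_Tm[OF G Y t, of n]
    have e: "path_ty C \<Gamma> (Y n) (centre C \<Gamma> (Y n) (t n)) \<cdot> projsub \<Gamma> Y n
       = IdT C (cext C \<Gamma> (Omega \<Gamma> Y)) (Y n \<cdot> pp C \<Gamma> (Omega \<Gamma> Y))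
        (tmsub C (Y n) (centre C \<Gamma> (Y n) (t n)) (pp C \<Gamma> (Omega \<Gamma> Y))) (gproj \<Gamma> Y n)"
      using path_ty_sext[OF Y[of n] c[of n] OH gproj_Tm[of \<Gamma> Y n, OF G Y]] by (simp add: projsub_def)
    show ?thesis
      using tmsub_cmp[OF P K projsub_hom[of \<Gamma> Y, OF G Y] L(1)] e projsub_lift[of \<Gamma> Y, OF G Y s]
        tmsub_cmp[OF P K lift_hom[OF s Y] projsub_hom[of \<Delta> "\<lambda>n. Y n \<cdot> \<sigma>", OF D Ys]]
        path_ty_sub[OF s Y c, of n] centre_sub[OF s Y t, of n] contraction_sub[OF s Y t, of n] by simp
  qed
  show ?thesis
    unfolding path_ty_Omega[OF c]
    using iota_sub[OF L(1) tysub_Ty[OF Y OH] tmsub_Tm[OF Y c OH] gproj_Tm[of \<Gamma> Y, OF G Y] contraction_projsub_Tm]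
      OS 1 2 3 gproj_sub[of \<Gamma> Y, OF G Y s]
    by (simp add: Omega_path_def Let_def)
qed

lemma Omega_contr_Tm: "Omega_contr \<Gamma> Y t \<in> Tm C \<Gamma> (isContr C \<Gamma> (Omega \<Gamma> Y))"
  unfolding Omega_contr_def
  by (rule mk_contr_Tm[OF G Omega[of \<Gamma> Y, OF G Y] psi_Tm[OF G Y centre_Tm[OF G Y t]] Omega_path_Tm])

lemma Omega_contr_sub:
  assumes s: "\<sigma> \<in> hom C \<Delta> \<Gamma>"
  shows "tmsub C (isContr C \<Gamma> (Omega \<Gamma> Y)) (Omega_contr \<Gamma> Y t) \<sigma>
    = Omega_contr \<Delta> (\<lambda>n. Y n \<cdot> \<sigma>) (\<lambda>n. tmsub C (isContr C \<Gamma> (Y n)) (t n) \<sigma>)"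
  using mk_contr_sub[OF G Omega[of \<Gamma> Y, OF G Y] psi_Tm[OF G Y centre_Tm[OF G Y t]] Omega_path_Tm s]
    Omega_path_sub[OF s] psi_sub[OF s Y centre_Tm[OF G Y t]] Omega_sub[OF s Y] centre_sub[OF s Y t]
  by (simp add: Omega_contr_def)

end

end

section \<open>Types and contractibility in the presheaf model\<close>

lemma fib_cwf_simps:
  "Tm (fib_cwf D) \<Gamma> A = Tm D \<Gamma> (conv D \<Gamma> A)"
  "tmsub (fib_cwf D) A a \<sigma> = tmsub D (conv D (Cod D \<sigma>) A) a \<sigma>"
  "isContr (fib_cwf D) \<Gamma> A = SigF D \<Gamma> A
     (PiF D (cext D \<Gamma> (conv D \<Gamma> A)) (tysubF D A (pp D \<Gamma> (conv D \<Gamma> A))) (IdF D \<Gamma> A))"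
  by (simp_all add: fib_cwf_def isContr_def)

section \<open>Lifts and isomorphisms of extensions of presheaves\<close>

context psh_model
begin

lemma mk_ntrans_cong:
  assumes "\<And>\<Gamma> x. \<lbrakk>\<Gamma> \<in> Obj C; x \<in> at P \<Gamma>\<rbrakk> \<Longrightarrow> k \<Gamma> x = k' \<Gamma> x"
  shows "mk_ntrans C P Q k = mk_ntrans C P Q k'"
  using assms by (auto simp: mk_ntrans_def fun_eq_iff)

lemma pext_at_iff:
  "\<lbrakk>presheaf C P; presheaf (elements C P) A\<rbrakk>
    \<Longrightarrow> upair U x a \<in> at (pext U C P A) \<Gamma> \<longleftrightarrow> x \<in> at P \<Gamma> \<and> a \<in> at A (\<Gamma>, x)"
  by (auto simp: pext_at upair_inj at_Obj)

lemma pext_atE: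
  assumes "z \<in> at (pext U C P A) \<Gamma>"
  obtains x a where "z = upair U x a" "\<Gamma> \<in> Obj C" "x \<in> at P \<Gamma>" "a \<in> at A (\<Gamma>, x)"
  using assms by (auto simp: pext_at split: if_splits)

text \<open>The lift is a definite description in the presheaf model, so its values are read off
  from the equations that characterise its two coordinates.\<close>

lemma cpt_lift:
  assumes t: "nat_trans C \<tau>" and A: "presheaf (elements C (tgt \<tau>)) A"
  shows "nat_trans C (\<tau> \<up>\<^bsub>\<D>\<^esub> A)"
    and "src (\<tau> \<up>\<^bsub>\<D>\<^esub> A) = pext U C (src \<tau>) (pty_sub C A \<tau>)"
    and "tgt (\<tau> \<up>\<^bsub>\<D>\<^esub> A) = pext U C (tgt \<tau>) A"
    and "\<lbrakk>x \<in> at (src \<tau>) \<Gamma>; a \<in> at A (\<Gamma>, cpt \<tau> \<Gamma> x)\<rbrakk>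
      \<Longrightarrow> cpt (\<tau> \<up>\<^bsub>\<D>\<^esub> A) \<Gamma> (upair U x a) = upair U (cpt \<tau> \<Gamma> x) a"
proof -
  let ?L = "\<tau> \<up>\<^bsub>\<D>\<^esub> A"
  have tH: "\<tau> \<in> hom \<D> (src \<tau>) (tgt \<tau>)" using t by (simp add: D_hom)
  have AT: "A \<in> Ty \<D> (tgt \<tau>)" using A by simp
  note L = cwf.lift_hom[OF psh_cwf tH AT] cwf.pp_lift[OF psh_cwf tH AT] cwf.qq_lift[OF psh_cwf tH AT]
  show n: "nat_trans C ?L" and s: "src ?L = pext U C (src \<tau>) (pty_sub C A \<tau>)"
    and tg: "tgt ?L = pext U C (tgt \<tau>) A"
    using L(1) by (auto simp: D_hom)
  assume x: "x \<in> at (src \<tau>) \<Gamma>" and a: "a \<in> at A (\<Gamma>, cpt \<tau> \<Gamma> x)"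
  have G: "\<Gamma> \<in> Obj C" using at_Obj[OF nat_transD(1)[OF t] x] .
  have z: "upair U x a \<in> at (pext U C (src \<tau>) (pty_sub C A \<tau>)) \<Gamma>"
    using x a G by (auto simp: pext_at pty_sub_at)
  then have w: "cpt ?L \<Gamma> (upair U x a) \<in> at (pext U C (tgt \<tau>) A) \<Gamma>"
    using nat_transD(3)[OF n, of _ \<Gamma>] s tg by simp
  \<comment> \<open>The equation for the projection is evaluated at the element (x, a) to find the
    first coordinate; the equation for the generic term gives the second.\<close>
  from fun_cong[OF fun_cong[OF arg_cong[OF L(2), of cpt], of \<Gamma>], of "upair U x a"]
  have "ufst U (cpt ?L \<Gamma> (upair U x a)) = cpt \<tau> \<Gamma> x"
    using G z w s by (simp add: cpt_ncomp cpt_mk)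
  moreover from fun_cong[OF fun_cong[OF L(3), of \<Gamma>], of "upair U x a"]
  have "usnd U (cpt ?L \<Gamma> (upair U x a)) = a"
    using G z w s by (simp add: ptm_sub_def mk_ptm_app)
  ultimately show "cpt ?L \<Gamma> (upair U x a) = upair U (cpt \<tau> \<Gamma> x) a"
    using w by (auto elim!: pext_atE)
qed

text \<open>The inverse is built from the fibrewise inverses, which commute with restriction because
  the bijections do.\<close>

lemma ty_iso_mk:
  assumes P: "presheaf C P" and A: "presheaf (elements C P) A" and B: "presheaf (elements C P) B"
    and bij: "\<And>\<Gamma> x. \<lbrakk>\<Gamma> \<in> Obj C; x \<in> at P \<Gamma>\<rbrakk> \<Longrightarrow> bij_betw (k \<Gamma> x) (at A (\<Gamma>, x)) (at B (\<Gamma>, x))"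
    and nat: "\<And>\<Delta> \<Gamma> \<sigma> x a. \<lbrakk>\<sigma> \<in> hom C \<Delta> \<Gamma>; x \<in> at P \<Gamma>; a \<in> at A (\<Gamma>, x)\<rbrakk>
      \<Longrightarrow> k \<Delta> (act P \<sigma> x) (act A (\<sigma>, x) a) = act B (\<sigma>, x) (k \<Gamma> x a)"
  shows "ty_iso \<D> P A B (mk_ntrans C (pext U C P A) (pext U C P B)
    (\<lambda>\<Gamma> z. upair U (ufst U z) (k \<Gamma> (ufst U z) (usnd U z))))"
proof -
  \<comment> \<open>Kept general in both types and in the fibre map, so that the same facts serve
    for the map and for its inverse.\<close>
  let ?E = "\<lambda>A B k. mk_ntrans C (pext U C P A) (pext U C P B)
    (\<lambda>\<Gamma> z. upair U (ufst U z) (k \<Gamma> (ufst U z) (usnd U z)))"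
  have E: "nat_trans C (?E A B k)" "ncomp C (mk_ntrans C (pext U C P B) P (\<lambda>_ z. ufst U z)) (?E A B k)
      = mk_ntrans C (pext U C P A) P (\<lambda>_ z. ufst U z)"
    if A: "presheaf (elements C P) A" and B: "presheaf (elements C P) B"
    and k: "\<And>\<Gamma> x a. \<lbrakk>\<Gamma> \<in> Obj C; x \<in> at P \<Gamma>; a \<in> at A (\<Gamma>, x)\<rbrakk> \<Longrightarrow> k \<Gamma> x a \<in> at B (\<Gamma>, x)"
    and nat: "\<And>\<Delta> \<Gamma> \<sigma> x a. \<lbrakk>\<sigma> \<in> hom C \<Delta> \<Gamma>; x \<in> at P \<Gamma>; a \<in> at A (\<Gamma>, x)\<rbrakk>
      \<Longrightarrow> k \<Delta> (act P \<sigma> x) (act A (\<sigma>, x) a) = act B (\<sigma>, x) (k \<Gamma> x a)" for A B k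
  proof -
    show n: "nat_trans C (?E A B k)"
    proof (rule nat_trans_mk[OF pext_psh[OF P A] pext_psh[OF P B]], goal_cases)
      case (1 \<Gamma> z) then show ?case by (auto elim!: pext_atE simp: pext_at_iff[OF P B] k)
    next
      case (2 \<Delta> \<Gamma> \<sigma> z)
      from 2(2) show ?case
        by (rule pext_atE) (simp add: pext_act[OF 2(1)] nat[OF 2(1)] k)
    qed
    show "ncomp C (mk_ntrans C (pext U C P B) P (\<lambda>_ z. ufst U z)) (?E A B k)
      = mk_ntrans C (pext U C P A) P (\<lambda>_ z. ufst U z)"
    proof (rule nat_trans_eqI[OF ncomp_nat[OF pp_nat[OF P B] n] pp_nat[OF P A]], goal_cases)
      case (4 \<Gamma> z)
      then show ?case using nat_transD(3)[OF n, of z \<Gamma>] by (simp add: cpt_ncomp cpt_mk)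
    qed simp_all
  qed
  have I: "ncomp C (?E B A l) (?E A B k) = mk_ntrans C (pext U C P A) (pext U C P A) (\<lambda>_ z. z)"
    if k: "\<And>\<Gamma> x a. \<lbrakk>\<Gamma> \<in> Obj C; x \<in> at P \<Gamma>; a \<in> at A (\<Gamma>, x)\<rbrakk> \<Longrightarrow> k \<Gamma> x a \<in> at B (\<Gamma>, x)"
    and lk: "\<And>\<Gamma> x a. \<lbrakk>\<Gamma> \<in> Obj C; x \<in> at P \<Gamma>; a \<in> at A (\<Gamma>, x)\<rbrakk> \<Longrightarrow> l \<Gamma> x (k \<Gamma> x a) = a"
    and B: "presheaf (elements C P) B"
    for A B k l
    unfolding ncomp_def src_mk tgt_mk
  proof (rule mk_ntrans_cong)
    fix \<Gamma> z assume G: "\<Gamma> \<in> Obj C" and z: "z \<in> at (pext U C P A) \<Gamma>"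
    from z obtain x a where xa: "z = upair U x a" "x \<in> at P \<Gamma>" "a \<in> at A (\<Gamma>, x)" by (rule pext_atE)
    have "upair U x (k \<Gamma> x a) \<in> at (pext U C P B) \<Gamma>" using G xa k by (simp add: pext_at_iff[OF P B])
    then show "cpt (?E B A l) \<Gamma> (cpt (?E A B k) \<Gamma> z) = z"
      using G z xa lk by (simp add: cpt_mk)
  qed
  let ?l = "\<lambda>\<Gamma> x. inv_into (at A (\<Gamma>, x)) (k \<Gamma> x)"
  have k: "k \<Gamma> x a \<in> at B (\<Gamma>, x)" "?l \<Gamma> x (k \<Gamma> x a) = a" if "\<Gamma> \<in> Obj C" "x \<in> at P \<Gamma>" "a \<in> at A (\<Gamma>, x)" for \<Gamma> x a
    using bij[OF that(1,2)] that(3) by (auto simp: bij_betw_def)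
  have l: "?l \<Gamma> x b \<in> at A (\<Gamma>, x)" "k \<Gamma> x (?l \<Gamma> x b) = b" if "\<Gamma> \<in> Obj C" "x \<in> at P \<Gamma>" "b \<in> at B (\<Gamma>, x)" for \<Gamma> x b
    using bij[OF that(1,2)] that(3) by (auto simp: bij_betw_def inv_into_into f_inv_into_f)
  have lnat: "?l \<Delta> (act P \<sigma> x) (act B (\<sigma>, x) b) = act A (\<sigma>, x) (?l \<Gamma> x b)"
    if s: "\<sigma> \<in> hom C \<Delta> \<Gamma>" "x \<in> at P \<Gamma>" and b: "b \<in> at B (\<Gamma>, x)" for \<Delta> \<Gamma> \<sigma> x b
  proof -
    have G: "\<Gamma> \<in> Obj C" "\<Delta> \<in> Obj C" using homD[OF s(1)] by auto
    have "act B (\<sigma>, x) b = k \<Delta> (act P \<sigma> x) (act A (\<sigma>, x) (?l \<Gamma> x b))"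
      using nat[OF s l(1)[OF G(1) s(2) b]] l(2)[OF G(1) s(2) b] by simp
    then show ?thesis
      using k(2)[OF G(2) act_at[OF P s] pty_act_at[OF P A s l(1)[OF G(1) s(2) b]]] by simp
  qed
  show ?thesis
    unfolding ty_iso_def
    using E[where A = A and B = B and k = k, OF A B k(1) nat] E[where A = B and B = A and k = ?l, OF B A l(1) lnat]
      I[where A = A and B = B and k = k and l = ?l, OF k B] I[where A = B and B = A and k = ?l and l = k, OF l A]
    by (auto simp: D_hom intro!: exI[of _ "?E B A ?l"])
qed

lemma exo_nat_at: "at (exo_nat U C) (\<Gamma>, x) = (if x \<in> at (pterminal U C) \<Gamma> then range (unum U) else {})"
  unfolding exo_nat_def pty_at using at_Obj[OF pterminal_psh, of x \<Gamma>] by auto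

lemma exo_nat_act:
  "\<lbrakk>\<sigma> \<in> hom C \<Delta> \<Gamma>; x \<in> at (pterminal U C) \<Gamma>; a \<in> range (unum U)\<rbrakk> \<Longrightarrow> act (exo_nat U C) (\<sigma>, x) a = a"
  unfolding exo_nat_def by (rule pty_act) auto

lemma exo_nat_psh: "presheaf (elements C (pterminal U C)) (exo_nat U C)"
  unfolding exo_nat_def by (rule pty_mk[OF pterminal_psh]) auto

end

section \<open>Contractibility in the presheaf model, computed pointwise\<close>

locale psh_tt = psh_model U C + cwf_Pi_Sigma_Id C
  for U :: "('o, 'm, 'u) universe" and C :: "('o, 'm, 'u, 'u, 'z) cwf_tt_scheme" (structure)
begin

text \<open>The formers of the second level are evaluated at generic elements: over \<Gamma>.A at
  (x[p], q), and over \<Gamma>.A.A[p] at its restriction paired with the new variable. By naturality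
  \<open>Y\<close> takes weakened types there as values, and the identity type reduces to
  \<open>Idt\<close>.\<close>

lemma isContr_psh:
  assumes Y: "nat_trans C Y" "tgt Y = ty_psh C" "src Y = P"
  shows "isContr (fib_cwf \<D>) P Y = mk_ntrans C P (ty_psh C) (\<lambda>\<Gamma> x. isContr C \<Gamma> (cpt Y \<Gamma> x))"
  unfolding fib_cwf_simps
proof (simp add: psh_tlcwf_def, unfold fty_binder_def, rule mk_ntrans_cong, goal_cases)
  case (1 \<Gamma> x)
  note G = 1(1) and x = 1(2)
  have P: "presheaf C P" using nat_transD(1)[OF Y(1)] Y(3) by simp
  let ?F = "fty_conv C P Y"
  have F: "presheaf (elements C P) ?F" using fty_conv_psh[OF Y(1,2)] Y(3) by simp
  let ?PA = "pext U C P ?F"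
  let ?\<pi> = "mk_ntrans C ?PA P (\<lambda>_ z. ufst U z)"
  let ?Y' = "ncomp C Y ?\<pi>"
  note PA = pext_psh[OF P F] and pn = pp_nat[OF P F]
  have Y': "nat_trans C ?Y'" "tgt ?Y' = ty_psh C" "src ?Y' = ?PA"
    using ncomp_nat[OF Y(1) pn] Y by simp_all
  have F': "presheaf (elements C ?PA) (fty_conv C ?PA ?Y')" using fty_conv_psh[OF Y'(1,2)] by simp
  have Ycpt: "cpt ?Y' \<Delta> (upair U y a) = cpt Y \<Delta> y" if "upair U y a \<in> at ?PA \<Delta>" for \<Delta> y a
    using that at_Obj[OF PA that] by (simp add: cpt_ncomp cpt_mk)
  define A where "A = cpt Y \<Gamma> x"
  have A: "A \<in> Ty C \<Gamma>" unfolding A_def using ftyD(1)[OF Y(1,2)] x Y(3) by simp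
  define p where "p = pp C \<Gamma> A" define q where "q = qq C \<Gamma> A"
  define E where "E = cext C \<Gamma> A"
  have E: "E \<in> Obj C" and p: "p \<in> hom C E \<Gamma>" and q: "q \<in> Tm C E (A \<cdot> p)"
    using cext_obj[OF G A] pp_hom[OF G A] qq_Tm[OF G A] by (simp_all add: E_def p_def q_def)
  have Ap: "A \<cdot> p \<in> Ty C E" using tysub_Ty[OF A p] .
  define p' where "p' = pp C E (A \<cdot> p)" define q' where "q' = qq C E (A \<cdot> p)"
  define E' where "E' = cext C E (A \<cdot> p)"
  have E': "E' \<in> Obj C" and p': "p' \<in> hom C E' E" and q': "q' \<in> Tm C E' (A \<cdot> p \<cdot> p')"
    using cext_obj[OF E Ap] pp_hom[OF E Ap] qq_Tm[OF E Ap] by (simp_all add: E'_def p'_def q'_def)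
  have xp: "act P p x \<in> at P E" and Yp: "cpt Y E (act P p x) = A \<cdot> p"
    using act_at[OF P p x] ftyD(2)[OF Y(1,2) p] x Y(3) by (simp_all add: A_def)
  have xp': "act P p' (act P p x) \<in> at P E'" and Yp': "cpt Y E' (act P p' (act P p x)) = A \<cdot> p \<cdot> p'"
    using act_at[OF P p' xp] ftyD(2)[OF Y(1,2) p', of "act P p x"] xp Yp Y(3) by simp_all
  \<comment> \<open>The generic element over \<Gamma>.A at which \<open>fty_binder\<close> evaluates
    its second argument.\<close>
  let ?z = "upair U (act P p x) q"
  have qF: "q \<in> at ?F (E, act P p x)" using E xp q Yp by (simp add: fty_conv_at)
  have z: "?z \<in> at ?PA E" using xp qF by (simp add: pext_at_iff[OF P F])
  have zp': "act ?PA p' ?z = upair U (act P p' (act P p x)) (tmsub C (A \<cdot> p) q p')"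
    using pext_act[OF p' xp qF] fty_conv_act[OF p' xp, of q Y] q Yp by simp
  have zp'_at: "act ?PA p' ?z \<in> at ?PA E'" using act_at[OF PA p' z] .
  \<comment> \<open>The generic element over \<Gamma>.A.A[p]. Membership has to be known before
    \<open>fty_Id\<close> can be evaluated, since components take a default value elsewhere.\<close>
  have w: "upair U (act ?PA p' ?z) q' \<in> at (pext U C ?PA (fty_conv C ?PA ?Y')) E'"
    using zp'_at E' q' Yp' Ycpt[of "act P p' (act P p x)" "tmsub C (A \<cdot> p) q p'" E'] zp'
    by (simp add: pext_at_iff[OF PA F'] fty_conv_at)
  \<comment> \<open>The value is the identity type at the two variables, which is \<open>Idt\<close>
    by \<open>Idt_eq_path_ty\<close>.\<close>
  have Id: "cpt (fty_Id U C P Y) E' (upair U (act ?PA p' ?z) q') = Idt C \<Gamma> A"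
    unfolding fty_Id_def Let_def
    using w E' zp' Yp' Idt_eq_path_ty[OF G A]
    by (simp add: cpt_mk path_ty_def E_def E'_def p_def p'_def q_def q'_def)
  show ?case
    using E z Ycpt[OF z] Yp Id
    by (simp add: A_def[symmetric] p_def[symmetric] q_def[symmetric] E_def[symmetric] cpt_mk
        p'_def[symmetric] q'_def[symmetric] E'_def[symmetric] isContr_contr_body contr_body_def)
qed

end

section \<open>Cofibrancy of the natural numbers\<close>

definition components :: "('o, 'm, 'u) universe \<Rightarrow> ('o, 'm, 'u) ntrans \<Rightarrow> 'o \<Rightarrow> 'u \<Rightarrow> nat \<Rightarrow> 'u" where
  "components U Y \<Gamma> x n = cpt Y \<Gamma> (upair U x (unum U n))"

locale psh_exo_nat = psh_model U C + cwf_exo_nat C Omega phi psi iota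
  for U :: "('o, 'm, 'u) universe" and C :: "('o, 'm, 'u, 'u, 'z) cwf_tt_scheme" (structure)
    and Omega phi psi iota
begin

sublocale psh_tt U C ..

abbreviation \<N> where "\<N> \<equiv> exo_nat U C"

definition ThTy where
  "ThTy \<sigma> Y = mk_ntrans C (src \<sigma>) (ty_psh C) (\<lambda>\<Gamma> x. Omega \<Gamma> (components U Y \<Gamma> x))"

text \<open>The dependent function that a term \<open>w\<close> of the product determines: at
  (\<rho>, n) it is the n-th component of \<open>w\<close> substituted along \<rho>. The value
  \<open>undefined\<close> elsewhere follows the convention of \<open>pi_families\<close>.\<close>

definition family :: "'o \<Rightarrow> (nat \<Rightarrow> 'u) \<Rightarrow> 'u \<Rightarrow> 'o \<Rightarrow> 'm \<Rightarrow> 'u \<Rightarrow> 'u" where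
  "family \<Gamma> F w = (\<lambda>\<Delta> \<rho> a. if \<rho> \<in> hom C \<Delta> \<Gamma> \<and> a \<in> range (unum U)
     then let n = inv (unum U) a in tmsub C (F n) (phi \<Gamma> F w n) \<rho> else undefined)"

definition iso where
  "iso \<sigma> Y = (let P = src \<sigma>; N = pty_sub C \<N> \<sigma> in
     mk_ntrans C (pext U C P (fty_conv C P (ThTy \<sigma> Y)))
       (pext U C P (pPi U C P N (fty_conv C (pext U C P N) Y)))
       (\<lambda>\<Gamma> z. upair U (ufst U z) (ufam U (family \<Gamma> (components U Y \<Gamma> (ufst U z)) (usnd U z)))))"

definition ThTm where
  "ThTm \<sigma> Y t = mk_ptm C (src \<sigma>) (\<lambda>\<Gamma> x.
     Omega_contr \<Gamma> (components U Y \<Gamma> x) (\<lambda>n. t \<Gamma> (upair U x (unum U n))))"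

lemma family_apply:
  "\<rho> \<in> hom C \<Delta> \<Gamma> \<Longrightarrow> family \<Gamma> F w \<Delta> \<rho> (unum U n) = tmsub C (F n) (phi \<Gamma> F w n) \<rho>"
  by (simp add: family_def unum_inj)

section \<open>The natural numbers over an arbitrary presheaf\<close>

context
  fixes \<sigma> :: "('o, 'm, 'u) ntrans" and P :: "('o, 'm, 'u) psh"
  assumes \<sigma>: "nat_trans C \<sigma>" "tgt \<sigma> = pterminal U C" "src \<sigma> = P"
begin

lemma P: "presheaf C P"
  using nat_transD(1)[OF \<sigma>(1)] \<sigma>(3) by simp

lemma N_psh: "presheaf (elements C P) (pty_sub C \<N> \<sigma>)"
  using pty_sub_psh[OF \<sigma>(1)] exo_nat_psh \<sigma> by simp

lemma N_at: "at (pty_sub C \<N> \<sigma>) (\<Gamma>, x) = (if x \<in> at P \<Gamma> then range (unum U) else {})"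
  using nat_transD(3)[OF \<sigma>(1)] \<sigma>(2,3) at_Obj[OF P] by (auto simp: pty_sub_at exo_nat_at)

lemma N_act: "\<lbrakk>\<tau> \<in> hom C \<Delta> \<Gamma>; x \<in> at P \<Gamma>; a \<in> range (unum U)\<rbrakk> \<Longrightarrow> act (pty_sub C \<N> \<sigma>) (\<tau>, x) a = a"
  using nat_transD(3)[OF \<sigma>(1)] \<sigma>(2,3) by (simp add: pty_sub_act exo_nat_act exo_nat_at)

lemma extN_at: "upair U x (unum U n) \<in> at (pext U C P (pty_sub C \<N> \<sigma>)) \<Gamma> \<longleftrightarrow> x \<in> at P \<Gamma>"
  by (simp add: pext_at_iff[OF P N_psh] N_at)

lemma extN_act:
  "\<lbrakk>\<tau> \<in> hom C \<Delta> \<Gamma>; x \<in> at P \<Gamma>\<rbrakk> \<Longrightarrow>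
    act (pext U C P (pty_sub C \<N> \<sigma>)) \<tau> (upair U x (unum U n)) = upair U (act P \<tau> x) (unum U n)"
  by (simp add: pext_act N_at N_act)

section \<open>The exo-nat product as a type of dependent functions\<close>

context
  fixes Y :: "('o, 'm, 'u) ntrans"
  assumes Y: "nat_trans C Y" "tgt Y = ty_psh C" "src Y = pext U C P (pty_sub C \<N> \<sigma>)"
begin

lemma components_Ty: "x \<in> at P \<Gamma> \<Longrightarrow> components U Y \<Gamma> x n \<in> Ty C \<Gamma>"
  unfolding components_def using ftyD(1)[OF Y(1,2)] extN_at Y(3) by simp

lemma components_act:
  "\<lbrakk>\<tau> \<in> hom C \<Delta> \<Gamma>; x \<in> at P \<Gamma>\<rbrakk> \<Longrightarrow> components U Y \<Delta> (act P \<tau> x) = (\<lambda>n. components U Y \<Gamma> x n \<cdot> \<tau>)"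
  unfolding components_def fun_eq_iff
  using ftyD(2)[OF Y(1,2), of \<tau> \<Delta> \<Gamma>] extN_at extN_act Y(3) by metis

lemma Omega_components: "x \<in> at P \<Gamma> \<Longrightarrow> Omega \<Gamma> (components U Y \<Gamma> x) \<in> Ty C \<Gamma>"
  using Omega_Ty at_Obj[OF P] components_Ty by blast

lemma Omega_components_act:
  "\<lbrakk>\<tau> \<in> hom C \<Delta> \<Gamma>; x \<in> at P \<Gamma>\<rbrakk>
    \<Longrightarrow> Omega \<Delta> (components U Y \<Delta> (act P \<tau> x)) = Omega \<Gamma> (components U Y \<Gamma> x) \<cdot> \<tau>"
  using Omega_sub[of \<tau> \<Delta> \<Gamma> "components U Y \<Gamma> x"] by (simp add: components_act components_Ty)

lemma ThTy_nat_trans: "nat_trans C (ThTy \<sigma> Y)" "src (ThTy \<sigma> Y) = P" "tgt (ThTy \<sigma> Y) = ty_psh C"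
proof -
  show "nat_trans C (ThTy \<sigma> Y)" unfolding ThTy_def \<sigma>(3)
  proof (rule nat_trans_mk[OF P ty_psh_psh], goal_cases)
    case (1 \<Gamma> x) then show ?case by (simp add: ty_psh_at Omega_components)
  next
    case (2 \<Delta> \<Gamma> \<tau> x)
    then show ?case by (simp add: ty_psh_act Omega_components Omega_components_act)
  qed
qed (simp_all add: ThTy_def \<sigma>)

lemma ThTy_cpt: "x \<in> at P \<Gamma> \<Longrightarrow> cpt (ThTy \<sigma> Y) \<Gamma> x = Omega \<Gamma> (components U Y \<Gamma> x)"
  using at_Obj[OF P] by (simp add: ThTy_def cpt_mk \<sigma>(3))

text \<open>The natural numbers form a constant presheaf, so restriction fixes the argument n. An
  element of the function type is thus a family of terms of the substituted components, indexed by
  arrows and numbers and stable under restriction.\<close>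

lemma pi_families_iff:
  assumes "x \<in> at P \<Gamma>"
  shows "f \<in> pi_families U C P (pty_sub C \<N> \<sigma>) (fty_conv C (pext U C P (pty_sub C \<N> \<sigma>)) Y) \<Gamma> x \<longleftrightarrow>
    (\<forall>\<Delta> \<rho>. \<rho> \<in> hom C \<Delta> \<Gamma> \<longrightarrow>
       (\<forall>n. f \<Delta> \<rho> (unum U n) \<in> Tm C \<Delta> (components U Y \<Gamma> x n \<cdot> \<rho>))) \<and>
    (\<forall>\<Delta> \<rho> a. \<not> (\<rho> \<in> hom C \<Delta> \<Gamma> \<and> a \<in> range (unum U)) \<longrightarrow> f \<Delta> \<rho> a = undefined) \<and>
    (\<forall>\<Theta> \<Delta> \<rho> \<tau> n. \<rho> \<in> hom C \<Delta> \<Gamma> \<longrightarrow> \<tau> \<in> hom C \<Theta> \<Delta> \<longrightarrow>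
       tmsub C (components U Y \<Gamma> x n \<cdot> \<rho>) (f \<Delta> \<rho> (unum U n)) \<tau> = f \<Theta> (\<rho> \<odot> \<tau>) (unum U n))"
    (is "?L \<longleftrightarrow> ?R")
proof -
  let ?N = "pty_sub C \<N> \<sigma>"
  let ?B = "fty_conv C (pext U C P ?N) Y"
  have xr: "act P \<rho> x \<in> at P \<Delta>" "\<Delta> \<in> Obj C" if "\<rho> \<in> hom C \<Delta> \<Gamma>" for \<rho> \<Delta>
    using act_at[OF P that assms] homD[OF that] by auto
  have B: "at ?B (\<Delta>, upair U (act P \<rho> x) (unum U n)) = Tm C \<Delta> (components U Y \<Gamma> x n \<cdot> \<rho>)"
    if "\<rho> \<in> hom C \<Delta> \<Gamma>" for \<rho> \<Delta> n
    using xr[OF that] extN_at fun_cong[OF components_act[OF that assms], of n]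
    by (simp add: fty_conv_at components_def)
  have Bact: "act ?B (\<tau>, upair U (act P \<rho> x) (unum U n)) b = tmsub C (components U Y \<Gamma> x n \<cdot> \<rho>) b \<tau>"
    if r: "\<rho> \<in> hom C \<Delta> \<Gamma>" and t: "\<tau> \<in> hom C \<Theta> \<Delta>" and b: "b \<in> Tm C \<Delta> (components U Y \<Gamma> x n \<cdot> \<rho>)"
    for \<rho> \<Delta> \<tau> \<Theta> n b
    using fty_conv_act[OF t, of "upair U (act P \<rho> x) (unum U n)" "pext U C P ?N" b Y] xr[OF r] extN_at b
      fun_cong[OF components_act[OF r assms], of n]
    by (simp add: components_def)
  show ?thesis
  proof
    assume f: ?L
    have 1: "f \<Delta> \<rho> (unum U n) \<in> Tm C \<Delta> (components U Y \<Gamma> x n \<cdot> \<rho>)" if "\<rho> \<in> hom C \<Delta> \<Gamma>" for \<Delta> \<rho> n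
      using f that xr[OF that] B[OF that] unfolding pi_families_def mem_Collect_eq
      by (metis N_at rangeI)
    have 2: "f \<Delta> \<rho> a = undefined" if "\<not> (\<rho> \<in> hom C \<Delta> \<Gamma> \<and> a \<in> range (unum U))" for \<Delta> \<rho> a
      using f that xr unfolding pi_families_def mem_Collect_eq by (metis N_at)
    have 3: "tmsub C (components U Y \<Gamma> x n \<cdot> \<rho>) (f \<Delta> \<rho> (unum U n)) \<tau> = f \<Theta> (\<rho> \<odot> \<tau>) (unum U n)"
      if r: "\<rho> \<in> hom C \<Delta> \<Gamma>" and t: "\<tau> \<in> hom C \<Theta> \<Delta>" for \<Theta> \<Delta> \<rho> \<tau> n
    proof -
      have "unum U n \<in> at ?N (\<Delta>, act P \<rho> x)" using xr[OF r] by (simp add: N_at)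
      then have "act ?B (\<tau>, upair U (act P \<rho> x) (unum U n)) (f \<Delta> \<rho> (unum U n))
          = f \<Theta> (\<rho> \<odot> \<tau>) (act ?N (\<tau>, act P \<rho> x) (unum U n))"
        using f r t unfolding pi_families_def mem_Collect_eq by blast
      then show ?thesis using Bact[OF r t 1[OF r]] N_act[OF t] xr[OF r] by simp
    qed
    show ?R using 1 2 3 by blast
  next
    assume f: ?R
    show ?L unfolding pi_families_def mem_Collect_eq
    proof (intro conjI allI ballI, goal_cases)
      case (1 \<Delta> \<rho> a)
      then show ?case using f xr[of \<rho> \<Delta>] B[of \<rho> \<Delta>] by (auto simp: N_at)
    next
      case (2 \<Theta> \<Delta> \<rho> a \<tau>)
      then obtain n where a: "a = unum U n" using xr by (auto simp: N_at)
      show ?case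
        using f 2(1,3) Bact[OF 2(1,3)] N_act[OF 2(3)] xr[OF 2(1)] by (simp add: a)
    qed
  qed
qed

text \<open>A Yoneda argument: naturality forces f(\<Delta>, \<rho>, n) to be f(\<Gamma>, id, n)
  substituted along \<rho>. A compatible family thus amounts to a sequence of terms, and
  \<open>psi\<close> turns that sequence into a term of the product.\<close>

lemma family_bij:
  assumes x: "x \<in> at P \<Gamma>"
  shows "bij_betw (family \<Gamma> (components U Y \<Gamma> x)) (Tm C \<Gamma> (Omega \<Gamma> (components U Y \<Gamma> x)))
    (pi_families U C P (pty_sub C \<N> \<sigma>) (fty_conv C (pext U C P (pty_sub C \<N> \<sigma>)) Y) \<Gamma> x)"
    (is "bij_betw (family \<Gamma> ?F) ?T ?X")
proof (rule bij_betw_byWitness[where f' = "\<lambda>f. psi \<Gamma> ?F (\<lambda>n. f \<Gamma> (idn C \<Gamma>) (unum U n))"])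
  have G: "\<Gamma> \<in> Obj C" using at_Obj[OF P x] .
  note I = idn_hom[OF G]
  have F: "?F n \<in> Ty C \<Gamma>" for n using components_Ty[OF x] .
  note X = pi_families_iff[OF x]
  have phi: "phi \<Gamma> ?F w n \<in> Tm C \<Gamma> (?F n)" if "w \<in> ?T" for w n
    using phi_Tm[OF G F that] .
  have "family \<Gamma> ?F w \<in> ?X" if w: "w \<in> ?T" for w
    unfolding X
  proof (intro conjI allI impI, goal_cases)
    case (1 \<Delta> \<rho> n)
    then show ?case using tmsub_Tm[OF F phi[OF w]] by (simp add: family_apply)
  next
    case (2 \<Delta> \<rho> a) then show ?case by (auto simp: family_def)
  next
    case (3 \<Theta> \<Delta> \<rho> \<tau> n)
    then show ?case
      using tmsub_cmp[OF F phi[OF w] 3] cmp_hom[OF 3] by (simp add: family_apply)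
  qed
  then show "family \<Gamma> ?F ` ?T \<subseteq> ?X" by blast
  have at_id: "f \<Gamma> (idn C \<Gamma>) (unum U n) \<in> Tm C \<Gamma> (?F n)" if "f \<in> ?X" for f n
    using that I tysub_idn[OF G F] unfolding X by metis
  show "(\<lambda>f. psi \<Gamma> ?F (\<lambda>n. f \<Gamma> (idn C \<Gamma>) (unum U n))) ` ?X \<subseteq> ?T"
    by (auto intro!: psi_Tm G F at_id)
  show "\<forall>w \<in> ?T. psi \<Gamma> ?F (\<lambda>n. family \<Gamma> ?F w \<Gamma> (idn C \<Gamma>) (unum U n)) = w"
    using psi_phi[of \<Gamma> ?F, OF G F] tmsub_idn[OF G F phi] by (simp add: family_apply[OF I])
  have "family \<Gamma> ?F (psi \<Gamma> ?F (\<lambda>n. f \<Gamma> (idn C \<Gamma>) (unum U n))) \<Delta> \<rho> a = f \<Delta> \<rho> a" if f: "f \<in> ?X" for f \<Delta> \<rho> a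
  proof (cases "\<rho> \<in> hom C \<Delta> \<Gamma> \<and> a \<in> range (unum U)")
    case True
    then obtain n where r: "\<rho> \<in> hom C \<Delta> \<Gamma>" and a: "a = unum U n" by blast
    \<comment> \<open>Naturality of f along \<rho>, starting from the identity of \<Gamma>.\<close>
    have "tmsub C (?F n) (f \<Gamma> (idn C \<Gamma>) (unum U n)) \<rho> = f \<Delta> \<rho> (unum U n)"
      using f I r tysub_idn[OF G F] idn_cmp[OF r] unfolding X by metis
    then show ?thesis using phi_psi[OF G F at_id[OF f]] by (simp add: a family_apply[OF r])
  next
    case False
    then have "f \<Delta> \<rho> a = undefined" using f unfolding X by blast
    with False show ?thesis by (auto simp: family_def)
  qed
  then show "\<forall>f \<in> ?X. family \<Gamma> ?F (psi \<Gamma> ?F (\<lambda>n. f \<Gamma> (idn C \<Gamma>) (unum U n))) = f"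
    by (auto intro!: ext)
qed

text \<open>Follows from naturality of \<open>phi\<close>. The right-hand side is the action of
  \<open>pPi\<close> on a family before coding, with the same default value.\<close>

lemma family_sub:
  assumes t: "\<tau> \<in> hom C \<Delta> \<Gamma>" and x: "x \<in> at P \<Gamma>" and w: "w \<in> Tm C \<Gamma> (Omega \<Gamma> (components U Y \<Gamma> x))"
  shows "family \<Delta> (components U Y \<Delta> (act P \<tau> x)) (tmsub C (Omega \<Gamma> (components U Y \<Gamma> x)) w \<tau>)
    = (\<lambda>\<Theta> \<rho> a. if \<rho> \<in> hom C \<Theta> \<Delta> \<and> a \<in> range (unum U)
         then family \<Gamma> (components U Y \<Gamma> x) w \<Theta> (\<tau> \<odot> \<rho>) a else undefined)"
proof (intro ext)
  fix \<Theta> \<rho> a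
  let ?F = "components U Y \<Gamma> x"
  have G: "\<Gamma> \<in> Obj C" using homD[OF t] by simp
  have F: "?F n \<in> Ty C \<Gamma>" for n using components_Ty[OF x] .
  show "family \<Delta> (components U Y \<Delta> (act P \<tau> x)) (tmsub C (Omega \<Gamma> ?F) w \<tau>) \<Theta> \<rho> a
    = (if \<rho> \<in> hom C \<Theta> \<Delta> \<and> a \<in> range (unum U) then family \<Gamma> ?F w \<Theta> (\<tau> \<odot> \<rho>) a else undefined)"
  proof (cases "\<rho> \<in> hom C \<Theta> \<Delta> \<and> a \<in> range (unum U)")
    case True
    then obtain n where r: "\<rho> \<in> hom C \<Theta> \<Delta>" and a: "a = unum U n" by blast
    show ?thesis
      using tmsub_cmp[OF F[of n] phi_Tm[of \<Gamma> ?F, OF G F w] t r] phi_sub[of \<tau> \<Delta> \<Gamma> ?F, OF t F w, of n] components_act[OF t x]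
      by (simp add: a r family_apply[OF r] family_apply[OF cmp_hom[OF t r]])
  qed (auto simp: family_def)
qed

abbreviation "PiN \<equiv> pPi U C P (pty_sub C \<N> \<sigma>) (fty_conv C (pext U C P (pty_sub C \<N> \<sigma>)) Y)"

text \<open>The arguments of a family are codes of numbers, which form a small set, so the coding is
  faithful and the action may decode.\<close>

lemma ufam_inj_families:
  "inj_on (ufam U) (pi_families U C P (pty_sub C \<N> \<sigma>) (fty_conv C (pext U C P (pty_sub C \<N> \<sigma>)) Y) \<Gamma> x)"
proof (rule pi_families_inj)
  show "small U (at (pty_sub C \<N> \<sigma>) (\<Delta>, x))" for \<Delta> x
    by (rule small_subset[OF small_unum]) (simp add: N_at)
qed

text \<open>By \<open>family_bij\<close> every element of the fibre codes the family of some term of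
  the product; later arguments work with that term.\<close>

lemma PiN_at: "x \<in> at P \<Gamma> \<Longrightarrow> at PiN (\<Gamma>, x) =
    (\<lambda>w. ufam U (family \<Gamma> (components U Y \<Gamma> x) w)) ` Tm C \<Gamma> (Omega \<Gamma> (components U Y \<Gamma> x))"
  using at_Obj[OF P] family_bij[of x \<Gamma>] by (simp add: pPi_def pty_at bij_betw_def image_image[symmetric])

text \<open>Decoding returns the family by injectivity, and \<open>family_sub\<close> computes its
  restriction. In terms of the product, the action is substitution.\<close>

lemma PiN_act:
  assumes t: "\<tau> \<in> hom C \<Delta> \<Gamma>" and x: "x \<in> at P \<Gamma>" and w: "w \<in> Tm C \<Gamma> (Omega \<Gamma> (components U Y \<Gamma> x))"
  shows "act PiN (\<tau>, x) (ufam U (family \<Gamma> (components U Y \<Gamma> x) w))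
    = ufam U (family \<Delta> (components U Y \<Delta> (act P \<tau> x)) (tmsub C (Omega \<Gamma> (components U Y \<Gamma> x)) w \<tau>))"
proof -
  have D: "Dom C \<tau> = \<Delta>" "Cod C \<tau> = \<Gamma>" using homD[OF t] by auto
  have f: "family \<Gamma> (components U Y \<Gamma> x) w
      \<in> pi_families U C P (pty_sub C \<N> \<sigma>) (fty_conv C (pext U C P (pty_sub C \<N> \<sigma>)) Y) \<Gamma> x"
    using family_bij[OF x] w by (auto simp: bij_betw_def)
  have N: "at (pty_sub C \<N> \<sigma>) (\<Theta>, act P \<rho> (act P \<tau> x)) = range (unum U)" if "\<rho> \<in> hom C \<Theta> \<Delta>" for \<Theta> \<rho>
    using act_at[OF P that act_at[OF P t x]] by (simp add: N_at)
  show ?thesis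
    unfolding pPi_def family_sub[OF assms]
    by (subst pty_act[OF t x])
      (use f in \<open>auto simp: D Let_def inv_into_f_f[OF ufam_inj_families f] N intro!: arg_cong[where f = "ufam U"] ext\<close>)
qed

lemma conv_ThTy_at: "x \<in> at P \<Gamma> \<Longrightarrow> at (fty_conv C P (ThTy \<sigma> Y)) (\<Gamma>, x) = Tm C \<Gamma> (Omega \<Gamma> (components U Y \<Gamma> x))"
  using at_Obj[OF P] by (simp add: fty_conv_at ThTy_cpt)

text \<open>The presheaf laws are transported along \<open>PiN_at\<close> and \<open>PiN_act\<close>
  from the laws of substitution for terms of the product.\<close>

lemma PiN_psh: "presheaf (elements C P) PiN"
proof -
  \<comment> \<open>\<open>pty_mk\<close> concerns values of \<open>mk_psh\<close>. Rebuilding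
    \<open>PiN\<close> from its own fibres and action changes nothing, by
    \<open>mk_psh_idem\<close>.\<close>
  have "presheaf (elements C P) (mk_psh (elements C P) (at PiN) (act PiN))"
  proof (rule pty_mk[OF P], goal_cases)
    case (1 \<Delta> \<Gamma> \<tau> x v)
    then obtain w where w: "w \<in> Tm C \<Gamma> (Omega \<Gamma> (components U Y \<Gamma> x))"
      and v: "v = ufam U (family \<Gamma> (components U Y \<Gamma> x) w)" by (auto simp: PiN_at)
    show ?case
      unfolding v PiN_act[OF 1(1,2) w] PiN_at[OF act_at[OF P 1(1,2)]]
      using tmsub_Tm[OF Omega_components[OF 1(2)] w 1(1)] Omega_components_act[OF 1(1,2)] by simp
  next
    case (2 \<Gamma> x v)
    then obtain w where w: "w \<in> Tm C \<Gamma> (Omega \<Gamma> (components U Y \<Gamma> x))"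
      and v: "v = ufam U (family \<Gamma> (components U Y \<Gamma> x) w)" by (auto simp: PiN_at)
    show ?case
      unfolding v PiN_act[OF idn_hom[OF 2(1)] 2(2) w]
      by (simp add: tmsub_idn[OF 2(1) Omega_components[OF 2(2)] w] act_idn[OF P 2(2)])
  next
    case (3 \<Theta> \<Delta> \<Gamma> \<tau> \<rho> x v)
    then obtain w where w: "w \<in> Tm C \<Gamma> (Omega \<Gamma> (components U Y \<Gamma> x))"
      and v: "v = ufam U (family \<Gamma> (components U Y \<Gamma> x) w)" by (auto simp: PiN_at)
    note O = Omega_components[OF 3(3)] and a = Omega_components_act[OF 3(1,3)]
    have w': "tmsub C (Omega \<Gamma> (components U Y \<Gamma> x)) w \<tau>
        \<in> Tm C \<Delta> (Omega \<Delta> (components U Y \<Delta> (act P \<tau> x)))"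
      using tmsub_Tm[OF O w 3(1)] a by simp
    show ?case
      unfolding v PiN_act[OF 3(1,3) w] PiN_act[OF 3(2) act_at[OF P 3(1,3)] w']
        PiN_act[OF cmp_hom[OF 3(1,2)] 3(3) w]
      using tmsub_cmp[OF O w 3(1,2)] a act_cmp[OF P 3(1-3)] by simp
  qed
  then show ?thesis
    unfolding pPi_def category.mk_psh_idem[OF elements_category[OF P]] .
qed

text \<open>The fibre map is the bijection \<open>family_bij\<close> followed by the injective
  coding, and \<open>PiN_act\<close> is its naturality.\<close>

lemma iso_ty_iso: "ty_iso \<D> P (fty_conv C P (ThTy \<sigma> Y)) PiN (iso \<sigma> Y)"
  unfolding iso_def Let_def \<sigma>(3)
proof (rule ty_iso_mk[OF P _ PiN_psh, where k = "\<lambda>\<Gamma> x w. ufam U (family \<Gamma> (components U Y \<Gamma> x) w)"], goal_cases)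
  case 1 show ?case using fty_conv_psh[OF ThTy_nat_trans(1,3)] by (simp add: ThTy_nat_trans)
next
  case (2 \<Gamma> x)
  then show ?case
    using bij_betw_trans[OF family_bij[OF 2(2)] inj_on_imp_bij_betw[OF ufam_inj_families, of \<Gamma> x]]
    by (simp add: conv_ThTy_at PiN_at comp_def bij_betw_def image_image)
next
  case (3 \<Delta> \<Gamma> \<tau> x w)
  then have w: "w \<in> Tm C \<Gamma> (Omega \<Gamma> (components U Y \<Gamma> x))" by (simp add: conv_ThTy_at)
  show ?case
    using PiN_act[OF 3(1,2) w] fty_conv_act[OF 3(1,2), of w "ThTy \<sigma> Y"] w ThTy_cpt[OF 3(2)] by simp
qed

text \<open>By \<open>isContr_psh\<close> the given term consists of contractions of all components,
  stable under restriction. \<open>Omega_contr\<close> combines them over each x, and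
  \<open>Omega_contr_sub\<close> makes the result stable.\<close>

lemma ThTm_Tm:
  assumes t: "t \<in> Tm (fib_cwf \<D>) (pext U C P (pty_sub C \<N> \<sigma>))
    (isContr (fib_cwf \<D>) (pext U C P (pty_sub C \<N> \<sigma>)) Y)"
  shows "ThTm \<sigma> Y t \<in> Tm (fib_cwf \<D>) P (isContr (fib_cwf \<D>) P (ThTy \<sigma> Y))"
proof -
  let ?E = "pext U C P (pty_sub C \<N> \<sigma>)"
  have E: "presheaf C ?E" using pext_psh[OF P N_psh] .
  let ?c = "mk_ntrans C ?E (ty_psh C) (\<lambda>\<Gamma> x. isContr C \<Gamma> (cpt Y \<Gamma> x))"
  have t: "t \<in> ptms C ?E (fty_conv C ?E ?c)"
    using t isContr_psh[OF Y] by (simp add: fib_cwf_simps(1,2))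
  have tm: "t \<Gamma> (upair U x (unum U n)) \<in> Tm C \<Gamma> (isContr C \<Gamma> (components U Y \<Gamma> x n))" if x: "x \<in> at P \<Gamma>" for \<Gamma> x n
    using ptmsD(2)[OF E t, of "upair U x (unum U n)" \<Gamma>] extN_at x at_Obj[OF P x]
    by (simp add: fty_conv_at cpt_mk components_def)
  have tsub: "tmsub C (isContr C \<Gamma> (components U Y \<Gamma> x n)) (t \<Gamma> (upair U x (unum U n))) \<tau>
      = t \<Delta> (upair U (act P \<tau> x) (unum U n))" if \<tau>: "\<tau> \<in> hom C \<Delta> \<Gamma>" and x: "x \<in> at P \<Gamma>" for \<tau> \<Delta> \<Gamma> x n
    using ptmsD(3)[OF E t \<tau>, of "upair U x (unum U n)"] extN_at x extN_act[OF \<tau> x, of n] at_Obj[OF P x]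
      fty_conv_act[OF \<tau>, of "upair U x (unum U n)" ?E _ ?c] tm[OF x, of n]
    by (simp add: cpt_mk components_def)
  have "ThTm \<sigma> Y t \<in> ptms C P (fty_conv C P (isContr (fib_cwf \<D>) P (ThTy \<sigma> Y)))"
    unfolding ThTm_def \<sigma>(3) isContr_psh[OF ThTy_nat_trans(1,3,2)]
  proof (rule ptms_mk[OF P], goal_cases)
    case (1 \<Gamma> x)
    then show ?case using Omega_contr_Tm[OF 1(1) components_Ty[OF 1(2)] tm[OF 1(2)]]
      by (simp add: fty_conv_at cpt_mk ThTy_cpt)
  next
    case (2 \<Delta> \<Gamma> \<tau> x)
    have G: "\<Gamma> \<in> Obj C" using homD[OF 2(1)] by simp
    show ?case
      using Omega_contr_Tm[OF G components_Ty[OF 2(2)] tm[OF 2(2)]]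
        Omega_contr_sub[OF G components_Ty[OF 2(2)] tm[OF 2(2)] 2(1)]
        tsub[OF 2] components_act[OF 2] 2(2) G
      by (subst fty_conv_act[OF 2]) (simp_all add: cpt_mk ThTy_cpt)
  qed
  then show "ThTm \<sigma> Y t \<in> Tm (fib_cwf \<D>) P (isContr (fib_cwf \<D>) P (ThTy \<sigma> Y))"
    by (simp add: fib_cwf_simps(1,2))
qed

end

end

section \<open>Naturality of the cofibrancy data in the base presheaf\<close>

context
  fixes \<sigma> \<tau> Y :: "('o, 'm, 'u) ntrans" and P :: "('o, 'm, 'u) psh"
  assumes \<sigma>: "nat_trans C \<sigma>" "tgt \<sigma> = pterminal U C" "src \<sigma> = P"
    and Y: "nat_trans C Y" "tgt Y = ty_psh C" "src Y = pext U C P (pty_sub C \<N> \<sigma>)"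
    and \<tau>: "nat_trans C \<tau>" "tgt \<tau> = P"
begin

abbreviation "Y\<tau> \<equiv> ncomp C Y (\<tau> \<up>\<^bsub>\<D>\<^esub> pty_sub C \<N> \<sigma>)"

lemma pty_sub_ncomp: "pty_sub C \<N> (ncomp C \<sigma> \<tau>) = pty_sub C (pty_sub C \<N> \<sigma>) \<tau>"
  using cwf.tysub_cmp[OF psh_cwf, of \<N> "pterminal U C" \<sigma> P \<tau> "src \<tau>"] exo_nat_psh \<sigma> \<tau>
  by (simp add: D_hom)

lemma \<sigma>\<tau>: "nat_trans C (ncomp C \<sigma> \<tau>)" "tgt (ncomp C \<sigma> \<tau>) = pterminal U C" "src (ncomp C \<sigma> \<tau>) = src \<tau>"
  using ncomp_nat[OF \<sigma>(1) \<tau>(1)] \<sigma> \<tau> by simp_all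

lemma N_psh': "presheaf (elements C (tgt \<tau>)) (pty_sub C \<N> \<sigma>)"
  using N_psh[OF \<sigma>] \<tau>(2) by simp

lemma \<tau>_at: "x \<in> at (src \<tau>) \<Gamma> \<Longrightarrow> cpt \<tau> \<Gamma> x \<in> at P \<Gamma>"
  using nat_transD(3)[OF \<tau>(1)] \<tau>(2) by simp

lemma lift_cpt:
  "x \<in> at (src \<tau>) \<Gamma> \<Longrightarrow>
    cpt (\<tau> \<up>\<^bsub>\<D>\<^esub> pty_sub C \<N> \<sigma>) \<Gamma> (upair U x (unum U n)) = upair U (cpt \<tau> \<Gamma> x) (unum U n)"
  by (rule cpt_lift(4)[OF \<tau>(1) N_psh']) (simp_all add: N_at[OF \<sigma>] \<tau>_at)

lemma extN_at':
  "x \<in> at (src \<tau>) \<Gamma> \<Longrightarrow> upair U x (unum U n) \<in> at (src (\<tau> \<up>\<^bsub>\<D>\<^esub> pty_sub C \<N> \<sigma>)) \<Gamma>"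
  unfolding cpt_lift(2)[OF \<tau>(1) N_psh'] pty_sub_ncomp[symmetric] by (simp add: extN_at[OF \<sigma>\<tau>])

text \<open>The lift of \<tau> leaves the number untouched, so reindexing \<open>Y\<close> amounts
  to evaluating its components at \<tau>(x). All three naturality conditions rest on this.\<close>

lemma components_ncomp:
  "x \<in> at (src \<tau>) \<Gamma> \<Longrightarrow> components U Y\<tau> \<Gamma> x = components U Y \<Gamma> (cpt \<tau> \<Gamma> x)"
  unfolding components_def using at_Obj[OF nat_transD(1)[OF \<tau>(1)]] extN_at' lift_cpt
  by (simp add: cpt_ncomp)

lemma ThTy_ncomp: "ncomp C (ThTy \<sigma> Y) \<tau> = ThTy (ncomp C \<sigma> \<tau>) Y\<tau>"
  unfolding ncomp_def[of C "ThTy \<sigma> Y"] ThTy_nat_trans(3)[OF \<sigma> Y] unfolding ThTy_def[of "ncomp C \<sigma> \<tau>"] ncomp_src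
  by (rule mk_ntrans_cong) (simp add: ThTy_cpt[OF \<sigma> Y] \<tau>_at components_ncomp)

lemma ThTm_ncomp:
  "ptm_sub C (ThTm \<sigma> Y t) \<tau> = ThTm (ncomp C \<sigma> \<tau>) Y\<tau> (ptm_sub C t (\<tau> \<up>\<^bsub>\<D>\<^esub> pty_sub C \<N> \<sigma>))"
proof (rule ptm_eqI[where P = "src \<tau>"], goal_cases)
  case (3 \<Gamma> x)
  then show ?case
    using \<tau>_at[OF 3(2)] extN_at'[OF 3(2)]
    by (simp add: ThTm_def ptm_sub_def mk_ptm_app \<sigma>(3) components_ncomp lift_cpt)
qed (simp_all add: ptm_sub_def ThTm_def)

text \<open>Both composites send (x, w) to \<tau>(x) paired with the code of the family of
  \<open>w\<close>, since lifts change only the first coordinate.\<close>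

lemma iso_ncomp:
  "ncomp C (iso \<sigma> Y) (\<tau> \<up>\<^bsub>\<D>\<^esub> fty_conv C P (ThTy \<sigma> Y))
    = ncomp C (\<tau> \<up>\<^bsub>\<D>\<^esub> pPi U C P (pty_sub C \<N> \<sigma>) (fty_conv C (pext U C P (pty_sub C \<N> \<sigma>)) Y))
        (iso (ncomp C \<sigma> \<tau>) Y\<tau>)"
    (is "ncomp C ?i (\<tau> \<up>\<^bsub>\<D>\<^esub> ?c) = ncomp C (\<tau> \<up>\<^bsub>\<D>\<^esub> ?Pi) ?i'")
proof -
  have c: "presheaf (elements C (tgt \<tau>)) ?c"
    using fty_conv_psh[OF ThTy_nat_trans(1,3)[OF \<sigma> Y]] ThTy_nat_trans(2)[OF \<sigma> Y] \<tau>(2) by simp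
  have Pi: "presheaf (elements C (tgt \<tau>)) ?Pi" using PiN_psh[OF \<sigma> Y] \<tau>(2) by simp
  have cs: "pty_sub C ?c \<tau> = fty_conv C (src \<tau>) (ThTy (ncomp C \<sigma> \<tau>) Y\<tau>)"
    using two_level_cwf.conv_sub[OF psh_two_level, of "ThTy \<sigma> Y" P \<tau> "src \<tau>"]
      ThTy_nat_trans[OF \<sigma> Y] \<tau> ThTy_ncomp by (simp add: D_hom)
  \<comment> \<open>The sources agree through \<open>conv_sub\<close> and the targets by the formula
    for lifts, so both composites have the same ends and can be compared on elements.\<close>
  have s': "src ?i' = src (\<tau> \<up>\<^bsub>\<D>\<^esub> ?c)"
    unfolding cpt_lift(2)[OF \<tau>(1) c] cs by (simp add: iso_def Let_def)
  have t': "tgt ?i = tgt (\<tau> \<up>\<^bsub>\<D>\<^esub> ?Pi)"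
    unfolding cpt_lift(3)[OF \<tau>(1) Pi] \<tau>(2) by (simp add: iso_def Let_def \<sigma>(3))
  show ?thesis
    unfolding ncomp_def[of C ?i] ncomp_def[of C _ ?i'] s' t'
  proof (rule mk_ntrans_cong)
    fix \<Gamma> z assume G: "\<Gamma> \<in> Obj C" and z: "z \<in> at (src (\<tau> \<up>\<^bsub>\<D>\<^esub> ?c)) \<Gamma>"
    from z[unfolded cpt_lift(2)[OF \<tau>(1) c]] obtain x w where
      zw: "z = upair U x w" and x: "x \<in> at (src \<tau>) \<Gamma>" and w: "w \<in> at (pty_sub C ?c \<tau>) (\<Gamma>, x)"
      by (rule pext_atE)
    note tx = \<tau>_at[OF x]
    let ?F = "components U Y \<Gamma> (cpt \<tau> \<Gamma> x)"
    have w1: "w \<in> at ?c (\<Gamma>, cpt \<tau> \<Gamma> x)" using w x G by (simp add: pty_sub_at)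
    then have w2: "w \<in> Tm C \<Gamma> (Omega \<Gamma> ?F)" by (simp add: conv_ThTy_at[OF \<sigma> Y tx])
    have fP: "ufam U (family \<Gamma> ?F w) \<in> at ?Pi (\<Gamma>, cpt \<tau> \<Gamma> x)"
      unfolding PiN_at[OF \<sigma> Y tx] using w2 by blast
    have "upair U (cpt \<tau> \<Gamma> x) w \<in> at (pext U C P ?c) \<Gamma>"
      using tx w1 c \<tau>(2) P[OF \<sigma>] by (simp add: pext_at_iff)
    then have 1: "cpt ?i \<Gamma> (upair U (cpt \<tau> \<Gamma> x) w) = upair U (cpt \<tau> \<Gamma> x) (ufam U (family \<Gamma> ?F w))"
      using G by (simp add: iso_def Let_def \<sigma>(3) cpt_mk)
    have "z \<in> at (src ?i') \<Gamma>" using z s' by simp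
    then have 2: "cpt ?i' \<Gamma> z = upair U x (ufam U (family \<Gamma> ?F w))"
      using G by (simp add: iso_def Let_def cpt_mk zw components_ncomp[OF x])
    show "cpt ?i \<Gamma> (cpt (\<tau> \<up>\<^bsub>\<D>\<^esub> ?c) \<Gamma> z) = cpt (\<tau> \<up>\<^bsub>\<D>\<^esub> ?Pi) \<Gamma> (cpt ?i' \<Gamma> z)"
      unfolding 2 unfolding zw cpt_lift(4)[OF \<tau>(1) c x w1] cpt_lift(4)[OF \<tau>(1) Pi x fP] by (rule 1)
  qed
qed

end

lemma exo_nat_cofibrancy: "cofibrancy \<D> (One \<D>) \<N> ThTy iso ThTm"
proof (unfold_locales, goal_cases)
  case (1 \<sigma> P Y)
  then show ?case using ThTy_nat_trans[of \<sigma> P Y] by (simp add: D_hom)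
next
  case (2 \<sigma> P Y \<tau> Q)
  then show ?case using ThTy_ncomp[of \<sigma> P Y \<tau>] by (simp add: D_hom)
next
  case (3 \<sigma> P Y)
  then show ?case using iso_ty_iso[of \<sigma> P Y] by (simp add: D_hom)
next
  case (4 \<sigma> P Y \<tau> Q)
  then show ?case using iso_ncomp[of \<sigma> P Y \<tau>] by (simp add: D_hom)
next
  case (5 \<sigma> P Y t)
  then show ?case using ThTm_Tm[of \<sigma> P Y t] by (simp add: D_hom)
next
  case (6 \<sigma> P Y \<tau> Q t)
  then show ?case using ThTm_ncomp[of \<sigma> P Y \<tau> t] by (simp add: D_hom fib_cwf_simps(2))
qed

end

theorem theorem5p3:
  fixes C :: "('o, 'm, 'u, 'u) cwf_tt"
    and U :: "('o, 'm, 'u) universe"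
  assumes "set_universe U"
    and "cwf_type_formers C"
    and "has_exo_nat_products C"
  shows "cofibrant (psh_tlcwf U C) (One (psh_tlcwf U C)) (exo_nat U C)"
proof -
  obtain Omega phi psi iota where "exo_nat_products C Omega phi psi iota"
    using assms(3) by (auto simp: has_exo_nat_products_def)
  then interpret psh_exo_nat U C Omega phi psi iota
    using assms(1,2)
    by (simp add: psh_exo_nat_def psh_model_def cwf_exo_nat_def cwf_Pi_Sigma_Id_def
        cwf_type_formers_def exo_nat_products_def cwf_Pi_def)
  show ?thesis
    unfolding cofibrant_def using exo_nat_cofibrancy pterminal_psh exo_nat_psh by auto
qed

end
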